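(* Let $A$ be an abelian group of central type whose order is $n^2$ and let $[\alpha]\in H^2(A,\mathbb{C}^* )$ be non-degenerate. Let $[\mathbb{C}^{\alpha}A]_{\mathbb{C}}\subseteq\mathrm{Grad}(M_n(\mathbb{C}))$ be the set of all elementary quotient grading classes of $[\mathbb{C}^{\alpha}A]$, partially ordered by $\leq$. Then: (1) An elementary quotient grading class in $[\mathbb{C}^{\alpha}A]_{\mathbb{C}}$ is maximal in $[\mathbb{C}^{\alpha}A]_{\mathbb{C}}$ if and only if it is an elementary crossed product grading class. (2) There is a unique maximal class in $[\mathbb{C}^{\alpha}A]_{\mathbb{C}}$ if and only if $A$ is elementary abelian (in the sense that every element of $A$ has square-free order).
   Context: A $\Gamma$-grading of a complex algebra $\mathcal{A}$ is a decomposition $\mathcal{A}=\bigoplus_{\gamma\in\Gamma}\mathcal{A}_\gamma$ with $\mathcal{A}_{\gamma_1}\mathcal{A}_{\gamma_2}\subseteq\mathcal{A}_{\gamma_1\gamma_2}$; it is connected if $\{\gamma:\mathcal{A}_\gamma\neq0\}$ generates $\Gamma$. A quotient morphism from a $\Gamma_1$-grading of $\mathcal{A}$ to a $\Gamma_2$-grading of $\mathcal{B}$ is a pair $(\psi,\phi)$ of an algebra isomorphism $\psi:\mathcal{A}\to\mathcal{B}$ and a surjective group homomorphism $\phi:\Gamma_1\to\Gamma_2$ with $\psi(\mathcal{A}_\gamma)\subseteq\mathcal{B}_{\phi(\gamma)}$ for all $\gamma$; it is a graded-equivalence if $\phi$ is an isomorphism. $[\cdot]$ denotes the graded-equivalence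 class, and $\mathrm{Grad}(\mathcal{A})$ the set of classes of connected gradings of a finite-dimensional algebra $\mathcal{A}$. It is partially ordered by: $[\mathcal{G}_2]\leq[\mathcal{G}_1]$ if there is a quotient morphism $\mathcal{G}_1\to\mathcal{G}_2$ ($[\mathcal{G}_2]$ is then a graded quotient of $[\mathcal{G}_1]$). For a finite group $G$ and $\alpha\in Z^2(G,\mathbb{C}^* )$ (trivial action), $\mathbb{C}^{\alpha}G=\bigoplus_{g\in G}\mathbb{C}u_g$, $u_gu_h=\alpha(g,h)u_{gh}$, is graded by $G$ via $(\mathbb{C}^{\alpha}G)_g=\mathbb{C}u_g$. The class $[\alpha]$ is non-degenerate if $\mathbb{C}^{\alpha}G$ is simple, i.e. isomorphic to $M_n(\mathbb{C})$ with $n^2=|G|$; $G$ is of central type if it admits a non-degenerate class. For a group $\Gamma$ and $x=\sum_{i=1}^r\gamma_i\in\mathbb{N}[\Gamma]$, $x(\mathbb{C})$ is the $\Gamma$-grading of $M_r(\mathbb{C})$ in which the matrix unit $E_{i,j}$ has degree $\gamma_i\gamma_j^{-1}$; gradings (and classes) of this form are called elementary. For a finite group $\Gamma$ of order $n$, the elementary crossed product $\Gamma$-grading of $M_n(\mathbb{C})$ is $\left(\sum_{\gamma\in\Gamma}\gamma\right)(\mathbb{C})$. *)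

theory Defs
  imports
    "Jordan_Normal_Form.VS_Connect"
    "HOL-Algebra.QuotRing"
    "HOL-Algebra.Generated_Groups"
    "HOL-Algebra.Multiplicative_Group"
    "HOL-Computational_Algebra.Squarefree"
begin

text \<open>The locale \<open>algebra\<close> of HOL-Algebra is restricted to commutative algebras.\<close>

locale complex_algebra = vectorspace class_ring M + ring M
  for M :: "(complex, 'v) module" (structure) +
  assumes smult_mult_left:
      "\<lbrakk>x \<in> carrier M; y \<in> carrier M\<rbrakk> \<Longrightarrow> (c \<odot> x) \<otimes> y = c \<odot> (x \<otimes> y)"
    and smult_mult_right:
      "\<lbrakk>x \<in> carrier M; y \<in> carrier M\<rbrakk> \<Longrightarrow> x \<otimes> (c \<odot> y) = c \<odot> (x \<otimes> y)"

definition algebra_iso :: "(complex, 'v) module \<Rightarrow> (complex, 'w) module \<Rightarrow> ('v \<Rightarrow> 'w) set" where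
  "algebra_iso M N =
    {\<psi> \<in> ring_iso M N. \<forall>c. \<forall>x\<in>carrier M. \<psi> (c \<odot>\<^bsub>M\<^esub> x) = c \<odot>\<^bsub>N\<^esub> \<psi> x}"

definition simple_algebra :: "(complex, 'v) module \<Rightarrow> bool" where
  "simple_algebra M \<longleftrightarrow> complex_algebra M \<and> carrier M \<noteq> {\<zero>\<^bsub>M\<^esub>} \<and>
    (\<forall>I. ideal I M \<longrightarrow> I = {\<zero>\<^bsub>M\<^esub>} \<or> I = carrier M)"

abbreviation matrix_algebra :: "nat \<Rightarrow> (complex, complex mat) module" where
  "matrix_algebra n \<equiv> module_mat TYPE(complex) n n"

text \<open>A grading consists of the grading group and the family of homogeneous components;
  the values of the family outside the carrier of the group are irrelevant.\<close>

type_synonym ('g, 'v) grading = "'g monoid \<times> ('g \<Rightarrow> 'v set)"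

definition is_grading :: "(complex, 'v) module \<Rightarrow> ('g, 'v) grading \<Rightarrow> bool" where
  "is_grading M = (\<lambda>(\<Gamma>, V).
    complex_algebra M \<and> group \<Gamma> \<and>
    (\<forall>\<gamma>\<in>carrier \<Gamma>. VectorSpace.subspace class_ring (V \<gamma>) M) \<and>
    (\<forall>x\<in>carrier M. \<exists>!f. f \<in> (\<Pi>\<^sub>E \<gamma>\<in>carrier \<Gamma>. V \<gamma>) \<and>
        finite {\<gamma>\<in>carrier \<Gamma>. f \<gamma> \<noteq> \<zero>\<^bsub>M\<^esub>} \<and>
        x = (\<Oplus>\<^bsub>M\<^esub>\<gamma>\<in>{\<gamma>\<in>carrier \<Gamma>. f \<gamma> \<noteq> \<zero>\<^bsub>M\<^esub>}. f \<gamma>)) \<and>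
    (\<forall>\<gamma>\<^sub>1\<in>carrier \<Gamma>. \<forall>\<gamma>\<^sub>2\<in>carrier \<Gamma>. \<forall>x\<in>V \<gamma>\<^sub>1. \<forall>y\<in>V \<gamma>\<^sub>2.
        x \<otimes>\<^bsub>M\<^esub> y \<in> V (\<gamma>\<^sub>1 \<otimes>\<^bsub>\<Gamma>\<^esub> \<gamma>\<^sub>2)))"

definition connected_grading :: "(complex, 'v) module \<Rightarrow> ('g, 'v) grading \<Rightarrow> bool" where
  "connected_grading M = (\<lambda>(\<Gamma>, V). is_grading M (\<Gamma>, V) \<and>
    generate \<Gamma> {\<gamma>\<in>carrier \<Gamma>. V \<gamma> \<noteq> {\<zero>\<^bsub>M\<^esub>}} = carrier \<Gamma>)"

definition quotient_morphism ::
    "(complex, 'v) module \<Rightarrow> ('g, 'v) grading \<Rightarrow> (complex, 'w) module \<Rightarrow> ('h, 'w) grading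
      \<Rightarrow> ('v \<Rightarrow> 'w) \<Rightarrow> ('g \<Rightarrow> 'h) \<Rightarrow> bool" where
  "quotient_morphism M \<G>\<^sub>1 N \<G>\<^sub>2 \<psi> \<phi> \<longleftrightarrow>
    \<psi> \<in> algebra_iso M N \<and>
    \<phi> \<in> hom (fst \<G>\<^sub>1) (fst \<G>\<^sub>2) \<and> \<phi> ` carrier (fst \<G>\<^sub>1) = carrier (fst \<G>\<^sub>2) \<and>
    (\<forall>\<gamma>\<in>carrier (fst \<G>\<^sub>1). \<psi> ` snd \<G>\<^sub>1 \<gamma> \<subseteq> snd \<G>\<^sub>2 (\<phi> \<gamma>))"

definition graded_equivalent ::
    "(complex, 'v) module \<Rightarrow> ('g, 'v) grading \<Rightarrow> (complex, 'w) module \<Rightarrow> ('h, 'w) grading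
      \<Rightarrow> bool" where
  "graded_equivalent M \<G>\<^sub>1 N \<G>\<^sub>2 \<longleftrightarrow>
    (\<exists>\<psi> \<phi>. quotient_morphism M \<G>\<^sub>1 N \<G>\<^sub>2 \<psi> \<phi> \<and> \<phi> \<in> iso (fst \<G>\<^sub>1) (fst \<G>\<^sub>2))"

text \<open>A connected grading of a finite-dimensional algebra has a finite support generating its
  group, so its group is countable and isomorphic to one whose carrier consists of natural
  numbers. Hence every graded-equivalence class has representatives graded by groups of type
  \<open>nat monoid\<close>, and no class is lost by admitting only those.\<close>

definition connected_gradings :: "(complex, 'v) module \<Rightarrow> (nat, 'v) grading set" where
  "connected_gradings M = {\<G>. connected_grading M \<G>}"

definition graded_equiv_rel :: "(complex, 'v) module \<Rightarrow> (nat, 'v) grading rel" where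
  "graded_equiv_rel M = {(\<G>, \<H>). \<G> \<in> connected_gradings M \<and> \<H> \<in> connected_gradings M \<and>
    graded_equivalent M \<G> M \<H>}"

definition Grad :: "(complex, 'v) module \<Rightarrow> (nat, 'v) grading set set" where
  "Grad M = connected_gradings M // graded_equiv_rel M"

text \<open>\<open>grading_class M N \<G>\<close> is the class \<open>[\<G>]\<close>, as an element of \<open>Grad M\<close>, of a connected
  grading \<open>\<G>\<close> (by a group of any type) of an algebra \<open>N\<close> isomorphic to \<open>M\<close>.\<close>

definition grading_class ::
    "(complex, 'v) module \<Rightarrow> (complex, 'w) module \<Rightarrow> ('g, 'w) grading \<Rightarrow> (nat, 'v) grading set" where
  "grading_class M N \<G> = {\<H> \<in> connected_gradings M. graded_equivalent N \<G> M \<H>}"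

definition class_le ::
    "(complex, 'v) module \<Rightarrow> (nat, 'v) grading set \<Rightarrow> (nat, 'v) grading set \<Rightarrow> bool" where
  "class_le M X\<^sub>2 X\<^sub>1 \<longleftrightarrow>
    (\<exists>\<G>\<^sub>1\<in>X\<^sub>1. \<exists>\<G>\<^sub>2\<in>X\<^sub>2. \<exists>\<psi> \<phi>. quotient_morphism M \<G>\<^sub>1 M \<G>\<^sub>2 \<psi> \<phi>)"

definition maximal_class ::
    "(complex, 'v) module \<Rightarrow> (nat, 'v) grading set set \<Rightarrow> (nat, 'v) grading set \<Rightarrow> bool" where
  "maximal_class M S X \<longleftrightarrow> X \<in> S \<and> (\<forall>Y\<in>S. class_le M X Y \<longrightarrow> Y = X)"

definition two_cocycle :: "'a monoid \<Rightarrow> ('a \<Rightarrow> 'a \<Rightarrow> complex) \<Rightarrow> bool" where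
  "two_cocycle G \<alpha> \<longleftrightarrow>
    (\<forall>g\<in>carrier G. \<forall>h\<in>carrier G. \<alpha> g h \<noteq> 0) \<and>
    (\<forall>g\<in>carrier G. \<forall>h\<in>carrier G. \<forall>k\<in>carrier G.
      \<alpha> g h * \<alpha> (g \<otimes>\<^bsub>G\<^esub> h) k = \<alpha> h k * \<alpha> g (h \<otimes>\<^bsub>G\<^esub> k))"

text \<open>The function \<open>f\<close> stands for the formal sum of the \<open>f g \<cdot> u\<^sub>g\<close>. Cocycles need not be
  normalized, so the identity is \<open>\<alpha>(1,1)\<^sup>-\<^sup>1 \<cdot> u\<^sub>1\<close>.\<close>

definition basis_elem :: "'a \<Rightarrow> 'a \<Rightarrow> complex" where
  "basis_elem g = (\<lambda>h. if h = g then 1 else 0)"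

definition twisted_group_algebra ::
    "'a monoid \<Rightarrow> ('a \<Rightarrow> 'a \<Rightarrow> complex) \<Rightarrow> (complex, 'a \<Rightarrow> complex) module" where
  "twisted_group_algebra G \<alpha> = \<lparr>
    carrier = {f. \<forall>g. g \<notin> carrier G \<longrightarrow> f g = 0},
    monoid.mult = (\<lambda>f f' k.
      \<Sum>(g, h) \<in> {(g, h) \<in> carrier G \<times> carrier G. g \<otimes>\<^bsub>G\<^esub> h = k}. \<alpha> g h * (f g * f' h)),
    one = (\<lambda>k. inverse (\<alpha> \<one>\<^bsub>G\<^esub> \<one>\<^bsub>G\<^esub>) * basis_elem \<one>\<^bsub>G\<^esub> k),
    zero = (\<lambda>k. 0),
    add = (\<lambda>f f' k. f k + f' k),
    module.smult = (\<lambda>c f k. c * f k)\<rparr>"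

definition twisted_grading :: "'a monoid \<Rightarrow> ('a, 'a \<Rightarrow> complex) grading" where
  "twisted_grading G = (G, \<lambda>g. {\<lambda>k. c * basis_elem g k | c. True})"

definition nondegenerate :: "'a monoid \<Rightarrow> ('a \<Rightarrow> 'a \<Rightarrow> complex) \<Rightarrow> bool" where
  "nondegenerate G \<alpha> \<longleftrightarrow> two_cocycle G \<alpha> \<and> simple_algebra (twisted_group_algebra G \<alpha>)"

definition central_type :: "'a monoid \<Rightarrow> bool" where
  "central_type G \<longleftrightarrow> group G \<and> finite (carrier G) \<and> (\<exists>\<alpha>. nondegenerate G \<alpha>)"

text \<open>The element \<open>s 0 + \<dots> + s (n - 1)\<close> of \<open>\<nat>[\<Gamma>]\<close> is given by the family \<open>s\<close>; the component
  of degree \<open>\<gamma>\<close> is the span of the matrix units \<open>E\<^sub>i\<^sub>j\<close> with \<open>s i \<otimes> inv (s j) = \<gamma>\<close>. Reordering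
  the family yields an equivalent grading.\<close>

definition elementary_grading ::
    "nat \<Rightarrow> 'g monoid \<Rightarrow> (nat \<Rightarrow> 'g) \<Rightarrow> ('g, complex mat) grading" where
  "elementary_grading n \<Gamma> s = (\<Gamma>, \<lambda>\<gamma>. {B \<in> carrier_mat n n.
    \<forall>i<n. \<forall>j<n. B $$ (i, j) \<noteq> 0 \<longrightarrow> s i \<otimes>\<^bsub>\<Gamma>\<^esub> inv\<^bsub>\<Gamma>\<^esub> (s j) = \<gamma>})"

definition elementary_class :: "nat \<Rightarrow> (nat, complex mat) grading set \<Rightarrow> bool" where
  "elementary_class n X \<longleftrightarrow> X \<in> Grad (matrix_algebra n) \<and>
    (\<exists>(\<Gamma> :: nat monoid) s. group \<Gamma> \<and> s \<in> {..<n} \<rightarrow> carrier \<Gamma> \<and>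
      X = grading_class (matrix_algebra n) (matrix_algebra n) (elementary_grading n \<Gamma> s))"

definition elementary_crossed_product_class :: "nat \<Rightarrow> (nat, complex mat) grading set \<Rightarrow> bool" where
  "elementary_crossed_product_class n X \<longleftrightarrow> X \<in> Grad (matrix_algebra n) \<and>
    (\<exists>(\<Gamma> :: nat monoid) s. group \<Gamma> \<and> bij_betw s {..<n} (carrier \<Gamma>) \<and>
      X = grading_class (matrix_algebra n) (matrix_algebra n) (elementary_grading n \<Gamma> s))"

definition elementary_quotient_classes ::
    "nat \<Rightarrow> 'a monoid \<Rightarrow> ('a \<Rightarrow> 'a \<Rightarrow> complex) \<Rightarrow> (nat, complex mat) grading set set" where
  "elementary_quotient_classes n A \<alpha> = {X. elementary_class n X \<and>
    class_le (matrix_algebra n) X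
      (grading_class (matrix_algebra n) (twisted_group_algebra A \<alpha>) (twisted_grading A))}"

end

theory Submission
  imports Defs "HOL-Algebra.Sylow"
begin

text \<open>What orders two quotients is the inclusion of their kernels, once both are seen as
  images of the same grading of the twisted group algebra. The classes themselves consist of
  gradings of the matrix algebra by groups on natural numbers, so comparisons of classes are first
  turned into comparisons of quotient morphisms out of \<open>T\<close>. Since |N| |perp N| = n^2, a
  Lagrangian has order n and so has its quotient group; n is also the size of the matrices, so an
  enumeration of that group is exactly a crossed product family. Maximality is then a count: every
  elementary quotient group is an image of a group of order n, and a surjection from it onto a group
  of order n must be an isomorphism. Simplicity enters twice, each time through an explicit ideal:
  an eigenspace gives the non-degeneracy of the form, a kernel gives injectivity of the
  representation on the cosets. Surjectivity of that representation comes from an orthogonality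
  relation, which yields an explicit inverse. In part (2) the isomorphism type of A/L suffices
  because relabelling a crossed product family amounts to conjugation by a permutation
  matrix.\<close>

text \<open>
  The commutator \<open>\<omega>(g, h) = \<alpha>(g, h) / \<alpha>(h, g)\<close> is an alternating bicharacter of \<open>A\<close>, and simplicity of
  the twisted group algebra makes it non-degenerate. Quotient gradings correspond to subgroups \<open>N\<close> of
  \<open>A\<close>, the kernels. If the quotient by \<open>N\<close> is elementary, then its identity component contains the
  diagonal matrices, which forces \<open>N\<^sup>\<bottom> \<subseteq> N\<close>; so \<open>N\<close> contains a Lagrangian \<open>L = L\<^sup>\<bottom>\<close>. Conversely, for
  a Lagrangian \<open>L\<close> the cocycle splits on \<open>L\<close>, and inducing the resulting character of the
  twisted group algebra of \<open>L\<close> identifies the quotient by \<open>L\<close> with the elementary crossed product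
  grading by \<open>A/L\<close>, a group of order \<open>n\<close>. Hence the maximal classes are those of the Lagrangian
  quotients, and they are determined by the isomorphism type of \<open>A/L\<close>. If all orders are square-free,
  the order \<open>n\<close> determines this type. Otherwise two Lagrangians with quotients of different
  exponents exist.
\<close>

section \<open>Extension of homomorphisms of abelian groups\<close>

lemma (in group) mult_inv_cancel:
  assumes "x \<in> carrier G" "y \<in> carrier G"
  shows "inv x \<otimes> (x \<otimes> y) = y" "x \<otimes> (inv x \<otimes> y) = y"
  using assms by (simp_all add: m_assoc[symmetric])

lemma (in comm_group) subgroup_is_comm_group:
  assumes H: "subgroup H G" shows "comm_group (G\<lparr>carrier := H\<rparr>)"
  using subgroup.subgroup_is_group[OF H is_group] subgroup.mem_carrier[OF H]
  by (intro group.group_comm_groupI) (auto simp: m_comm)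

text \<open>Two expressions of one element differ by a power of y that lies in K, and
  \<open>yz\<close> says that f already agrees with z on such powers. \<open>K'\<close> and
  \<open>F\<close> are described explicitly because one application must also prove that the
  extension stays injective.\<close>

lemma (in comm_group) hom_extend_by_element:
  assumes H: "comm_group H" and K: "subgroup K G" and f: "f \<in> hom (G\<lparr>carrier := K\<rparr>) H"
    and y: "y \<in> carrier G" and z: "z \<in> carrier H"
    and yz: "\<And>i::int. y [^] i \<in> K \<Longrightarrow> f (y [^] i) = z [^]\<^bsub>H\<^esub> i"
  shows "\<exists>K' F. subgroup K' G \<and> K' = {k \<otimes> y [^] i | k (i::int). k \<in> K} \<and>
    F \<in> hom (G\<lparr>carrier := K'\<rparr>) H \<and>
    (\<forall>k\<in>K. \<forall>i::int. F (k \<otimes> y [^] i) = f k \<otimes>\<^bsub>H\<^esub> z [^]\<^bsub>H\<^esub> i)"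
proof -
  interpret H: comm_group H by (rule H)
  have KG: "k \<in> carrier G" if "k \<in> K" for k using subgroup.mem_carrier[OF K that] .
  have fc: "f k \<in> carrier H" if "k \<in> K" for k using f that by (auto simp: hom_def)
  have fm: "f (k \<otimes> l) = f k \<otimes>\<^bsub>H\<^esub> f l" if "k \<in> K" "l \<in> K" for k l
    using f that by (auto simp: hom_def)
  define K' where "K' = {k \<otimes> y [^] i | k (i::int). k \<in> K}"
  \<comment> \<open>An element can be written as k y^i in many ways; the choice made here is
    harmless because \<open>wd\<close> shows that all of them give the same value.\<close>
  define F where "F w = (SOME v. \<exists>k\<in>K. \<exists>i::int. w = k \<otimes> y [^] i \<and> v = f k \<otimes>\<^bsub>H\<^esub> z [^]\<^bsub>H\<^esub> i)" for w
  have wd: "f k \<otimes>\<^bsub>H\<^esub> z [^]\<^bsub>H\<^esub> i = f l \<otimes>\<^bsub>H\<^esub> z [^]\<^bsub>H\<^esub> j"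
    if k: "k \<in> K" and l: "l \<in> K" and eq: "k \<otimes> y [^] i = l \<otimes> y [^] j" for k l and i j :: int
  proof -
    have "l = k \<otimes> y [^] i \<otimes> inv (y [^] j)"
      using eq y KG[OF k] KG[OF l] by (simp add: m_assoc)
    then have l_eq: "l = k \<otimes> y [^] (i - j)"
      using y KG[OF k] by (simp add: m_assoc int_pow_diff)
    then have "y [^] (i - j) = inv k \<otimes> l"
      using y KG[OF k] by (simp add: m_assoc[symmetric])
    then have mem: "y [^] (i - j) \<in> K"
      using k l K by (simp add: subgroup.m_closed subgroup.m_inv_closed)
    have "f l = f k \<otimes>\<^bsub>H\<^esub> z [^]\<^bsub>H\<^esub> (i - j)"
      unfolding l_eq using fm[OF k mem] yz[OF mem] by simp
    then have "f l \<otimes>\<^bsub>H\<^esub> z [^]\<^bsub>H\<^esub> j = f k \<otimes>\<^bsub>H\<^esub> (z [^]\<^bsub>H\<^esub> (i - j) \<otimes>\<^bsub>H\<^esub> z [^]\<^bsub>H\<^esub> j)"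
      using z fc[OF k] by (simp add: H.m_assoc)
    then show ?thesis using z by (simp add: H.int_pow_mult[symmetric])
  qed
  have F: "F (k \<otimes> y [^] i) = f k \<otimes>\<^bsub>H\<^esub> z [^]\<^bsub>H\<^esub> i" if k: "k \<in> K" for k and i :: int
    unfolding F_def
  proof (rule someI2)
    show "\<exists>k'\<in>K. \<exists>i'::int. k \<otimes> y [^] i = k' \<otimes> y [^] i' \<and>
        f k \<otimes>\<^bsub>H\<^esub> z [^]\<^bsub>H\<^esub> i = f k' \<otimes>\<^bsub>H\<^esub> z [^]\<^bsub>H\<^esub> i'"
      using k by blast
  next
    fix v assume "\<exists>k'\<in>K. \<exists>i'::int. k \<otimes> y [^] i = k' \<otimes> y [^] i' \<and>
        v = f k' \<otimes>\<^bsub>H\<^esub> z [^]\<^bsub>H\<^esub> i'"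
    then obtain k' and i' :: int where "k' \<in> K" "k \<otimes> y [^] i = k' \<otimes> y [^] i'"
        "v = f k' \<otimes>\<^bsub>H\<^esub> z [^]\<^bsub>H\<^esub> i'" by blast
    then show "v = f k \<otimes>\<^bsub>H\<^esub> z [^]\<^bsub>H\<^esub> i" using wd k by metis
  qed
  have mult: "(k \<otimes> y [^] i) \<otimes> (l \<otimes> y [^] j) = (k \<otimes> l) \<otimes> y [^] (i + j)"
    if "k \<in> K" "l \<in> K" for k l and i j :: int
    using KG[OF that(1)] KG[OF that(2)] y by (simp add: int_pow_mult m_ac)
  have sub: "subgroup K' G"
  proof (rule subgroupI)
    show "K' \<subseteq> carrier G" unfolding K'_def using KG y by auto
    have "\<one> \<otimes> y [^] (0::int) \<in> K'" unfolding K'_def using subgroup.one_closed[OF K] by blast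
    then show "K' \<noteq> {}" by blast
  next
    fix a assume "a \<in> K'"
    then obtain k and i :: int where a: "k \<in> K" "a = k \<otimes> y [^] i" unfolding K'_def by blast
    have "inv a = inv k \<otimes> y [^] (- i)"
      unfolding a(2) using KG[OF a(1)] y by (simp add: inv_mult int_pow_neg)
    then show "inv a \<in> K'" unfolding K'_def using subgroup.m_inv_closed[OF K a(1)] by blast
  next
    fix a b assume "a \<in> K'" "b \<in> K'"
    then obtain k l and i j :: int where "k \<in> K" "a = k \<otimes> y [^] i" "l \<in> K" "b = l \<otimes> y [^] j"
      unfolding K'_def by blast
    then show "a \<otimes> b \<in> K'" unfolding K'_def using mult[of k l i j] subgroup.m_closed[OF K] by blast
  qed
  have "F \<in> hom (G\<lparr>carrier := K'\<rparr>) H"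
  proof (rule homI)
    fix a assume "a \<in> carrier (G\<lparr>carrier := K'\<rparr>)"
    then obtain k and i :: int where a: "k \<in> K" "a = k \<otimes> y [^] i" unfolding K'_def by auto
    then show "F a \<in> carrier H" using F fc z by simp
  next
    fix a b assume "a \<in> carrier (G\<lparr>carrier := K'\<rparr>)" "b \<in> carrier (G\<lparr>carrier := K'\<rparr>)"
    then obtain k l and i j :: int where
      ab: "k \<in> K" "a = k \<otimes> y [^] i" "l \<in> K" "b = l \<otimes> y [^] j"
      unfolding K'_def by auto
    have "F (a \<otimes> b) = f (k \<otimes> l) \<otimes>\<^bsub>H\<^esub> z [^]\<^bsub>H\<^esub> (i + j)"
      unfolding ab(2,4) mult[OF ab(1,3)] using F subgroup.m_closed[OF K ab(1,3)] by simp
    also have "\<dots> = F a \<otimes>\<^bsub>H\<^esub> F b"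
      using fm ab fc z F by (simp add: H.int_pow_mult H.m_ac)
    finally show "F (a \<otimes>\<^bsub>G\<lparr>carrier := K'\<rparr>\<^esub> b) = F a \<otimes>\<^bsub>H\<^esub> F b" by simp
  qed
  then show ?thesis using sub K'_def F by blast
qed

text \<open>The integers i with y^i in K form an ideal, generated by its least positive member: the
  remainder of i modulo m is again such an exponent.\<close>

lemma (in group) least_power_dvd:
  assumes K: "subgroup K G" and y: "y \<in> carrier G" and m: "0 < (m::nat)" "y [^] m \<in> K"
    and least: "\<And>r::nat. 0 < r \<Longrightarrow> r < m \<Longrightarrow> y [^] r \<notin> K" and i: "y [^] (i::int) \<in> K"
  shows "int m dvd i"
proof -
  have "y [^] (i mod int m) = y [^] i \<otimes> inv (y [^] (int m * (i div int m)))"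
    using y by (simp add: minus_mult_div_eq_mod[symmetric] int_pow_diff)
  also have "y [^] (int m * (i div int m)) = (y [^] m) [^] (i div int m)"
    using y by (simp add: int_pow_pow[symmetric] int_pow_int)
  finally have "y [^] (i mod int m) \<in> K"
    using K i m(2) by (simp add: subgroup.m_closed subgroup.m_inv_closed subgroup_int_pow_closed)
  moreover have "y [^] (i mod int m) = y [^] nat (i mod int m)"
    using m by (simp add: int_pow_int[symmetric])
  ultimately have "y [^] nat (i mod int m) \<in> K" by simp
  moreover have "nat (i mod int m) < m" using m by (simp add: nat_less_iff)
  ultimately have "nat (i mod int m) = 0" using least by (metis gr0I)
  moreover have "0 \<le> i mod int m" using m by simp
  ultimately have "i mod int m = 0" by simp
  then show ?thesis by (rule mod_0_imp_dvd)
qed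

text \<open>Divisible groups are injective. As each element of the finite set S has a positive power
  in K, adjoining these elements one after the other replaces the usual appeal to Zorn's
  lemma.\<close>

lemma (in comm_group) hom_extend_divisible:
  assumes H: "comm_group H" and K: "subgroup K G" and f: "f \<in> hom (G\<lparr>carrier := K\<rparr>) H"
    and div: "\<And>z (m::nat). z \<in> carrier H \<Longrightarrow> 0 < m \<Longrightarrow> \<exists>w\<in>carrier H. w [^]\<^bsub>H\<^esub> m = z"
    and S: "finite S" "S \<subseteq> carrier G" "\<And>y. y \<in> S \<Longrightarrow> \<exists>m::nat. 0 < m \<and> y [^] m \<in> K"
  shows "\<exists>K' F. subgroup K' G \<and> K \<union> S \<subseteq> K' \<and> F \<in> hom (G\<lparr>carrier := K'\<rparr>) H \<and> (\<forall>k\<in>K. F k = f k)"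
  using S
proof (induction S rule: finite_induct)
  case empty
  have "subgroup K G \<and> K \<union> {} \<subseteq> K \<and> f \<in> hom (G\<lparr>carrier := K\<rparr>) H \<and> (\<forall>k\<in>K. f k = f k)"
    using K f by blast
  then show ?case by blast
next
  case (insert y S)
  interpret H: comm_group H by (rule H)
  obtain K1 F1 where K1: "subgroup K1 G" "K \<union> S \<subseteq> K1" "F1 \<in> hom (G\<lparr>carrier := K1\<rparr>) H"
      "\<forall>k\<in>K. F1 k = f k"
    using insert.IH insert.prems by blast
  have y: "y \<in> carrier G" using insert.prems by simp
  \<comment> \<open>The value at y^m is already prescribed, so the image of y has to be an m-th root
    of it; divisibility provides such a root w. By minimality of m no other power of y imposes a
    further condition.\<close>
  define m where "m = (LEAST m::nat. 0 < m \<and> y [^] m \<in> K1)"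
  have ex: "\<exists>m::nat. 0 < m \<and> y [^] m \<in> K1" using insert.prems(2)[of y] K1(2) by auto
  have m: "0 < m" "y [^] m \<in> K1" using LeastI_ex[OF ex] unfolding m_def by auto
  have least: "y [^] r \<notin> K1" if "0 < r" "r < m" for r :: nat
    using not_less_Least[of r] that unfolding m_def by blast
  have F1c: "F1 k \<in> carrier H" if "k \<in> K1" for k using K1(3) that by (auto simp: hom_def)
  obtain w where w: "w \<in> carrier H" "w [^]\<^bsub>H\<^esub> m = F1 (y [^] m)" using div[OF F1c[OF m(2)] m(1)] by blast
  have gK1: "group (G\<lparr>carrier := K1\<rparr>)" using subgroup.subgroup_is_group[OF K1(1)] is_group by blast
  have ext: "F1 (y [^] i) = w [^]\<^bsub>H\<^esub> i" if i: "y [^] i \<in> K1" for i :: int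
  proof -
    obtain q where q: "i = int m * q" using least_power_dvd[OF K1(1) y m least i] by (auto simp: dvd_def)
    have "y [^] i = (y [^] m) [^] q" unfolding q using y by (simp add: int_pow_pow[symmetric] int_pow_int)
    also have "\<dots> = (y [^] m) [^]\<^bsub>G\<lparr>carrier := K1\<rparr>\<^esub> q" by (rule int_pow_consistent[OF K1(1) m(2)])
    also have "F1 \<dots> = F1 (y [^] m) [^]\<^bsub>H\<^esub> q"
      using hom_int_pow[OF K1(3) _ gK1 H.is_group] m(2) by simp
    also have "\<dots> = w [^]\<^bsub>H\<^esub> i"
      unfolding w(2)[symmetric] q using w(1) by (simp add: H.int_pow_pow[symmetric] int_pow_int)
    finally show ?thesis .
  qed
  obtain K' F where K': "subgroup K' G" "K' = {k \<otimes> y [^] i | k (i::int). k \<in> K1}"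
      "F \<in> hom (G\<lparr>carrier := K'\<rparr>) H"
      and F: "\<forall>k\<in>K1. \<forall>i::int. F (k \<otimes> y [^] i) = F1 k \<otimes>\<^bsub>H\<^esub> w [^]\<^bsub>H\<^esub> i"
    using hom_extend_by_element[OF H K1(1,3) y w(1) ext] by blast
  have K1': "k \<in> K' \<and> F k = F1 k" if k: "k \<in> K1" for k
  proof -
    have kk: "k \<otimes> y [^] (0::int) = k" using subgroup.mem_carrier[OF K1(1) k] by simp
    have "k \<otimes> y [^] (0::int) \<in> K'" unfolding K'(2) using k by blast
    moreover have "F (k \<otimes> y [^] (0::int)) = F1 k"
      using bspec[OF F k, THEN spec, of 0] F1c[OF k] by simp
    ultimately show ?thesis unfolding kk by blast
  qed
  have "y = \<one> \<otimes> y [^] (1::int)" using y by simp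
  then have "y \<in> K'" unfolding K'(2) using subgroup.one_closed[OF K1(1)] by blast
  then have "K \<union> insert y S \<subseteq> K'" using K1' K1(2) by auto
  moreover have "\<forall>k\<in>K. F k = f k" using K1' K1(2,4) by auto
  ultimately show ?case using K'(1,3) by blast
qed

section \<open>Non-zero complex numbers and splitting of symmetric cocycles\<close>

definition complex_units :: "complex monoid" where
  "complex_units = \<lparr>carrier = - {0}, monoid.mult = (*), one = 1\<rparr>"

lemma complex_units_simps [simp]:
  "carrier complex_units = - {0}" "x \<otimes>\<^bsub>complex_units\<^esub> y = x * y" "\<one>\<^bsub>complex_units\<^esub> = 1"
  by (simp_all add: complex_units_def)

lemma comm_group_complex_units: "comm_group complex_units"
proof (rule comm_groupI)
  fix x assume "x \<in> carrier complex_units"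
  then show "\<exists>y\<in>carrier complex_units. y \<otimes>\<^bsub>complex_units\<^esub> x = \<one>\<^bsub>complex_units\<^esub>"
    by (intro bexI[of _ "inverse x"]) auto
qed auto

lemma complex_units_pow [simp]: "x [^]\<^bsub>complex_units\<^esub> (n::nat) = x ^ n"
proof -
  interpret comm_group complex_units by (rule comm_group_complex_units)
  show ?thesis by (induction n) (simp_all add: nat_pow_def)
qed

text \<open>Put the identity into two neighbouring places of the cocycle equation and cancel. For a
  cocycle that is not normalized, the common value \<alpha>(1,1) survives as a correction factor in
  the constructions below.\<close>

lemma two_cocycle_one:
  assumes "group G" "two_cocycle G \<alpha>" "g \<in> carrier G"
  shows "\<alpha> \<one>\<^bsub>G\<^esub> g = \<alpha> \<one>\<^bsub>G\<^esub> \<one>\<^bsub>G\<^esub>" "\<alpha> g \<one>\<^bsub>G\<^esub> = \<alpha> \<one>\<^bsub>G\<^esub> \<one>\<^bsub>G\<^esub>"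
proof -
  interpret group G by fact
  have nz: "\<And>g h. g \<in> carrier G \<Longrightarrow> h \<in> carrier G \<Longrightarrow> \<alpha> g h \<noteq> 0"
    and coc: "\<And>g h k. g \<in> carrier G \<Longrightarrow> h \<in> carrier G \<Longrightarrow> k \<in> carrier G \<Longrightarrow>
      \<alpha> g h * \<alpha> (g \<otimes>\<^bsub>G\<^esub> h) k = \<alpha> h k * \<alpha> g (h \<otimes>\<^bsub>G\<^esub> k)"
    using assms(2) unfolding two_cocycle_def by auto
  show "\<alpha> \<one>\<^bsub>G\<^esub> g = \<alpha> \<one>\<^bsub>G\<^esub> \<one>\<^bsub>G\<^esub>" using coc[of "\<one>\<^bsub>G\<^esub>" "\<one>\<^bsub>G\<^esub>" g] nz[of "\<one>\<^bsub>G\<^esub>" g] assms(3) by simp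
  show "\<alpha> g \<one>\<^bsub>G\<^esub> = \<alpha> \<one>\<^bsub>G\<^esub> \<one>\<^bsub>G\<^esub>" using coc[of g "\<one>\<^bsub>G\<^esub>" "\<one>\<^bsub>G\<^esub>"] nz[of g "\<one>\<^bsub>G\<^esub>"] assms(3) by simp
qed

text \<open>A symmetric cocycle defines an abelian extension of the group by the divisible group of
  non-zero complex numbers; extending the identity of the latter to the extension splits it.\<close>

lemma symmetric_cocycle_splits:
  assumes "comm_group L" and fin: "finite (carrier L)" and coc: "two_cocycle L \<alpha>"
    and sym: "\<And>g h. g \<in> carrier L \<Longrightarrow> h \<in> carrier L \<Longrightarrow> \<alpha> g h = \<alpha> h g"
  obtains \<mu> where "\<And>g. g \<in> carrier L \<Longrightarrow> \<mu> g \<noteq> (0::complex)"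
    "\<And>g h. g \<in> carrier L \<Longrightarrow> h \<in> carrier L \<Longrightarrow> \<mu> g * \<mu> h = \<alpha> g h * \<mu> (g \<otimes>\<^bsub>L\<^esub> h)"
proof -
  interpret L: comm_group L by fact
  have nz: "\<And>g h. g \<in> carrier L \<Longrightarrow> h \<in> carrier L \<Longrightarrow> \<alpha> g h \<noteq> 0"
    and coc': "\<And>g h k. g \<in> carrier L \<Longrightarrow> h \<in> carrier L \<Longrightarrow> k \<in> carrier L \<Longrightarrow>
      \<alpha> g h * \<alpha> (g \<otimes>\<^bsub>L\<^esub> h) k = \<alpha> h k * \<alpha> g (h \<otimes>\<^bsub>L\<^esub> k)"
    using coc unfolding two_cocycle_def by auto
  define e where "e = \<alpha> \<one>\<^bsub>L\<^esub> \<one>\<^bsub>L\<^esub>"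
  have e: "e \<noteq> 0" unfolding e_def using nz by simp
  have one: "\<alpha> \<one>\<^bsub>L\<^esub> g = e" "\<alpha> g \<one>\<^bsub>L\<^esub> = e" if "g \<in> carrier L" for g
    using two_cocycle_one[OF L.is_group coc that] unfolding e_def by auto
  \<comment> \<open>The pair (c, g) stands for c u_g. The identity of the algebra is u_1 / e, hence
    the first component of the identity of E.\<close>
  define E where "E = \<lparr>carrier = (- {0::complex}) \<times> carrier L,
      monoid.mult = (\<lambda>(c, g) (d, h). (c * d * \<alpha> g h, g \<otimes>\<^bsub>L\<^esub> h)), one = (inverse e, \<one>\<^bsub>L\<^esub>)\<rparr>"
  have Ecar: "carrier E = (- {0}) \<times> carrier L"
    and Emul: "\<And>c g d h. (c, g) \<otimes>\<^bsub>E\<^esub> (d, h) = (c * d * \<alpha> g h, g \<otimes>\<^bsub>L\<^esub> h)"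
    and Eone: "\<one>\<^bsub>E\<^esub> = (inverse e, \<one>\<^bsub>L\<^esub>)"
    unfolding E_def by auto
  interpret E: comm_group E
  proof (rule comm_groupI)
    fix x y z assume "x \<in> carrier E" "y \<in> carrier E" "z \<in> carrier E"
    then obtain c g d h b k where "x = (c, g)" "y = (d, h)" "z = (b, k)"
        "g \<in> carrier L" "h \<in> carrier L" "k \<in> carrier L" unfolding Ecar by (metis SigmaE)
    then show "x \<otimes>\<^bsub>E\<^esub> y \<otimes>\<^bsub>E\<^esub> z = x \<otimes>\<^bsub>E\<^esub> (y \<otimes>\<^bsub>E\<^esub> z)"
      using coc'[of g h k] by (simp add: Emul L.m_assoc)
  next
    fix x y assume "x \<in> carrier E" "y \<in> carrier E"
    then show "x \<otimes>\<^bsub>E\<^esub> y \<in> carrier E" "x \<otimes>\<^bsub>E\<^esub> y = y \<otimes>\<^bsub>E\<^esub> x"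
      using nz sym by (auto simp: Ecar Emul L.m_comm)
  next
    fix x assume "x \<in> carrier E"
    then obtain c g where x: "x = (c, g)" "g \<in> carrier L" "c \<noteq> 0" unfolding Ecar by auto
    then show "\<one>\<^bsub>E\<^esub> \<otimes>\<^bsub>E\<^esub> x = x" using e one by (simp add: Eone Emul)
    have "\<alpha> (inv\<^bsub>L\<^esub> g) g \<noteq> 0" using nz x by simp
    then have "(inverse (e * c * \<alpha> (inv\<^bsub>L\<^esub> g) g), inv\<^bsub>L\<^esub> g) \<otimes>\<^bsub>E\<^esub> x = \<one>\<^bsub>E\<^esub>"
      using x e by (simp add: Emul Eone field_simps)
    moreover have "(inverse (e * c * \<alpha> (inv\<^bsub>L\<^esub> g) g), inv\<^bsub>L\<^esub> g) \<in> carrier E"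
      using x e nz unfolding Ecar by simp
    ultimately show "\<exists>y\<in>carrier E. y \<otimes>\<^bsub>E\<^esub> x = \<one>\<^bsub>E\<^esub>" by blast
  qed (simp add: Ecar Eone e)
  define K where "K = (- {0::complex}) \<times> {\<one>\<^bsub>L\<^esub>}"
  have K: "subgroup K E"
  proof (rule E.subgroupI)
    have "(1, \<one>\<^bsub>L\<^esub>) \<in> K" unfolding K_def by simp
    then show "K \<subseteq> carrier E" "K \<noteq> {}" unfolding K_def Ecar by blast+
  next
    fix a assume "a \<in> K"
    then obtain c where a: "a = (c, \<one>\<^bsub>L\<^esub>)" "c \<noteq> 0" unfolding K_def by auto
    have "(inverse (e * e * c), \<one>\<^bsub>L\<^esub>) \<otimes>\<^bsub>E\<^esub> a = \<one>\<^bsub>E\<^esub>"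
      using a(2) e one(1)[OF L.one_closed] unfolding a(1) by (simp add: Emul Eone field_simps)
    moreover have "a \<in> carrier E" "(inverse (e * e * c), \<one>\<^bsub>L\<^esub>) \<in> carrier E"
      using a(2) e unfolding a(1) Ecar by simp_all
    ultimately have "inv\<^bsub>E\<^esub> a = (inverse (e * e * c), \<one>\<^bsub>L\<^esub>)"
      by (rule E.inv_equality)
    then show "inv\<^bsub>E\<^esub> a \<in> K" unfolding K_def using a e by simp
  next
    fix a b assume "a \<in> K" "b \<in> K"
    then show "a \<otimes>\<^bsub>E\<^esub> b \<in> K" unfolding K_def using one e by (auto simp: Emul)
  qed
  \<comment> \<open>In K the product of (c, 1) and (d, 1) is (c d e, 1), so the factor e is what
    makes this map multiplicative: c u_1 is the scalar c e.\<close>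
  define f where "f = (\<lambda>(c, g :: 'a). c * e)"
  have f: "f \<in> hom (E\<lparr>carrier := K\<rparr>) complex_units"
    by (rule homI) (auto simp: f_def K_def e Emul one)
  have div: "\<exists>w\<in>carrier complex_units. w [^]\<^bsub>complex_units\<^esub> m = z"
    if "z \<in> carrier complex_units" "0 < m" for z and m :: nat
  proof -
    let ?w = "rcis (root m (cmod z)) (Arg z / real m)"
    have "?w ^ m = z"
      using that by (simp add: DeMoivre2 real_root_pow_pos2 rcis_cmod_Arg)
    moreover have "?w \<noteq> 0" using that by simp
    ultimately show ?thesis by (intro bexI[of _ ?w]) simp_all
  qed
  have snd_hom: "snd \<in> hom E L" by (rule homI) (auto simp: Ecar Emul)
  \<comment> \<open>Raising to the order of L annihilates the second component, so E is torsion
    modulo K and roots of finite degree suffice for the extension.\<close>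
  have tors: "\<exists>m::nat. 0 < m \<and> y [^]\<^bsub>E\<^esub> m \<in> K" if "y \<in> {1} \<times> carrier L" for y
  proof (intro exI conjI)
    have y: "y \<in> carrier E" "snd y \<in> carrier L" using that by (auto simp: Ecar)
    show "0 < Coset.order L" using fin L.order_gt_0_iff_finite by blast
    have "snd (y [^]\<^bsub>E\<^esub> Coset.order L) = snd y [^]\<^bsub>L\<^esub> Coset.order L"
      using group_hom.hom_nat_pow[of E L snd] snd_hom y E.is_group L.is_group
      by (simp add: group_hom_def group_hom_axioms_def)
    also have "\<dots> = \<one>\<^bsub>L\<^esub>" using y L.pow_order_eq_1 by simp
    finally have "snd (y [^]\<^bsub>E\<^esub> Coset.order L) = \<one>\<^bsub>L\<^esub>" .
    moreover have "y [^]\<^bsub>E\<^esub> Coset.order L \<in> carrier E" using y by simp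
    ultimately show "y [^]\<^bsub>E\<^esub> Coset.order L \<in> K" unfolding K_def Ecar by (simp add: mem_Times_iff)
  qed
  have "\<exists>K' F. subgroup K' E \<and> K \<union> {1} \<times> carrier L \<subseteq> K' \<and>
      F \<in> hom (E\<lparr>carrier := K'\<rparr>) complex_units \<and> (\<forall>k\<in>K. F k = f k)"
  proof (rule E.hom_extend_divisible[OF comm_group_complex_units K f])
    show "finite ({1} \<times> carrier L)" using fin by simp
    show "{1} \<times> carrier L \<subseteq> carrier E" unfolding Ecar by auto
  next
    fix z and m :: nat
    assume "z \<in> carrier complex_units" "0 < m"
    then show "\<exists>w\<in>carrier complex_units. w [^]\<^bsub>complex_units\<^esub> m = z" by (rule div)
  next
    fix y :: "complex \<times> 'a" assume "y \<in> {1} \<times> carrier L"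
    then show "\<exists>m>0. y [^]\<^bsub>E\<^esub> (m::nat) \<in> K" by (rule tors)
  qed
  then obtain K' F where K': "subgroup K' E" "K \<union> {1} \<times> carrier L \<subseteq> K'"
      and F: "F \<in> hom (E\<lparr>carrier := K'\<rparr>) complex_units" "\<forall>k\<in>K. F k = f k"
    by blast
  have Fm: "F (x \<otimes>\<^bsub>E\<^esub> y) = F x * F y" if "x \<in> K'" "y \<in> K'" for x y
    using hom_mult[OF F(1)] that by simp
  show ?thesis
  proof (rule that[of "\<lambda>g. F (1, g)"])
    fix g assume "g \<in> carrier L"
    then have "(1, g) \<in> K'" using K' by auto
    then show "F (1, g) \<noteq> 0" using hom_in_carrier[OF F(1)] by simp
  next
    fix g h assume gh: "g \<in> carrier L" "h \<in> carrier L"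
    then have mem: "(1, g) \<in> K'" "(1, h) \<in> K'" "(1, g \<otimes>\<^bsub>L\<^esub> h) \<in> K'"
      "(\<alpha> g h / e, \<one>\<^bsub>L\<^esub>) \<in> K'" "(\<alpha> g h / e, \<one>\<^bsub>L\<^esub>) \<in> K" using K' nz e unfolding K_def by auto
    have "F (1, g) * F (1, h) = F ((1, g) \<otimes>\<^bsub>E\<^esub> (1, h))" using Fm mem by simp
    \<comment> \<open>This is u_g u_h = \<alpha>(g,h) u_gh, with the scalar \<alpha>(g,h) written as
      an element of K; the division by e compensates the factor e in f.\<close>
    also have "(1, g) \<otimes>\<^bsub>E\<^esub> (1, h) = (\<alpha> g h / e, \<one>\<^bsub>L\<^esub>) \<otimes>\<^bsub>E\<^esub> (1, g \<otimes>\<^bsub>L\<^esub> h)"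
      using gh e one by (simp add: Emul)
    also have "F \<dots> = f (\<alpha> g h / e, \<one>\<^bsub>L\<^esub>) * F (1, g \<otimes>\<^bsub>L\<^esub> h)" using Fm mem F(2) by simp
    finally show "F (1, g) * F (1, h) = \<alpha> g h * F (1, g \<otimes>\<^bsub>L\<^esub> h)" using e by (simp add: f_def)
  qed
qed

section \<open>Finite abelian groups with square-free element orders\<close>

lemma (in group) coprime_powers_in_subgroup:
  assumes K: "subgroup K G" and x: "x \<in> carrier G"
    and ij: "x [^] (i::int) \<in> K" "x [^] (j::int) \<in> K" "coprime i j"
  shows "x \<in> K"
proof -
  obtain u v where uv: "u * i + v * j = 1" using ij(3) by (metis coprime_iff_gcd_eq_1 bezout_int)
  have "x = x [^] (i * u + j * v)" using x uv by (simp add: mult.commute)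
  also have "\<dots> = (x [^] i) [^] u \<otimes> (x [^] j) [^] v"
    using x by (simp only: int_pow_mult int_pow_pow)
  also have "\<dots> \<in> K"
    using ij K by (simp add: subgroup.m_closed subgroup_int_pow_closed)
  finally show ?thesis .
qed

text \<open>Cauchy's theorem gives an element of order p in the quotient by K; the point is to lift
  it to an element killed by p. If x is any lift, then p divides its order p m, for otherwise Bezout
  would put x into K. Square-freeness makes m prime to p, so x^m is killed by p but, again by
  Bezout, stays outside K.\<close>

lemma (in comm_group) element_of_prime_order_outside:
  assumes fin: "finite (carrier G)" and sf: "\<forall>x\<in>carrier G. squarefree (ord x)"
    and K: "subgroup K G" and p: "prime p" "p dvd card (rcosets K)"
  shows "\<exists>y\<in>carrier G. y \<notin> K \<and> y [^] p = \<one>"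
proof -
  have nK: "K \<lhd> G" using K by (rule subgroup_imp_normal)
  interpret Q: group "G Mod K" using nK by (rule normal.factorgroup_is_group)
  have ordQ: "Coset.order (G Mod K) = card (rcosets K)" by (simp add: Coset.order_def FactGroup_def)
  have finQ: "finite (carrier (G Mod K))"
    using fin by (simp add: FactGroup_def RCOSETS_def)
  \<comment> \<open>The exponent 1 reduces the Sylow theorem to Cauchy's theorem: a subgroup with
    exactly p elements.\<close>
  obtain r where "card (rcosets K) = p ^ 1 * r" using p(2) by auto
  then obtain S where S: "subgroup S (G Mod K)" "card S = p ^ 1"
    using sylow_thm[OF p(1) Q.is_group _ finQ] ordQ by metis
  have S1: "1 < card S" using S(2) prime_gt_1_nat[OF p(1)] by simp
  then have "\<not> S \<subseteq> {K}" using card_mono[of "{K}" S] by auto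
  then obtain X where X: "X \<in> S" "X \<noteq> K" by blast
  then have "X \<in> rcosets K" using S(1) subgroup.subset unfolding FactGroup_def by fastforce
  then obtain x where x: "x \<in> carrier G" "X = K #> x" unfolding RCOSETS_def by blast
  have "X [^]\<^bsub>G Mod K\<^esub> p = \<one>\<^bsub>G Mod K\<^esub>"
  proof -
    interpret S: group "(G Mod K)\<lparr>carrier := S\<rparr>"
      using subgroup.subgroup_is_group[OF S(1) Q.is_group] .
    have "Coset.order ((G Mod K)\<lparr>carrier := S\<rparr>) = p" using S(2) by (simp add: Coset.order_def)
    then have "X [^]\<^bsub>(G Mod K)\<lparr>carrier := S\<rparr>\<^esub> p = \<one>\<^bsub>G Mod K\<^esub>"
      using S.pow_order_eq_1[of X] X by simp
    then show ?thesis by (simp add: Q.nat_pow_consistent[symmetric])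
  qed
  moreover have "K #> (x [^] p) = X [^]\<^bsub>G Mod K\<^esub> p"
  proof -
    interpret h: group_hom G "G Mod K" "\<lambda>a. K #> a"
      using normal.r_coset_hom_Mod[OF nK] Q.is_group is_group
      by (simp add: group_hom_def group_hom_axioms_def)
    show ?thesis using h.hom_nat_pow[OF x(1), of p] x(2) by simp
  qed
  ultimately have "K #> (x [^] p) = K" by (simp add: FactGroup_def)
  then have xp: "x [^] int p \<in> K" using coset_join1[OF _ _ K, of "x [^] p"] x K subgroup.subset
    by (auto simp: int_pow_int)
  have xK: "x \<notin> K" using coset_join2[OF x(1) K] X(2) x(2) by blast
  have xo: "x [^] int (ord x) \<in> K" using x K subgroup.one_closed by (simp add: int_pow_int)
  have "p dvd ord x"
  proof (rule ccontr)
    assume "\<not> p dvd ord x"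
    then have "coprime (int p) (int (ord x))" using p(1) prime_imp_coprime by auto
    then show False using coprime_powers_in_subgroup[OF K x(1) xp xo] xK by blast
  qed
  then obtain m where m: "ord x = p * m" by auto
  have "\<not> p dvd m"
  proof
    assume "p dvd m"
    then have "p ^ 2 dvd ord x" unfolding m power2_eq_square by (rule mult_dvd_mono[OF dvd_refl])
    then have "is_unit p" using sf x(1) unfolding squarefree_def by blast
    then show False using p(1) by auto
  qed
  then have cop: "coprime (int p) (int m)" using p(1) prime_imp_coprime by auto
  show ?thesis
  proof (intro bexI conjI)
    show "x [^] m \<notin> K"
      using coprime_powers_in_subgroup[OF K x(1) xp _ cop] xK by (auto simp: int_pow_int)
    have "(x [^] m) [^] p = x [^] ord x" using x by (simp add: nat_pow_pow m mult.commute)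
    then show "(x [^] m) [^] p = \<one>" using x by simp
  qed (use x in simp)
qed

text \<open>Take an injective homomorphism defined on a subgroup K of largest possible order. If K
  is proper, then K and its image have the same index, so one prime p divides both indices; sending
  an element of order p outside K to one outside the image extends the map injectively. This
  bypasses the decomposition into cyclic factors.\<close>

lemma squarefree_abelian_groups_iso:
  assumes "comm_group G" "comm_group H" and fin: "finite (carrier G)" "finite (carrier H)"
    and ord: "Coset.order G = Coset.order H"
    and sf: "\<forall>x\<in>carrier G. squarefree (group.ord G x)" "\<forall>x\<in>carrier H. squarefree (group.ord H x)"
  shows "\<exists>\<theta>. \<theta> \<in> iso G H"
proof -
  interpret G: comm_group G by fact
  interpret H: comm_group H by fact
  define P where "P k \<longleftrightarrow> (\<exists>K f. subgroup K G \<and> f \<in> hom (G\<lparr>carrier := K\<rparr>) H \<and> inj_on f K \<and> card K = k)" for k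
  have "P 1" unfolding P_def
  proof (intro exI conjI)
    show "subgroup {\<one>\<^bsub>G\<^esub>} G" by (rule G.triv_subgroup)
    show "(\<lambda>_. \<one>\<^bsub>H\<^esub>) \<in> hom (G\<lparr>carrier := {\<one>\<^bsub>G\<^esub>}\<rparr>) H" by (rule homI) auto
  qed auto
  moreover have "\<forall>k. P k \<longrightarrow> k \<le> card (carrier G)"
    unfolding P_def using fin(1) by (auto intro: card_mono subgroup.subset[THEN subsetD])
  ultimately obtain k where k: "P k" and max: "\<forall>j. P j \<longrightarrow> j \<le> k"
    using Nat.ex_has_greatest_nat[of P 1] by blast
  obtain K f where K: "subgroup K G" and f: "f \<in> hom (G\<lparr>carrier := K\<rparr>) H" and inj: "inj_on f K"
    and kK: "card K = k" using k unfolding P_def by blast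
  have gK: "group (G\<lparr>carrier := K\<rparr>)" using subgroup.subgroup_is_group[OF K G.is_group] .
  interpret f: group_hom "G\<lparr>carrier := K\<rparr>" H f
    using gK H.is_group f by (simp add: group_hom_def group_hom_axioms_def)
  have fK: "subgroup (f ` K) H" using f.img_is_subgroup by simp
  have card_fK: "card (f ` K) = card K" using inj by (rule card_image)
  have lag: "card (rcosets\<^bsub>G\<^esub> K) * card K = card (carrier G)"
      "card (rcosets\<^bsub>H\<^esub> (f ` K)) * card K = card (carrier H)"
    using G.lagrange[OF K] H.lagrange[OF fK] card_fK by (simp_all add: Coset.order_def)
  have finK: "finite K" using K fin(1) subgroup.subset finite_subset by blast
  have K0: "0 < card K" using finK subgroup.one_closed[OF K] card_gt_0_iff by blast
  have idx: "card (rcosets\<^bsub>H\<^esub> (f ` K)) = card (rcosets\<^bsub>G\<^esub> K)"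
    using lag ord K0 by (metis Coset.order_def mult_right_cancel neq0_conv)
  have KG: "K = carrier G"
  proof (rule ccontr)
    assume "K \<noteq> carrier G"
    then have "card K \<noteq> card (carrier G)"
      using card_subset_eq[OF fin(1) subgroup.subset[OF K]] by blast
    then have "card (rcosets\<^bsub>G\<^esub> K) \<noteq> 1" using lag(1) by auto
    then obtain p where p: "prime p" "p dvd card (rcosets\<^bsub>G\<^esub> K)" using prime_factor_nat by blast
    obtain y where y: "y \<in> carrier G" "y \<notin> K" "y [^]\<^bsub>G\<^esub> p = \<one>\<^bsub>G\<^esub>"
      using G.element_of_prime_order_outside[OF fin(1) sf(1) K p] by blast
    obtain z where z: "z \<in> carrier H" "z \<notin> f ` K" "z [^]\<^bsub>H\<^esub> p = \<one>\<^bsub>H\<^esub>"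
      using H.element_of_prime_order_outside[OF fin(2) sf(2) fK p(1)] p(2) idx by auto
    have cop: "coprime (int p) i" if "\<not> int p dvd i" for i
      using that p(1) prime_imp_coprime[of "int p"] by simp
    \<comment> \<open>As y^p = 1 and y is outside K, the powers of y inside K are only the trivial
      ones. The same holds for z and the image, so the compatibility condition for the extension
      reads 1 = 1.\<close>
    have yp: "int p dvd i" if "y [^]\<^bsub>G\<^esub> (i::int) \<in> K" for i
      using G.coprime_powers_in_subgroup[OF K y(1) _ that cop] y subgroup.one_closed[OF K]
      by (auto simp: int_pow_int)
    have zp: "int p dvd i" if "z [^]\<^bsub>H\<^esub> (i::int) \<in> f ` K" for i
      using H.coprime_powers_in_subgroup[OF fK z(1) _ that cop] z subgroup.one_closed[OF fK]
      by (auto simp: int_pow_int)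
    have y1: "y [^]\<^bsub>G\<^esub> i = \<one>\<^bsub>G\<^esub>" "z [^]\<^bsub>H\<^esub> i = \<one>\<^bsub>H\<^esub>" if "int p dvd i" for i
      using that y z by (auto simp: dvd_def int_pow_int G.int_pow_pow[symmetric] H.int_pow_pow[symmetric])
    have ext: "f (y [^]\<^bsub>G\<^esub> i) = z [^]\<^bsub>H\<^esub> i" if "y [^]\<^bsub>G\<^esub> (i::int) \<in> K" for i
      using y1[OF yp[OF that]] f.hom_one by simp
    obtain K' F where K': "subgroup K' G" "K' = {k \<otimes>\<^bsub>G\<^esub> y [^]\<^bsub>G\<^esub> i | k (i::int). k \<in> K}"
        "F \<in> hom (G\<lparr>carrier := K'\<rparr>) H"
      and F: "\<forall>k\<in>K. \<forall>i::int. F (k \<otimes>\<^bsub>G\<^esub> y [^]\<^bsub>G\<^esub> i) = f k \<otimes>\<^bsub>H\<^esub> z [^]\<^bsub>H\<^esub> i"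
      using G.hom_extend_by_element[OF H.comm_group_axioms K f y(1) z(1) ext] by blast
    have gK': "group (G\<lparr>carrier := K'\<rparr>)" using subgroup.subgroup_is_group[OF K'(1) G.is_group] .
    interpret F: group_hom "G\<lparr>carrier := K'\<rparr>" H F
      using gK' H.is_group K'(3) by (simp add: group_hom_def group_hom_axioms_def)
    have "a = \<one>\<^bsub>G\<^esub>" if a: "a \<in> K'" "F a = \<one>\<^bsub>H\<^esub>" for a
    proof -
      obtain k and i :: int where ki: "k \<in> K" "a = k \<otimes>\<^bsub>G\<^esub> y [^]\<^bsub>G\<^esub> i" using a(1) K'(2) by blast
      have fk: "f k \<in> carrier H" using f.hom_closed ki(1) by simp
      have eq: "f k \<otimes>\<^bsub>H\<^esub> z [^]\<^bsub>H\<^esub> i = \<one>\<^bsub>H\<^esub>" using F ki a(2) by simp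
      \<comment> \<open>An element k y^i of the kernel forces z^i into the image of K. Then p
        divides i, both powers vanish, and injectivity of f on K applies.\<close>
      then have "z [^]\<^bsub>H\<^esub> i = inv\<^bsub>H\<^esub> (f k)"
        using fk z by (metis H.inv_equality H.int_pow_closed H.m_comm)
      then have "int p dvd i" using zp subgroup.m_inv_closed[OF fK] ki(1) by simp
      note y1[OF this]
      then have "f k = f \<one>\<^bsub>G\<^esub>" and "a = k" using eq fk f.hom_one ki subgroup.mem_carrier[OF K] by auto
      then show ?thesis using inj_onD[OF inj] ki(1) subgroup.one_closed[OF K] by auto
    qed
    then have "inj_on F K'" using F.inj_on_one_iff by simp
    then have "P (card K')" unfolding P_def using K' by blast
    then have "card K' \<le> card K" using max kK by blast
    moreover have "K \<subset> K'"
    proof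
      show "K \<subseteq> K'"
      proof
        fix k assume k: "k \<in> K"
        then have "k = k \<otimes>\<^bsub>G\<^esub> y [^]\<^bsub>G\<^esub> (0::int)" using subgroup.mem_carrier[OF K] by simp
        then show "k \<in> K'" unfolding K'(2) using k by blast
      qed
      have "y = \<one>\<^bsub>G\<^esub> \<otimes>\<^bsub>G\<^esub> y [^]\<^bsub>G\<^esub> (1::int)" using y by simp
      then have "y \<in> K'" unfolding K'(2) using subgroup.one_closed[OF K] by blast
      then show "K \<noteq> K'" using y by blast
    qed
    moreover have "finite K'" using K'(1) fin(1) subgroup.subset finite_subset by blast
    ultimately show False using psubset_card_mono[of K' K] by simp
  qed
  have "f ` carrier G = carrier H"
    using card_subset_eq[OF fin(2)] subgroup.subset[OF fK] card_fK ord
    unfolding KG Coset.order_def by simp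
  then have "f \<in> iso G H" using f inj unfolding KG iso_def bij_betw_def by simp
  then show ?thesis by blast
qed

section \<open>Alternating forms and Lagrangian subgroups\<close>

locale alternating_form = comm_group A for A :: "'a monoid" (structure) +
  fixes \<omega> :: "'a \<Rightarrow> 'a \<Rightarrow> complex"
  assumes fin: "finite (carrier A)"
    and nonzero: "\<lbrakk>g \<in> carrier A; h \<in> carrier A\<rbrakk> \<Longrightarrow> \<omega> g h \<noteq> 0"
    and mult_left: "\<lbrakk>g \<in> carrier A; h \<in> carrier A; k \<in> carrier A\<rbrakk> \<Longrightarrow> \<omega> (g \<otimes> h) k = \<omega> g k * \<omega> h k"
    and mult_right: "\<lbrakk>g \<in> carrier A; h \<in> carrier A; k \<in> carrier A\<rbrakk> \<Longrightarrow> \<omega> k (g \<otimes> h) = \<omega> k g * \<omega> k h"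
    and alternating: "g \<in> carrier A \<Longrightarrow> \<omega> g g = 1"
    and nondegen: "\<lbrakk>g \<in> carrier A; \<And>h. h \<in> carrier A \<Longrightarrow> \<omega> g h = 1\<rbrakk> \<Longrightarrow> g = \<one>"
begin

definition perp :: "'a set \<Rightarrow> 'a set" where
  "perp S = {g \<in> carrier A. \<forall>h\<in>S. \<omega> g h = 1}"

text \<open>Polarization: expand \<omega>(gh, gh) = 1.\<close>

lemma skew:
  assumes "g \<in> carrier A" "h \<in> carrier A" shows "\<omega> g h * \<omega> h g = 1"
proof -
  have "\<omega> (g \<otimes> h) (g \<otimes> h) = \<omega> g h * \<omega> h g"
    using assms by (simp add: mult_left mult_right alternating[OF assms(1)] alternating[OF assms(2)])
  then show ?thesis using alternating[of "g \<otimes> h"] assms by simp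
qed

lemma eq_one_sym:
  assumes "g \<in> carrier A" "h \<in> carrier A" shows "\<omega> g h = 1 \<longleftrightarrow> \<omega> h g = 1"
  using skew[OF assms] by auto

lemma form_one [simp]:
  assumes "g \<in> carrier A" shows "\<omega> \<one> g = 1" "\<omega> g \<one> = 1"
  using mult_left[of \<one> \<one> g] mult_right[of \<one> \<one> g] nonzero[of \<one> g] nonzero[of g \<one>] assms by auto

lemma form_inv:
  assumes "g \<in> carrier A" "h \<in> carrier A" shows "\<omega> (inv g) h = inverse (\<omega> g h)"
  using mult_left[of "inv g" g h] assms inverse_unique[of "\<omega> g h" "\<omega> (inv g) h"]
  by (simp add: mult.commute)

lemma form_pow:
  assumes "g \<in> carrier A" "h \<in> carrier A"
  shows "\<omega> (g [^] (n::nat)) h = \<omega> g h ^ n" "\<omega> h (g [^] n) = \<omega> h g ^ n"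
  using assms by (induction n) (simp_all add: mult_left mult_right)

lemma perp_subset: "perp S \<subseteq> carrier A"
  unfolding perp_def by auto

lemma subgroup_perp: assumes "S \<subseteq> carrier A" shows "subgroup (perp S) A"
proof (rule subgroupI)
  have "\<one> \<in> perp S" unfolding perp_def using assms by auto
  then show "perp S \<noteq> {}" by blast
qed (use assms in \<open>auto simp: perp_def mult_left form_inv subset_iff\<close>)

lemma perp_antimono: "S \<subseteq> T \<Longrightarrow> perp T \<subseteq> perp S"
  unfolding perp_def by auto

text \<open>Orthogonality of characters: when g is not in perp N, translating the summation by some
  k in N with \<omega>(g,k) different from 1 multiplies the sum by that number, so the sum is
  0.\<close>

lemma character_sum:
  assumes N: "subgroup N A" and g: "g \<in> carrier A"
  shows "(\<Sum>h\<in>N. \<omega> g h) = (if g \<in> perp N then of_nat (card N) else 0)"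
proof (cases "g \<in> perp N")
  case True
  then have "(\<Sum>h\<in>N. \<omega> g h) = (\<Sum>h\<in>N. 1)" by (intro sum.cong) (auto simp: perp_def)
  then show ?thesis using True by simp
next
  case False
  then obtain k where k: "k \<in> N" "\<omega> g k \<noteq> 1" using g unfolding perp_def by blast
  have NA: "h \<in> carrier A" if "h \<in> N" for h using subgroup.mem_carrier[OF N that] .
  have "(\<Sum>h\<in>N. \<omega> g h) = (\<Sum>h\<in>N. \<omega> g (k \<otimes> h))"
  proof (rule sum.reindex_bij_witness[of _ "\<lambda>h. k \<otimes> h" "\<lambda>h. inv k \<otimes> h"])
    fix h assume h: "h \<in> N"
    show "k \<otimes> (inv k \<otimes> h) = h" "inv k \<otimes> (k \<otimes> h) = h"
      using NA[OF k(1)] NA[OF h] by (simp_all add: m_assoc[symmetric])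
    show "inv k \<otimes> h \<in> N" "k \<otimes> h \<in> N" 
      using N k(1) h by (simp_all add: subgroup.m_closed subgroup.m_inv_closed)
  qed (use NA k in \<open>simp add: m_assoc[symmetric]\<close>)
  also have "\<dots> = \<omega> g k * (\<Sum>h\<in>N. \<omega> g h)"
    using NA k(1) g by (simp add: mult_right sum_distrib_left)
  finally have "(1 - \<omega> g k) * (\<Sum>h\<in>N. \<omega> g h) = 0" by (simp add: algebra_simps)
  then show ?thesis using k(2) False by simp
qed

lemma perp_carrier: "perp (carrier A) = {\<one>}"
  using nondegen unfolding perp_def by auto

text \<open>Double counting of the sum of \<omega>(g,h) over g in A and h in N. Summing over h first
  leaves |N| for each g in perp N. Summing over g first leaves |A| for h = 1 alone, by
  non-degeneracy.\<close>

lemma card_perp: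
  assumes N: "subgroup N A"
  shows "card N * card (perp N) = Coset.order A"
proof -
  have NA: "N \<subseteq> carrier A" using N by (rule subgroup.subset)
  have A: "subgroup (carrier A) A" by (rule subgroup_self)
  have "(\<Sum>g\<in>carrier A. \<Sum>h\<in>N. \<omega> g h) = (\<Sum>g\<in>carrier A. if g \<in> perp N then of_nat (card N) else 0)"
    using character_sum[OF N] by (intro sum.cong) auto
  also have "\<dots> = (\<Sum>g\<in>perp N. of_nat (card N))"
    using fin perp_subset by (intro sum.mono_neutral_cong_right) auto
  finally have 1: "(\<Sum>g\<in>carrier A. \<Sum>h\<in>N. \<omega> g h) = of_nat (card N * card (perp N))" by simp
  \<comment> \<open>Character sums run over the second argument, so skew-symmetry is used to move g
    there, at the price of inverting h.\<close>
  have "(\<Sum>g\<in>carrier A. \<Sum>h\<in>N. \<omega> g h) = (\<Sum>h\<in>N. \<Sum>g\<in>carrier A. inverse (\<omega> h g))"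
  proof (subst sum.swap, intro sum.cong refl)
    fix h g assume "h \<in> N" "g \<in> carrier A"
    then show "\<omega> g h = inverse (\<omega> h g)" using skew[of h g] NA inverse_unique by (metis subsetD)
  qed
  also have "\<dots> = (\<Sum>h\<in>N. \<Sum>g\<in>carrier A. \<omega> (inv h) g)"
    using NA by (intro sum.cong refl) (auto simp: form_inv)
  also have "\<dots> = (\<Sum>h\<in>N. if h = \<one> then of_nat (card (carrier A)) else 0)"
    using NA by (intro sum.cong refl) (auto simp: character_sum[OF A] perp_carrier subset_iff inv_eq_1_iff)
  also have "\<dots> = of_nat (card (carrier A))"
    using subgroup.one_closed[OF N] finite_subset[OF NA fin] by simp
  finally show ?thesis using 1 unfolding Coset.order_def by (metis of_nat_eq_iff)
qed

lemma subset_perp_perp: "N \<subseteq> carrier A \<Longrightarrow> N \<subseteq> perp (perp N)"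
  unfolding perp_def using eq_one_sym by auto

lemma perp_perp:
  assumes N: "subgroup N A" shows "perp (perp N) = N"
proof -
  have NA: "N \<subseteq> carrier A" using N by (rule subgroup.subset)
  have "0 < card N" using finite_subset[OF NA fin] subgroup.one_closed[OF N] card_gt_0_iff by blast
  moreover have "0 < Coset.order A" using fin order_gt_0_iff_finite by blast
  then have "0 < card (perp N)" using card_perp[OF N] by (metis mult_0_right neq0_conv)
  moreover have "card (perp N) * card (perp (perp N)) = card N * card (perp N)"
    using card_perp[OF N] card_perp[OF subgroup_perp[OF NA]] by simp
  ultimately have "card (perp (perp N)) = card N" by simp
  moreover have "finite (perp (perp N))" using perp_subset fin finite_subset by blast
  ultimately show ?thesis using card_subset_eq[OF _ subset_perp_perp[OF NA]] by simp
qed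

definition lagrangian :: "'a set \<Rightarrow> bool" where
  "lagrangian L \<longleftrightarrow> subgroup L A \<and> perp L = L"

text \<open>A maximal isotropic set L containing R equals its perp, since by alternation any x in
  perp L could be added to it. The perp of any set is a subgroup, so maximality among sets delivers
  the subgroup structure for free.\<close>

lemma lagrangian_above:
  assumes R: "R \<subseteq> carrier A" "\<And>r s. r \<in> R \<Longrightarrow> s \<in> R \<Longrightarrow> \<omega> r s = 1"
  obtains L where "lagrangian L" "R \<subseteq> L"
proof -
  define P where "P S \<longleftrightarrow> S \<subseteq> carrier A \<and> R \<subseteq> S \<and> (\<forall>r\<in>S. \<forall>s\<in>S. \<omega> r s = 1)" for S
  have "finite {S. P S}" using fin unfolding P_def by (auto intro: finite_subset[OF _ finite_Pow_iff[THEN iffD2]])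
  moreover have "R \<in> {S. P S}" using R unfolding P_def by auto
  ultimately obtain L where L: "P L" and max: "\<And>S. P S \<Longrightarrow> L \<subseteq> S \<Longrightarrow> S = L"
    using finite_has_maximal[of "{S. P S}"] by blast
  have LA: "L \<subseteq> carrier A" and L1: "\<And>r s. r \<in> L \<Longrightarrow> s \<in> L \<Longrightarrow> \<omega> r s = 1" using L unfolding P_def by auto
  have "perp L = L"
  proof
    show "L \<subseteq> perp L" using LA L1 unfolding perp_def by auto
    show "perp L \<subseteq> L"
    proof
      fix x assume x: "x \<in> perp L"
      then have "x \<in> carrier A" "\<forall>h\<in>L. \<omega> x h = 1" "\<forall>h\<in>L. \<omega> h x = 1"
        unfolding perp_def using eq_one_sym LA by auto
      then have "P (insert x L)" using L alternating unfolding P_def by auto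
      then show "x \<in> L" using max by blast
    qed
  qed
  moreover from this have "subgroup L A" using subgroup_perp[OF LA] by simp
  moreover have "R \<subseteq> L" using L unfolding P_def by auto
  ultimately show ?thesis using that unfolding lagrangian_def by blast
qed

text \<open>Dual to the previous lemma: under the hypothesis perp N is isotropic, and a Lagrangian
  containing it lies, after taking perps, inside perp (perp N) = N.\<close>

lemma lagrangian_below:
  assumes N: "subgroup N A" "perp N \<subseteq> N"
  obtains L where "lagrangian L" "L \<subseteq> N"
proof -
  obtain L where L: "lagrangian L" "perp N \<subseteq> L"
    by (rule lagrangian_above[of "perp N"]) (use N(2) in \<open>auto simp: perp_def\<close>)
  have "L = perp L" using L unfolding lagrangian_def by simp
  also have "\<dots> \<subseteq> perp (perp N)" using perp_antimono[OF L(2)] .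
  finally show ?thesis using that L(1) perp_perp[OF N(1)] by simp
qed

lemma card_lagrangian:
  assumes "lagrangian L" shows "card L ^ 2 = Coset.order A"
  using assms card_perp[of L] unfolding lagrangian_def power2_eq_square by simp

end

section \<open>Gradings and quotient morphisms\<close>

lemma algebra_isoD:
  assumes "\<psi> \<in> algebra_iso M N"
  shows "\<And>x. x \<in> carrier M \<Longrightarrow> \<psi> x \<in> carrier N"
    "\<And>x y. x \<in> carrier M \<Longrightarrow> y \<in> carrier M \<Longrightarrow> \<psi> (x \<otimes>\<^bsub>M\<^esub> y) = \<psi> x \<otimes>\<^bsub>N\<^esub> \<psi> y"
    "\<And>x y. x \<in> carrier M \<Longrightarrow> y \<in> carrier M \<Longrightarrow> \<psi> (x \<oplus>\<^bsub>M\<^esub> y) = \<psi> x \<oplus>\<^bsub>N\<^esub> \<psi> y"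
    "\<psi> \<one>\<^bsub>M\<^esub> = \<one>\<^bsub>N\<^esub>"
    "\<And>c x. x \<in> carrier M \<Longrightarrow> \<psi> (c \<odot>\<^bsub>M\<^esub> x) = c \<odot>\<^bsub>N\<^esub> \<psi> x"
    "bij_betw \<psi> (carrier M) (carrier N)"
  using assms by (auto simp: algebra_iso_def ring_iso_def Ring.ring_hom_def)

lemma algebra_iso_comp:
  "\<lbrakk>\<psi> \<in> algebra_iso M N; \<chi> \<in> algebra_iso N P\<rbrakk> \<Longrightarrow> \<chi> \<circ> \<psi> \<in> algebra_iso M P"
  using ring_iso_set_trans[of \<psi> M N \<chi> P] algebra_isoD(1)[of \<psi> M N]
  by (simp add: algebra_iso_def)

lemma algebra_iso_id: "id \<in> algebra_iso M M"
  using ring_iso_set_refl[of M] by (simp add: algebra_iso_def)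

lemma algebra_iso_inv:
  assumes M: "complex_algebra M" and \<psi>: "\<psi> \<in> algebra_iso M N"
  shows "inv_into (carrier M) \<psi> \<in> algebra_iso N M"
proof -
  interpret complex_algebra M by fact
  have bij: "bij_betw \<psi> (carrier M) (carrier N)" using algebra_isoD(6)[OF \<psi>] .
  have "inv_into (carrier M) \<psi> (c \<odot>\<^bsub>N\<^esub> y) = c \<odot>\<^bsub>M\<^esub> inv_into (carrier M) \<psi> y"
    if y: "y \<in> carrier N" for c y
  proof (rule inv_into_f_eq)
    show "inj_on \<psi> (carrier M)" using bij by (rule bij_betw_imp_inj_on)
    have mem: "inv_into (carrier M) \<psi> y \<in> carrier M" using bij y by (metis bij_betw_imp_surj_on inv_into_into)
    then show "c \<odot>\<^bsub>M\<^esub> inv_into (carrier M) \<psi> y \<in> carrier M"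
      by (simp add: smult_closed class_ring_simps)
    show "\<psi> (c \<odot>\<^bsub>M\<^esub> inv_into (carrier M) \<psi> y) = c \<odot>\<^bsub>N\<^esub> y"
      using algebra_isoD(5)[OF \<psi> mem] bij_betw_inv_into_right[OF bij y] by simp
  qed
  then show ?thesis
    using ring_iso_set_sym[OF ring_axioms, of \<psi> N] \<psi> by (simp add: algebra_iso_def)
qed

text \<open>Meant for coordinate functionals, such as a matrix entry or the value of f at k; it
  turns sums in the algebra into ordinary sums of complex numbers.\<close>

lemma (in complex_algebra) additive_finsum:
  fixes c :: "_ \<Rightarrow> complex"
  assumes add: "\<And>x y. x \<in> carrier M \<Longrightarrow> y \<in> carrier M \<Longrightarrow> c (x \<oplus>\<^bsub>M\<^esub> y) = c x + c y"
    and "finite S" "f \<in> S \<rightarrow> carrier M"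
  shows "c (finsum M f S) = (\<Sum>s\<in>S. c (f s))"
  using assms(2,3)
proof (induction S rule: finite_induct)
  case empty
  have "c (\<zero>\<^bsub>M\<^esub> \<oplus>\<^bsub>M\<^esub> \<zero>\<^bsub>M\<^esub>) = c \<zero>\<^bsub>M\<^esub> + c \<zero>\<^bsub>M\<^esub>" by (rule add) auto
  then show ?case by simp
next
  case (insert s S)
  then show ?case by (simp add: add)
qed

lemma algebra_iso_finsum:
  assumes "complex_algebra M" "complex_algebra N" "\<psi> \<in> algebra_iso M N"
    and "finite S" "f \<in> S \<rightarrow> carrier M"
  shows "\<psi> (finsum M f S) = finsum N (\<lambda>s. \<psi> (f s)) S"
proof -
  interpret M: complex_algebra M by fact
  interpret N: complex_algebra N by fact
  note \<psi> = algebra_isoD[OF assms(3)]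
  show ?thesis using assms(4,5)
  proof (induction S rule: finite_induct)
    case empty
    have "\<psi> \<zero>\<^bsub>M\<^esub> \<oplus>\<^bsub>N\<^esub> \<psi> \<zero>\<^bsub>M\<^esub> = \<psi> \<zero>\<^bsub>M\<^esub> \<oplus>\<^bsub>N\<^esub> \<zero>\<^bsub>N\<^esub>"
      using \<psi>(3)[of "\<zero>\<^bsub>M\<^esub>" "\<zero>\<^bsub>M\<^esub>"] \<psi>(1)[of "\<zero>\<^bsub>M\<^esub>"] by simp
    then show ?case using \<psi>(1)[of "\<zero>\<^bsub>M\<^esub>"] by simp
  next
    case (insert s S)
    then have "(\<lambda>s. \<psi> (f s)) \<in> S \<rightarrow> carrier N" using \<psi>(1) by auto
    then show ?case using insert \<psi>(1) \<psi>(3) by simp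
  qed
qed

lemma algebra_iso_zero:
  assumes "complex_algebra M" "complex_algebra N" "\<psi> \<in> algebra_iso M N"
  shows "\<psi> \<zero>\<^bsub>M\<^esub> = \<zero>\<^bsub>N\<^esub>"
proof -
  interpret M: complex_algebra M by fact
  interpret N: complex_algebra N by fact
  show ?thesis using algebra_iso_finsum[OF assms, of "{}"] by simp
qed

section \<open>Homogeneous components and their behaviour under quotient morphisms\<close>

lemma is_gradingD:
  assumes "is_grading M (\<Gamma>, V)"
  shows "complex_algebra M" "group \<Gamma>"
    "\<And>\<gamma>. \<gamma> \<in> carrier \<Gamma> \<Longrightarrow> V \<gamma> \<subseteq> carrier M"
    "\<And>\<gamma>. \<gamma> \<in> carrier \<Gamma> \<Longrightarrow> \<zero>\<^bsub>M\<^esub> \<in> V \<gamma>"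
    "\<And>\<gamma> x y. \<gamma> \<in> carrier \<Gamma> \<Longrightarrow> x \<in> V \<gamma> \<Longrightarrow> y \<in> V \<gamma> \<Longrightarrow> x \<oplus>\<^bsub>M\<^esub> y \<in> V \<gamma>"
proof -
  show "complex_algebra M" "group \<Gamma>" using assms by (simp_all add: is_grading_def)
  fix \<gamma> assume "\<gamma> \<in> carrier \<Gamma>"
  then have "LinearCombinations.submodule class_ring (V \<gamma>) M"
    using assms by (simp add: is_grading_def VectorSpace.subspace_def)
  then show "V \<gamma> \<subseteq> carrier M" "\<zero>\<^bsub>M\<^esub> \<in> V \<gamma>"
    "\<And>x y. x \<in> V \<gamma> \<Longrightarrow> y \<in> V \<gamma> \<Longrightarrow> x \<oplus>\<^bsub>M\<^esub> y \<in> V \<gamma>"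
    by (simp_all add: LinearCombinations.submodule_def)
qed

lemma grading_component_finsum:
  assumes "is_grading M (\<Gamma>, V)" "\<gamma> \<in> carrier \<Gamma>" "finite S" "\<And>s. s \<in> S \<Longrightarrow> f s \<in> V \<gamma>"
  shows "finsum M f S \<in> V \<gamma>"
  using assms(3,4)
proof (induction S rule: finite_induct)
  case empty
  interpret complex_algebra M using is_gradingD(1)[OF assms(1)] .
  show ?case using is_gradingD(4)[OF assms(1,2)] by simp
next
  case (insert s S)
  interpret complex_algebra M using is_gradingD(1)[OF assms(1)] .
  have "finsum M f (insert s S) = f s \<oplus>\<^bsub>M\<^esub> finsum M f S"
    using insert is_gradingD(3)[OF assms(1,2)] by (intro finsum_insert) auto
  then show ?case using insert is_gradingD(5)[OF assms(1,2)] by simp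
qed

text \<open>For a finite group the sum over the support may be taken over the entire group. With its
  uniqueness counterpart below, this removes supports and extensional functions from all later
  arguments.\<close>

lemma grading_decomposition:
  assumes G: "is_grading M (\<Gamma>, V)" and finG: "finite (carrier \<Gamma>)" and x: "x \<in> carrier M"
  obtains f where "\<And>\<gamma>. \<gamma> \<in> carrier \<Gamma> \<Longrightarrow> f \<gamma> \<in> V \<gamma>" "x = finsum M f (carrier \<Gamma>)"
proof -
  interpret complex_algebra M using is_gradingD(1)[OF G] .
  obtain f where f: "f \<in> (\<Pi>\<^sub>E \<gamma>\<in>carrier \<Gamma>. V \<gamma>)"
      "x = finsum M f {\<gamma>\<in>carrier \<Gamma>. f \<gamma> \<noteq> \<zero>\<^bsub>M\<^esub>}"
    using G x unfolding is_grading_def by blast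
  have "finsum M f {\<gamma>\<in>carrier \<Gamma>. f \<gamma> \<noteq> \<zero>\<^bsub>M\<^esub>} = finsum M f (carrier \<Gamma>)"
    using finG f(1) is_gradingD(3)[OF G] by (intro add.finprod_mono_neutral_cong_left) auto
  then show ?thesis using that[of f] f by auto
qed

lemma grading_decomposition_unique:
  assumes G: "is_grading M (\<Gamma>, V)" and finG: "finite (carrier \<Gamma>)"
    and f: "\<And>\<gamma>. \<gamma> \<in> carrier \<Gamma> \<Longrightarrow> f \<gamma> \<in> V \<gamma>" and g: "\<And>\<gamma>. \<gamma> \<in> carrier \<Gamma> \<Longrightarrow> g \<gamma> \<in> V \<gamma>"
    and eq: "finsum M f (carrier \<Gamma>) = finsum M g (carrier \<Gamma>)" and \<gamma>: "\<gamma> \<in> carrier \<Gamma>"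
  shows "f \<gamma> = g \<gamma>"
proof -
  interpret complex_algebra M using is_gradingD(1)[OF G] .
  let ?D = "\<lambda>x f. f \<in> (\<Pi>\<^sub>E \<gamma>\<in>carrier \<Gamma>. V \<gamma>) \<and> finite {\<gamma>\<in>carrier \<Gamma>. f \<gamma> \<noteq> \<zero>\<^bsub>M\<^esub>} \<and>
    x = finsum M f {\<gamma>\<in>carrier \<Gamma>. f \<gamma> \<noteq> \<zero>\<^bsub>M\<^esub>}"
  have D: "?D (finsum M h (carrier \<Gamma>)) (restrict h (carrier \<Gamma>))"
    if h: "\<And>\<gamma>. \<gamma> \<in> carrier \<Gamma> \<Longrightarrow> h \<gamma> \<in> V \<gamma>" for h
  proof (intro conjI)
    show "finsum M h (carrier \<Gamma>) =
        finsum M (restrict h (carrier \<Gamma>)) {\<gamma>\<in>carrier \<Gamma>. restrict h (carrier \<Gamma>) \<gamma> \<noteq> \<zero>\<^bsub>M\<^esub>}"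
      using finG h is_gradingD(3)[OF G] by (intro add.finprod_mono_neutral_cong_right) auto
  qed (use finG h in auto)
  have "finsum M f (carrier \<Gamma>) \<in> carrier M" using f is_gradingD(3)[OF G] by (intro finsum_closed) auto
  then have "\<exists>!h. ?D (finsum M f (carrier \<Gamma>)) h"
    using G unfolding is_grading_def by blast
  moreover have "?D (finsum M f (carrier \<Gamma>)) (restrict f (carrier \<Gamma>))" using D[OF f] .
  moreover have "?D (finsum M f (carrier \<Gamma>)) (restrict g (carrier \<Gamma>))" using D[OF g] eq by simp
  ultimately have "restrict f (carrier \<Gamma>) = restrict g (carrier \<Gamma>)" by blast
  then show ?thesis using \<gamma> by (metis restrict_apply')
qed

text \<open>Group the components of x by the fibres of \<phi>: their images add up to the
  decomposition of \<psi>(x). If that is concentrated in degree \<delta>, uniqueness kills the sum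
  over each other fibre, first in N and then, as \<psi> is injective, in M. Uniqueness in M finally
  kills the individual summands of such a fibre.\<close>

lemma quotient_morphism_components:
  assumes G1: "is_grading M (\<Gamma>\<^sub>1, V\<^sub>1)" and G2: "is_grading N (\<Gamma>\<^sub>2, V\<^sub>2)" and finG: "finite (carrier \<Gamma>\<^sub>1)"
    and q: "quotient_morphism M (\<Gamma>\<^sub>1, V\<^sub>1) N (\<Gamma>\<^sub>2, V\<^sub>2) \<psi> \<phi>"
    and f: "\<And>\<gamma>. \<gamma> \<in> carrier \<Gamma>\<^sub>1 \<Longrightarrow> f \<gamma> \<in> V\<^sub>1 \<gamma>"
    and \<delta>: "\<delta> \<in> carrier \<Gamma>\<^sub>2" "\<psi> (finsum M f (carrier \<Gamma>\<^sub>1)) \<in> V\<^sub>2 \<delta>"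
    and \<gamma>: "\<gamma> \<in> carrier \<Gamma>\<^sub>1" "\<phi> \<gamma> \<noteq> \<delta>"
  shows "f \<gamma> = \<zero>\<^bsub>M\<^esub>"
proof -
  interpret M: complex_algebra M using is_gradingD(1)[OF G1] .
  interpret N: complex_algebra N using is_gradingD(1)[OF G2] .
  have \<psi>: "\<psi> \<in> algebra_iso M N" and surj: "\<phi> ` carrier \<Gamma>\<^sub>1 = carrier \<Gamma>\<^sub>2"
    and V: "\<And>\<gamma> x. \<gamma> \<in> carrier \<Gamma>\<^sub>1 \<Longrightarrow> x \<in> V\<^sub>1 \<gamma> \<Longrightarrow> \<psi> x \<in> V\<^sub>2 (\<phi> \<gamma>)"
    using q unfolding quotient_morphism_def by auto
  note \<psi>' = algebra_isoD[OF \<psi>]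
  have fin2: "finite (carrier \<Gamma>\<^sub>2)" using surj finG finite_imageI by metis
  have fc: "f \<gamma> \<in> carrier M" if "\<gamma> \<in> carrier \<Gamma>\<^sub>1" for \<gamma> using f[OF that] is_gradingD(3)[OF G1 that] by blast
  let ?F = "\<lambda>\<delta>'. {\<gamma> \<in> carrier \<Gamma>\<^sub>1. \<phi> \<gamma> = \<delta>'}"
  define h where "h \<delta>' = finsum N (\<lambda>\<gamma>. \<psi> (f \<gamma>)) (?F \<delta>')" for \<delta>'
  define y where "y = \<psi> (finsum M f (carrier \<Gamma>\<^sub>1))"
  have h: "h \<delta>' \<in> V\<^sub>2 \<delta>'" if "\<delta>' \<in> carrier \<Gamma>\<^sub>2" for \<delta>'
    unfolding h_def using finG f V by (intro grading_component_finsum[OF G2 that]) auto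
  have "finsum N h (carrier \<Gamma>\<^sub>2) = finsum N (\<lambda>\<gamma>. \<psi> (f \<gamma>)) (\<Union> (?F ` carrier \<Gamma>\<^sub>2))"
    unfolding h_def using finG fin2 fc \<psi>'(1)
    by (intro N.add.finprod_UN_disjoint[symmetric]) (auto simp: pairwise_def disjnt_def)
  also have "\<Union> (?F ` carrier \<Gamma>\<^sub>2) = carrier \<Gamma>\<^sub>1" using surj by auto
  also have "finsum N (\<lambda>\<gamma>. \<psi> (f \<gamma>)) (carrier \<Gamma>\<^sub>1) = y"
    unfolding y_def using fc
    by (intro algebra_iso_finsum[OF M.complex_algebra_axioms N.complex_algebra_axioms \<psi> finG, symmetric]) auto
  \<comment> \<open>A homogeneous element is its own decomposition, with all other components zero;
    this is compared with \<open>h\<close>.\<close>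
  also have "y = finsum N (\<lambda>\<delta>'. if \<delta> = \<delta>' then y else \<zero>\<^bsub>N\<^esub>) (carrier \<Gamma>\<^sub>2)"
  proof -
    have "y \<in> carrier N" using \<delta> is_gradingD(3)[OF G2] unfolding y_def by auto
    then show ?thesis using N.add.finprod_singleton[OF \<delta>(1) fin2, of "\<lambda>_. y"] by simp
  qed
  finally have eq: "finsum N h (carrier \<Gamma>\<^sub>2) = finsum N (\<lambda>\<delta>'. if \<delta> = \<delta>' then y else \<zero>\<^bsub>N\<^esub>) (carrier \<Gamma>\<^sub>2)" .
  have "h (\<phi> \<gamma>) = (if \<delta> = \<phi> \<gamma> then y else \<zero>\<^bsub>N\<^esub>)"
    by (rule grading_decomposition_unique[OF G2 fin2 h _ eq])
      (use \<delta> \<gamma> surj is_gradingD(4)[OF G2] in \<open>auto simp: y_def\<close>)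
  then have "h (\<phi> \<gamma>) = \<zero>\<^bsub>N\<^esub>" using \<gamma> by simp
  moreover have "h (\<phi> \<gamma>) = \<psi> (finsum M f (?F (\<phi> \<gamma>)))"
    unfolding h_def using finG fc
    by (intro algebra_iso_finsum[OF M.complex_algebra_axioms N.complex_algebra_axioms \<psi>, symmetric]) auto
  moreover have "\<psi> \<zero>\<^bsub>M\<^esub> = \<zero>\<^bsub>N\<^esub>"
    by (rule algebra_iso_zero[OF M.complex_algebra_axioms N.complex_algebra_axioms \<psi>])
  moreover have "finsum M f (?F (\<phi> \<gamma>)) \<in> carrier M" using fc by (intro M.finsum_closed) auto
  ultimately have "finsum M f (?F (\<phi> \<gamma>)) = \<zero>\<^bsub>M\<^esub>"
    using \<psi>'(6) M.zero_closed unfolding bij_betw_def inj_on_def by metis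
  moreover have "finsum M (\<lambda>\<gamma>'. if \<phi> \<gamma>' = \<phi> \<gamma> then f \<gamma>' else \<zero>\<^bsub>M\<^esub>) (carrier \<Gamma>\<^sub>1) = finsum M f (?F (\<phi> \<gamma>))"
    using finG fc by (intro M.add.finprod_mono_neutral_cong_right) auto
  ultimately have eq0: "finsum M (\<lambda>\<gamma>'. if \<phi> \<gamma>' = \<phi> \<gamma> then f \<gamma>' else \<zero>\<^bsub>M\<^esub>) (carrier \<Gamma>\<^sub>1) =
      finsum M (\<lambda>_. \<zero>\<^bsub>M\<^esub>) (carrier \<Gamma>\<^sub>1)" by simp
  have "(if \<phi> \<gamma> = \<phi> \<gamma> then f \<gamma> else \<zero>\<^bsub>M\<^esub>) = \<zero>\<^bsub>M\<^esub>"
    by (rule grading_decomposition_unique[OF G1 finG _ _ eq0 \<gamma>(1)]) (use f is_gradingD(4)[OF G1] in auto)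
  then show ?thesis by simp
qed

lemma quotient_morphism_comp:
  assumes "quotient_morphism M \<G> N \<H> \<psi> \<phi>" "quotient_morphism N \<H> P \<K> \<psi>' \<phi>'"
  shows "quotient_morphism M \<G> P \<K> (\<psi>' \<circ> \<psi>) (\<phi>' \<circ> \<phi>)"
  unfolding quotient_morphism_def
proof (intro conjI ballI)
  show "\<psi>' \<circ> \<psi> \<in> algebra_iso M P"
    by (rule algebra_iso_comp[of _ _ N]) (use assms in \<open>simp_all add: quotient_morphism_def\<close>)
  show "\<phi>' \<circ> \<phi> \<in> hom (fst \<G>) (fst \<K>)"
    by (rule Group.hom_compose[of _ _ "fst \<H>"]) (use assms in \<open>simp_all add: quotient_morphism_def\<close>)
  have s: "\<phi> ` carrier (fst \<G>) = carrier (fst \<H>)" "\<phi>' ` carrier (fst \<H>) = carrier (fst \<K>)"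
    using assms unfolding quotient_morphism_def by auto
  then show "(\<phi>' \<circ> \<phi>) ` carrier (fst \<G>) = carrier (fst \<K>)" by (metis image_comp)
  fix \<gamma> assume "\<gamma> \<in> carrier (fst \<G>)"
  moreover from this have "\<phi> \<gamma> \<in> carrier (fst \<H>)" using s by blast
  ultimately have "\<psi> ` snd \<G> \<gamma> \<subseteq> snd \<H> (\<phi> \<gamma>)" "\<psi>' ` snd \<H> (\<phi> \<gamma>) \<subseteq> snd \<K> (\<phi>' (\<phi> \<gamma>))"
    using assms unfolding quotient_morphism_def by auto
  then show "(\<psi>' \<circ> \<psi>) ` snd \<G> \<gamma> \<subseteq> snd \<K> ((\<phi>' \<circ> \<phi>) \<gamma>)" by auto
qed

lemma quotient_morphism_id: "quotient_morphism M \<G> M \<G> id id"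
  unfolding quotient_morphism_def using algebra_iso_id by (auto simp: hom_def)

text \<open>Since the components of a quotient grading are sums of images of components, a quotient
  morphism factors through another one as soon as the group homomorphisms do.\<close>

lemma quotient_morphism_factor:
  assumes G0: "is_grading P (\<Gamma>\<^sub>0, V\<^sub>0)" and finG: "finite (carrier \<Gamma>\<^sub>0)"
    and G1: "is_grading M (\<Gamma>\<^sub>1, V\<^sub>1)" and G2: "is_grading N (\<Gamma>\<^sub>2, V\<^sub>2)"
    and q1: "quotient_morphism P (\<Gamma>\<^sub>0, V\<^sub>0) M (\<Gamma>\<^sub>1, V\<^sub>1) \<psi>\<^sub>1 \<phi>\<^sub>1"
    and q2: "quotient_morphism P (\<Gamma>\<^sub>0, V\<^sub>0) N (\<Gamma>\<^sub>2, V\<^sub>2) \<psi>\<^sub>2 \<phi>\<^sub>2"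
    and ker: "\<And>a b. a \<in> carrier \<Gamma>\<^sub>0 \<Longrightarrow> b \<in> carrier \<Gamma>\<^sub>0 \<Longrightarrow> \<phi>\<^sub>1 a = \<phi>\<^sub>1 b \<Longrightarrow> \<phi>\<^sub>2 a = \<phi>\<^sub>2 b"
  obtains \<psi> \<phi> where "quotient_morphism M (\<Gamma>\<^sub>1, V\<^sub>1) N (\<Gamma>\<^sub>2, V\<^sub>2) \<psi> \<phi>"
    "\<And>a. a \<in> carrier \<Gamma>\<^sub>0 \<Longrightarrow> \<phi> (\<phi>\<^sub>1 a) = \<phi>\<^sub>2 a"
proof -
  interpret P: complex_algebra P using is_gradingD(1)[OF G0] .
  interpret N: complex_algebra N using is_gradingD(1)[OF G2] .
  interpret \<Gamma>\<^sub>0: group \<Gamma>\<^sub>0 using is_gradingD(2)[OF G0] .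
  have \<psi>1: "\<psi>\<^sub>1 \<in> algebra_iso P M" and hom1: "\<phi>\<^sub>1 \<in> hom \<Gamma>\<^sub>0 \<Gamma>\<^sub>1" and surj1: "\<phi>\<^sub>1 ` carrier \<Gamma>\<^sub>0 = carrier \<Gamma>\<^sub>1"
    using q1 unfolding quotient_morphism_def by auto
  have \<psi>2: "\<psi>\<^sub>2 \<in> algebra_iso P N" and hom2: "\<phi>\<^sub>2 \<in> hom \<Gamma>\<^sub>0 \<Gamma>\<^sub>2" and surj2: "\<phi>\<^sub>2 ` carrier \<Gamma>\<^sub>0 = carrier \<Gamma>\<^sub>2"
    and V2: "\<And>a x. a \<in> carrier \<Gamma>\<^sub>0 \<Longrightarrow> x \<in> V\<^sub>0 a \<Longrightarrow> \<psi>\<^sub>2 x \<in> V\<^sub>2 (\<phi>\<^sub>2 a)"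
    using q2 unfolding quotient_morphism_def by auto
  \<comment> \<open>Preimages are chosen arbitrarily; \<open>ker\<close> makes \<phi> independent of
    the choice.\<close>
  define \<phi> where "\<phi> = (\<lambda>\<gamma>. \<phi>\<^sub>2 (inv_into (carrier \<Gamma>\<^sub>0) \<phi>\<^sub>1 \<gamma>))"
  define \<psi> where "\<psi> = \<psi>\<^sub>2 \<circ> inv_into (carrier P) \<psi>\<^sub>1"
  have \<phi>: "\<phi> (\<phi>\<^sub>1 a) = \<phi>\<^sub>2 a" if a: "a \<in> carrier \<Gamma>\<^sub>0" for a
    unfolding \<phi>_def using a by (intro ker) (auto intro: inv_into_into f_inv_into_f)
  have "quotient_morphism M (\<Gamma>\<^sub>1, V\<^sub>1) N (\<Gamma>\<^sub>2, V\<^sub>2) \<psi> \<phi>"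
    unfolding quotient_morphism_def fst_conv snd_conv
  proof (intro conjI ballI)
    show "\<psi> \<in> algebra_iso M N"
      unfolding \<psi>_def by (rule algebra_iso_comp[OF algebra_iso_inv[OF P.complex_algebra_axioms \<psi>1] \<psi>2])
    show "\<phi> \<in> hom \<Gamma>\<^sub>1 \<Gamma>\<^sub>2"
    proof (rule homI)
      fix \<gamma> assume "\<gamma> \<in> carrier \<Gamma>\<^sub>1"
      then obtain a where "a \<in> carrier \<Gamma>\<^sub>0" "\<gamma> = \<phi>\<^sub>1 a" using surj1 by blast
      then show "\<phi> \<gamma> \<in> carrier \<Gamma>\<^sub>2" using \<phi> surj2 by auto
    next
      fix \<gamma> \<delta> assume "\<gamma> \<in> carrier \<Gamma>\<^sub>1" "\<delta> \<in> carrier \<Gamma>\<^sub>1"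
      then obtain a b where ab: "a \<in> carrier \<Gamma>\<^sub>0" "\<gamma> = \<phi>\<^sub>1 a" "b \<in> carrier \<Gamma>\<^sub>0" "\<delta> = \<phi>\<^sub>1 b" using surj1 by blast
      then have "\<phi> (\<gamma> \<otimes>\<^bsub>\<Gamma>\<^sub>1\<^esub> \<delta>) = \<phi> (\<phi>\<^sub>1 (a \<otimes>\<^bsub>\<Gamma>\<^sub>0\<^esub> b))" using hom_mult[OF hom1] by simp
      then show "\<phi> (\<gamma> \<otimes>\<^bsub>\<Gamma>\<^sub>1\<^esub> \<delta>) = \<phi> \<gamma> \<otimes>\<^bsub>\<Gamma>\<^sub>2\<^esub> \<phi> \<delta>" using \<phi> ab hom_mult[OF hom2] by simp
    qed
    show "\<phi> ` carrier \<Gamma>\<^sub>1 = carrier \<Gamma>\<^sub>2"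
      unfolding surj1[symmetric] image_image using \<phi> surj2 by simp
    fix \<gamma> assume \<gamma>: "\<gamma> \<in> carrier \<Gamma>\<^sub>1"
    then obtain a0 where "a0 \<in> carrier \<Gamma>\<^sub>0" "\<gamma> = \<phi>\<^sub>1 a0" using surj1 by blast
    then have \<phi>\<gamma>: "\<phi> \<gamma> \<in> carrier \<Gamma>\<^sub>2" using \<phi> surj2 by auto
    show "\<psi> ` V\<^sub>1 \<gamma> \<subseteq> V\<^sub>2 (\<phi> \<gamma>)"
    proof
      fix z assume "z \<in> \<psi> ` V\<^sub>1 \<gamma>"
      then obtain y where y: "y \<in> V\<^sub>1 \<gamma>" "z = \<psi> y" by blast
      define x where "x = inv_into (carrier P) \<psi>\<^sub>1 y"
      have yM: "y \<in> carrier M" using y(1) is_gradingD(3)[OF G1 \<gamma>] by blast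
      note bij = algebra_isoD(6)[OF \<psi>1]
      have x: "x \<in> carrier P" "\<psi>\<^sub>1 x = y"
        unfolding x_def using yM bij by (metis bij_betw_imp_surj_on inv_into_into, metis bij bij_betw_inv_into_right yM)
      obtain f where f: "\<And>a. a \<in> carrier \<Gamma>\<^sub>0 \<Longrightarrow> f a \<in> V\<^sub>0 a" "x = finsum P f (carrier \<Gamma>\<^sub>0)"
        using grading_decomposition[OF G0 finG x(1)] by blast
      \<comment> \<open>Thus x is a sum of homogeneous pieces with degrees in the fibre over
        \<gamma>, all of which \<psi>2 carries to the same component.\<close>
      have f0: "f a = \<zero>\<^bsub>P\<^esub>" if "a \<in> carrier \<Gamma>\<^sub>0" "\<phi>\<^sub>1 a \<noteq> \<gamma>" for a
        by (rule quotient_morphism_components[OF G0 G1 finG q1 f(1) \<gamma> _ that]) (use f(2) x y in auto)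
      have fc: "f \<in> carrier \<Gamma>\<^sub>0 \<rightarrow> carrier P" using f(1) is_gradingD(3)[OF G0] by auto
      have \<psi>0: "\<psi>\<^sub>2 \<zero>\<^bsub>P\<^esub> = \<zero>\<^bsub>N\<^esub>"
        by (rule algebra_iso_zero[OF P.complex_algebra_axioms N.complex_algebra_axioms \<psi>2])
      have "z = \<psi>\<^sub>2 x" unfolding y(2) \<psi>_def x_def by simp
      also have "\<dots> = finsum N (\<lambda>a. \<psi>\<^sub>2 (f a)) (carrier \<Gamma>\<^sub>0)"
        unfolding f(2) by (rule algebra_iso_finsum[OF P.complex_algebra_axioms N.complex_algebra_axioms \<psi>2 finG fc])
      also have "\<dots> \<in> V\<^sub>2 (\<phi> \<gamma>)"
      proof (rule grading_component_finsum[OF G2 \<phi>\<gamma> finG])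
        fix a assume a: "a \<in> carrier \<Gamma>\<^sub>0"
        show "\<psi>\<^sub>2 (f a) \<in> V\<^sub>2 (\<phi> \<gamma>)"
        proof (cases "\<phi>\<^sub>1 a = \<gamma>")
          case True
          then show ?thesis using V2[OF a f(1)[OF a]] \<phi>[OF a] by simp
        next
          case False
          then show ?thesis using f0[OF a] \<psi>0 is_gradingD(4)[OF G2 \<phi>\<gamma>] by simp
        qed
      qed
      finally show "z \<in> V\<^sub>2 (\<phi> \<gamma>)" .
    qed
  qed
  then show ?thesis using that \<phi> by blast
qed

section \<open>Graded equivalence as an equivalence relation, and classes\<close>

lemma graded_equivalent_refl: "graded_equivalent M \<G> M \<G>"
  unfolding graded_equivalent_def
  by (rule exI[of _ id], rule exI[of _ id], rule conjI[OF quotient_morphism_id])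
    (simp add: iso_def hom_def)

lemma graded_equivalent_trans:
  "\<lbrakk>graded_equivalent M \<G> N \<H>; graded_equivalent N \<H> P \<K>\<rbrakk> \<Longrightarrow> graded_equivalent M \<G> P \<K>"
  unfolding graded_equivalent_def using quotient_morphism_comp iso_set_trans by blast

text \<open>A quotient morphism only guarantees inclusions between components, so inverting both
  maps is not obviously a morphism. Factoring the identity through the given morphism supplies the
  reverse inclusions.\<close>

lemma graded_equivalent_sym:
  assumes G: "is_grading M (\<Gamma>\<^sub>1, V\<^sub>1)" and finG: "finite (carrier \<Gamma>\<^sub>1)" and H: "is_grading N (\<Gamma>\<^sub>2, V\<^sub>2)"
    and eq: "graded_equivalent M (\<Gamma>\<^sub>1, V\<^sub>1) N (\<Gamma>\<^sub>2, V\<^sub>2)"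
  shows "graded_equivalent N (\<Gamma>\<^sub>2, V\<^sub>2) M (\<Gamma>\<^sub>1, V\<^sub>1)"
proof -
  obtain \<psi> \<phi> where q: "quotient_morphism M (\<Gamma>\<^sub>1, V\<^sub>1) N (\<Gamma>\<^sub>2, V\<^sub>2) \<psi> \<phi>" and \<phi>: "\<phi> \<in> iso \<Gamma>\<^sub>1 \<Gamma>\<^sub>2"
    using eq unfolding graded_equivalent_def by auto
  have bij: "bij_betw \<phi> (carrier \<Gamma>\<^sub>1) (carrier \<Gamma>\<^sub>2)" using \<phi> by (simp add: iso_def)
  then obtain \<psi>' \<phi>' where q': "quotient_morphism N (\<Gamma>\<^sub>2, V\<^sub>2) M (\<Gamma>\<^sub>1, V\<^sub>1) \<psi>' \<phi>'"
      "\<And>a. a \<in> carrier \<Gamma>\<^sub>1 \<Longrightarrow> \<phi>' (\<phi> a) = id a"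
    using quotient_morphism_factor[OF G finG H G q quotient_morphism_id]
    unfolding bij_betw_def inj_on_def by (metis id_apply)
  have "bij_betw \<phi>' (carrier \<Gamma>\<^sub>2) (carrier \<Gamma>\<^sub>1)"
    using q'(2) bij_betw_cong[of "carrier \<Gamma>\<^sub>1" "\<phi>' \<circ> \<phi>" id "carrier \<Gamma>\<^sub>1"] bij_betw_comp_iff[OF bij, of \<phi>']
    by simp
  then have "\<phi>' \<in> iso \<Gamma>\<^sub>2 \<Gamma>\<^sub>1" using q'(1) unfolding quotient_morphism_def iso_def by simp
  then show ?thesis unfolding graded_equivalent_def using q'(1) by auto
qed

lemma grading_class_eq:
  assumes G: "is_grading M (\<Gamma>\<^sub>1, V\<^sub>1)" and finG: "finite (carrier \<Gamma>\<^sub>1)" and H: "is_grading N (\<Gamma>\<^sub>2, V\<^sub>2)"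
    and eq: "graded_equivalent M (\<Gamma>\<^sub>1, V\<^sub>1) N (\<Gamma>\<^sub>2, V\<^sub>2)"
  shows "grading_class P M (\<Gamma>\<^sub>1, V\<^sub>1) = grading_class P N (\<Gamma>\<^sub>2, V\<^sub>2)"
  using graded_equivalent_trans[OF eq] graded_equivalent_trans[OF graded_equivalent_sym[OF assms]]
  unfolding grading_class_def by blast

lemma grading_class_self:
  "\<G> \<in> connected_gradings M \<Longrightarrow> \<G> \<in> grading_class M M \<G>"
  unfolding grading_class_def using graded_equivalent_refl[of M \<G>] by simp

lemma grading_class_in_Grad:
  "\<G> \<in> connected_gradings M \<Longrightarrow> grading_class M M \<G> \<in> Grad M"
proof -
  assume G: "\<G> \<in> connected_gradings M"
  then have "grading_class M M \<G> = graded_equiv_rel M `` {\<G>}"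
    unfolding grading_class_def graded_equiv_rel_def by blast
  then show ?thesis unfolding Grad_def using G by (simp add: quotientI)
qed

text \<open>A common source for the matrix, twisted and transported gradings: the c i are
  coordinates with respect to a finite basis, d i is the degree of the i-th basis vector, and a
  component consists of the vectors supported on one degree. Only multiplicativity depends on the
  algebra.\<close>

lemma coordinate_grading:
  fixes M :: "(complex, 'v) module" and c :: "'i \<Rightarrow> 'v \<Rightarrow> complex" and d :: "'i \<Rightarrow> 'g"
  assumes alg: "complex_algebra M" and \<Gamma>: "group \<Gamma>" and I: "finite I" "d \<in> I \<rightarrow> carrier \<Gamma>"
    and add: "\<And>i x y. \<lbrakk>i \<in> I; x \<in> carrier M; y \<in> carrier M\<rbrakk> \<Longrightarrow> c i (x \<oplus>\<^bsub>M\<^esub> y) = c i x + c i y"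
    and smult: "\<And>i k x. \<lbrakk>i \<in> I; x \<in> carrier M\<rbrakk> \<Longrightarrow> c i (k \<odot>\<^bsub>M\<^esub> x) = k * c i x"
    and sep: "\<And>x y. \<lbrakk>x \<in> carrier M; y \<in> carrier M; \<And>i. i \<in> I \<Longrightarrow> c i x = c i y\<rbrakk> \<Longrightarrow> x = y"
    and ex: "\<And>v. \<exists>x\<in>carrier M. \<forall>i\<in>I. c i x = v i"
    and V: "\<And>\<gamma>. \<gamma> \<in> carrier \<Gamma> \<Longrightarrow> V \<gamma> = {x \<in> carrier M. \<forall>i\<in>I. c i x \<noteq> 0 \<longrightarrow> d i = \<gamma>}"
    and mult: "\<And>\<gamma> \<delta> x y. \<lbrakk>\<gamma> \<in> carrier \<Gamma>; \<delta> \<in> carrier \<Gamma>; x \<in> V \<gamma>; y \<in> V \<delta>\<rbrakk> \<Longrightarrow> x \<otimes>\<^bsub>M\<^esub> y \<in> V (\<gamma> \<otimes>\<^bsub>\<Gamma>\<^esub> \<delta>)"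
  shows "is_grading M (\<Gamma>, V)"
proof -
  interpret complex_algebra M by fact
  have c0: "c i \<zero>\<^bsub>M\<^esub> = 0" if "i \<in> I" for i using add[OF that, of "\<zero>\<^bsub>M\<^esub>" "\<zero>\<^bsub>M\<^esub>"] by simp
  have sub: "VectorSpace.subspace class_ring (V \<gamma>) M" if \<gamma>: "\<gamma> \<in> carrier \<Gamma>" for \<gamma>
    unfolding VectorSpace.subspace_def LinearCombinations.submodule_def V[OF \<gamma>]
    using vectorspace_axioms module_axioms
    by (auto simp: add smult c0 class_ring_simps)
  have sum: "c i (finsum M f {\<gamma>\<in>carrier \<Gamma>. f \<gamma> \<noteq> \<zero>\<^bsub>M\<^esub>}) = c i (f (d i))"
    if i: "i \<in> I" and f: "f \<in> (\<Pi>\<^sub>E \<gamma>\<in>carrier \<Gamma>. V \<gamma>)" "finite {\<gamma>\<in>carrier \<Gamma>. f \<gamma> \<noteq> \<zero>\<^bsub>M\<^esub>}" for i f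
  proof -
    have fV: "f \<gamma> \<in> carrier M \<and> (c i (f \<gamma>) \<noteq> 0 \<longrightarrow> d i = \<gamma>)" if "\<gamma> \<in> carrier \<Gamma>" for \<gamma>
      using f(1) V[OF that] that i by (auto simp: PiE_iff)
    have di: "d i \<in> carrier \<Gamma>" using I(2) i by auto
    have "c i (finsum M f {\<gamma>\<in>carrier \<Gamma>. f \<gamma> \<noteq> \<zero>\<^bsub>M\<^esub>}) = (\<Sum>\<gamma> | \<gamma> \<in> carrier \<Gamma> \<and> f \<gamma> \<noteq> \<zero>\<^bsub>M\<^esub>. c i (f \<gamma>))"
      using fV by (intro additive_finsum[OF add[OF i] f(2)]) auto
    also have "\<dots> = (\<Sum>\<gamma> | \<gamma> \<in> carrier \<Gamma> \<and> f \<gamma> \<noteq> \<zero>\<^bsub>M\<^esub>. if \<gamma> = d i then c i (f \<gamma>) else 0)"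
      using fV by (intro sum.cong) auto
    also have "\<dots> = c i (f (d i))" using f(2) di c0[OF i] by (auto simp: sum.delta)
    finally show ?thesis .
  qed
  have "\<exists>!f. f \<in> (\<Pi>\<^sub>E \<gamma>\<in>carrier \<Gamma>. V \<gamma>) \<and> finite {\<gamma>\<in>carrier \<Gamma>. f \<gamma> \<noteq> \<zero>\<^bsub>M\<^esub>} \<and>
        x = finsum M f {\<gamma>\<in>carrier \<Gamma>. f \<gamma> \<noteq> \<zero>\<^bsub>M\<^esub>}" (is "\<exists>!f. ?D f")
    if x: "x \<in> carrier M" for x
  proof -
    \<comment> \<open>The projection of x to degree \<gamma>: coordinates of other degrees are set
      to 0.\<close>
    have "\<exists>y\<in>carrier M. \<forall>i\<in>I. c i y = (if d i = \<gamma> then c i x else 0)" for \<gamma> by (rule ex)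
    then obtain p where p: "\<And>\<gamma>. p \<gamma> \<in> carrier M" "\<And>\<gamma> i. i \<in> I \<Longrightarrow> c i (p \<gamma>) = (if d i = \<gamma> then c i x else 0)"
      by metis
    have p0: "p \<gamma> = \<zero>\<^bsub>M\<^esub>" if "\<gamma> \<notin> d ` I" for \<gamma>
      using that p c0 by (intro sep) auto
    define f where "f = restrict p (carrier \<Gamma>)"
    have fPi: "f \<in> (\<Pi>\<^sub>E \<gamma>\<in>carrier \<Gamma>. V \<gamma>)" unfolding f_def using p V by (auto split: if_splits)
    have ffin: "finite {\<gamma>\<in>carrier \<Gamma>. f \<gamma> \<noteq> \<zero>\<^bsub>M\<^esub>}"
      by (rule finite_subset[of _ "d ` I"]) (use p0 I in \<open>auto simp: f_def\<close>)
    have fin_carrier: "finsum M g {\<gamma>\<in>carrier \<Gamma>. g \<gamma> \<noteq> \<zero>\<^bsub>M\<^esub>} \<in> carrier M"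
      if "g \<in> (\<Pi>\<^sub>E \<gamma>\<in>carrier \<Gamma>. V \<gamma>)" for g
      using that V by (intro finsum_closed) (auto simp: PiE_iff)
    have "x = finsum M f {\<gamma>\<in>carrier \<Gamma>. f \<gamma> \<noteq> \<zero>\<^bsub>M\<^esub>}"
    proof (rule sep[OF x fin_carrier[OF fPi]])
      fix i assume i: "i \<in> I"
      then have "d i \<in> carrier \<Gamma>" using I(2) by auto
      then show "c i x = c i (finsum M f {\<gamma>\<in>carrier \<Gamma>. f \<gamma> \<noteq> \<zero>\<^bsub>M\<^esub>})"
        unfolding sum[OF i fPi ffin] using p(2)[OF i] by (simp add: f_def)
    qed
    then have D: "?D f" using fPi ffin by blast
    have uniq: "g = f" if g: "?D g" for g
    proof (rule PiE_ext)
      show "g \<in> (\<Pi>\<^sub>E \<gamma>\<in>carrier \<Gamma>. V \<gamma>)" "f \<in> (\<Pi>\<^sub>E \<gamma>\<in>carrier \<Gamma>. V \<gamma>)" using g fPi by auto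
      fix \<gamma> assume \<gamma>: "\<gamma> \<in> carrier \<Gamma>"
      have gV: "g \<gamma> \<in> carrier M" "\<And>i. i \<in> I \<Longrightarrow> c i (g \<gamma>) \<noteq> 0 \<Longrightarrow> d i = \<gamma>"
        using g \<gamma> V[OF \<gamma>] by (auto simp: PiE_iff)
      show "g \<gamma> = f \<gamma>"
      proof (rule sep[OF gV(1)])
        show "f \<gamma> \<in> carrier M" using p(1) \<gamma> unfolding f_def by simp
        fix i assume i: "i \<in> I"
        have "c i x = c i (g (d i))" using sum[OF i, of g] g by metis
        then show "c i (g \<gamma>) = c i (f \<gamma>)" using gV(2)[OF i] p(2)[OF i] \<gamma> unfolding f_def by auto
      qed
    qed
    show ?thesis by (rule ex1I[of ?D, OF D uniq])
  qed
  then show ?thesis unfolding is_grading_def using alg \<Gamma> sub mult by simp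
qed

section \<open>Elementary gradings\<close>

lemma complex_algebra_matrix: "complex_algebra (matrix_algebra n)"
proof -
  interpret vectorspace class_ring "matrix_algebra n" by (rule matrix_vs)
  have "ring (matrix_algebra n)"
    by (unfold_locales, insert add_inv_exists_mat,
        auto simp: module_mat_def algebra_simps Units_def)
  then show ?thesis
    by (intro complex_algebra.intro matrix_vs complex_algebra_axioms.intro)
      (auto simp: module_mat_simps)
qed

lemma index_mult_square_mat:
  assumes "A \<in> carrier_mat n n" "B \<in> carrier_mat n n" "i < n" "j < n"
  shows "(A * B) $$ (i, j) = (\<Sum>k<n. A $$ (i, k) * B $$ (k, j))"
  using assms by (simp add: scalar_prod_def atLeast0LessThan)

lemma fst_gradings:
  "fst (twisted_grading G) = G" "fst (elementary_grading m \<Gamma> s) = \<Gamma>"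
  by (simp_all add: twisted_grading_def elementary_grading_def)

lemma grading_pair: "elementary_grading n \<Gamma> s = (\<Gamma>, snd (elementary_grading n \<Gamma> s))"
  "twisted_grading G = (G, snd (twisted_grading G))"
  by (simp_all add: elementary_grading_def twisted_grading_def)

lemma elementary_is_grading:
  assumes \<Gamma>: "group \<Gamma>" and s: "s \<in> {..<n} \<rightarrow> carrier \<Gamma>"
  shows "is_grading (matrix_algebra n) (elementary_grading n \<Gamma> s)"
  unfolding elementary_grading_def
proof (rule coordinate_grading[where I = "{..<n} \<times> {..<n}" and c = "\<lambda>(i, j) B. B $$ (i, j)"
      and d = "\<lambda>(i, j). s i \<otimes>\<^bsub>\<Gamma>\<^esub> inv\<^bsub>\<Gamma>\<^esub> (s j)"])
  interpret group \<Gamma> by fact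
  have sc: "s i \<in> carrier \<Gamma>" if "i < n" for i using s that by auto
  show "(\<lambda>(i, j). s i \<otimes>\<^bsub>\<Gamma>\<^esub> inv\<^bsub>\<Gamma>\<^esub> (s j)) \<in> {..<n} \<times> {..<n} \<rightarrow> carrier \<Gamma>"
    using sc by auto
  fix v :: "nat \<times> nat \<Rightarrow> complex"
  show "\<exists>x\<in>carrier (matrix_algebra n). \<forall>i\<in>{..<n} \<times> {..<n}. (\<lambda>(i, j) B. B $$ (i, j)) i x = v i"
    by (rule bexI[of _ "mat n n v"]) (auto simp: module_mat_simps)
next
  interpret group \<Gamma> by fact
  have sc: "s i \<in> carrier \<Gamma>" if "i < n" for i using s that by auto
  fix \<gamma> \<delta> and x y :: "complex mat"
  assume x: "x \<in> {B \<in> carrier_mat n n. \<forall>i<n. \<forall>j<n. B $$ (i, j) \<noteq> 0 \<longrightarrow> s i \<otimes>\<^bsub>\<Gamma>\<^esub> inv\<^bsub>\<Gamma>\<^esub> (s j) = \<gamma>}"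
    and y: "y \<in> {B \<in> carrier_mat n n. \<forall>i<n. \<forall>j<n. B $$ (i, j) \<noteq> 0 \<longrightarrow> s i \<otimes>\<^bsub>\<Gamma>\<^esub> inv\<^bsub>\<Gamma>\<^esub> (s j) = \<delta>}"
  have "s i \<otimes>\<^bsub>\<Gamma>\<^esub> inv\<^bsub>\<Gamma>\<^esub> (s j) = \<gamma> \<otimes>\<^bsub>\<Gamma>\<^esub> \<delta>" if ij: "i < n" "j < n" and nz: "(x * y) $$ (i, j) \<noteq> 0" for i j
  proof -
    have "(x * y) $$ (i, j) = (\<Sum>k<n. x $$ (i, k) * y $$ (k, j))"
      using x y ij by (intro index_mult_square_mat) auto
    then have "(\<Sum>k<n. x $$ (i, k) * y $$ (k, j)) \<noteq> 0" using nz by simp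
    then obtain k where "k \<in> {..<n}" and k2: "x $$ (i, k) * y $$ (k, j) \<noteq> 0"
      by (rule sum.not_neutral_contains_not_neutral)
    then have k: "k < n" by simp
    have eq: "s i \<otimes>\<^bsub>\<Gamma>\<^esub> inv\<^bsub>\<Gamma>\<^esub> (s k) = \<gamma>" "s k \<otimes>\<^bsub>\<Gamma>\<^esub> inv\<^bsub>\<Gamma>\<^esub> (s j) = \<delta>"
      using x y ij k k2 by auto
    have "\<gamma> \<otimes>\<^bsub>\<Gamma>\<^esub> \<delta> = s i \<otimes>\<^bsub>\<Gamma>\<^esub> (inv\<^bsub>\<Gamma>\<^esub> (s k) \<otimes>\<^bsub>\<Gamma>\<^esub> s k) \<otimes>\<^bsub>\<Gamma>\<^esub> inv\<^bsub>\<Gamma>\<^esub> (s j)"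
      unfolding eq[symmetric] using sc[OF ij(1)] sc[OF ij(2)] sc[OF k(1)]
      by (simp only: m_assoc m_closed inv_closed)
    then show ?thesis using sc[OF ij(1)] sc[OF ij(2)] sc[OF k(1)] by simp
  qed
  then show "x \<otimes>\<^bsub>matrix_algebra n\<^esub> y \<in> {B \<in> carrier_mat n n. \<forall>i<n. \<forall>j<n. B $$ (i, j) \<noteq> 0 \<longrightarrow>
      s i \<otimes>\<^bsub>\<Gamma>\<^esub> inv\<^bsub>\<Gamma>\<^esub> (s j) = \<gamma> \<otimes>\<^bsub>\<Gamma>\<^esub> \<delta>}"
    using x y by (auto simp: module_mat_simps)
qed (use complex_algebra_matrix \<Gamma> in \<open>auto simp: module_mat_simps\<close>)

text \<open>The group isomorphism turns the enumeration s into one of \<Delta>, which differs from t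
  by a permutation of the indices. Conjugation by the permutation matrix is the required algebra
  isomorphism, so the class depends neither on the enumeration nor on more than the isomorphism type
  of the group.\<close>

lemma elementary_equivalent:
  assumes \<Gamma>: "group \<Gamma>" and \<Delta>: "group \<Delta>" and \<theta>: "\<theta> \<in> iso \<Gamma> \<Delta>"
    and s: "bij_betw s {..<n} (carrier \<Gamma>)" and t: "bij_betw t {..<n} (carrier \<Delta>)"
  shows "graded_equivalent (matrix_algebra n) (elementary_grading n \<Gamma> s)
    (matrix_algebra n) (elementary_grading n \<Delta> t)"
proof -
  have \<theta>bij: "bij_betw \<theta> (carrier \<Gamma>) (carrier \<Delta>)" and \<theta>hom: "\<theta> \<in> hom \<Gamma> \<Delta>"
    using \<theta> by (auto simp: iso_def)
  interpret \<theta>: group_hom \<Gamma> \<Delta> \<theta>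
    using \<Gamma> \<Delta> \<theta>hom by (simp add: group_hom_def group_hom_axioms_def)
  have st: "bij_betw (\<theta> \<circ> s) {..<n} (carrier \<Delta>)" using s \<theta>bij by (rule bij_betw_trans)
  \<comment> \<open>Matches the two enumerations: \<theta>(s(\<tau> i)) = t i.\<close>
  define \<tau> where "\<tau> = inv_into {..<n} (\<theta> \<circ> s) \<circ> t"
  have \<tau>: "bij_betw \<tau> {..<n} {..<n}"
    unfolding \<tau>_def by (rule bij_betw_trans[OF t bij_betw_inv_into[OF st]])
  have \<tau>n: "\<tau> i < n" if "i < n" for i using \<tau> that by (auto dest: bij_betwE)
  have \<tau>inj: "\<tau> i = \<tau> j \<longleftrightarrow> i = j" if "i < n" "j < n" for i j
    using \<tau> that by (auto simp: bij_betw_def inj_on_def)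
  have \<theta>s: "\<theta> (s (\<tau> i)) = t i" if "i < n" for i
    using bij_betw_inv_into_right[OF st, of "t i"] bij_betwE[OF t] that by (simp add: \<tau>_def)
  have sc: "s i \<in> carrier \<Gamma>" if "i < n" for i using bij_betwE[OF s] that by auto
  define \<psi> where "\<psi> B = mat n n (\<lambda>(i, j). B $$ (\<tau> i, \<tau> j))" for B :: "complex mat"
  have \<psi>i: "\<psi> B $$ (i, j) = B $$ (\<tau> i, \<tau> j)" if "i < n" "j < n" for B i j
    using that by (simp add: \<psi>_def)
  have \<psi>c: "\<psi> B \<in> carrier_mat n n" for B by (simp add: \<psi>_def)
  have \<psi>bij: "bij_betw \<psi> (carrier_mat n n) (carrier_mat n n)"
  proof (rule bij_betw_byWitness[where f' = "\<lambda>B. mat n n (\<lambda>(i, j). B $$ (inv_into {..<n} \<tau> i, inv_into {..<n} \<tau> j))"])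
    have inv: "inv_into {..<n} \<tau> i < n" if "i < n" for i
      using bij_betwE[OF bij_betw_inv_into[OF \<tau>]] that by auto
    show "\<forall>B\<in>carrier_mat n n. mat n n (\<lambda>(i, j). \<psi> B $$ (inv_into {..<n} \<tau> i, inv_into {..<n} \<tau> j)) = B"
      using inv \<tau> by (auto intro!: eq_matI simp: \<psi>i bij_betw_inv_into_right)
    show "\<forall>B\<in>carrier_mat n n. \<psi> (mat n n (\<lambda>(i, j). B $$ (inv_into {..<n} \<tau> i, inv_into {..<n} \<tau> j))) = B"
      using \<tau>n \<tau> by (auto intro!: eq_matI simp: \<psi>_def bij_betw_inv_into_left)
  qed (auto simp: \<psi>_def)
  have "\<psi> \<in> algebra_iso (matrix_algebra n) (matrix_algebra n)"
    unfolding algebra_iso_def ring_iso_def Ring.ring_hom_def module_mat_simps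
  proof (safe intro!: \<psi>bij \<psi>c)
    fix B C :: "complex mat" assume B: "B \<in> carrier_mat n n" and C: "C \<in> carrier_mat n n"
    show "\<psi> (B * C) = \<psi> B * \<psi> C"
    proof (rule eq_matI)
      fix i j assume "i < dim_row (\<psi> B * \<psi> C)" "j < dim_col (\<psi> B * \<psi> C)"
      then have ij: "i < n" "j < n" by (auto simp: \<psi>_def)
      have "(\<psi> B * \<psi> C) $$ (i, j) = (\<Sum>k<n. B $$ (\<tau> i, \<tau> k) * C $$ (\<tau> k, \<tau> j))"
        using ij \<psi>c[of B] \<psi>c[of C] by (simp only: index_mult_square_mat) (simp add: \<psi>i)
      also have "\<dots> = (\<Sum>k<n. B $$ (\<tau> i, k) * C $$ (k, \<tau> j))"
        by (rule sum.reindex_bij_betw[OF \<tau>])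
      also have "\<dots> = \<psi> (B * C) $$ (i, j)"
        using ij \<tau>n B C by (simp only: \<psi>i index_mult_square_mat)
      finally show "\<psi> (B * C) $$ (i, j) = (\<psi> B * \<psi> C) $$ (i, j)" by simp
    qed (auto simp: \<psi>_def)
    show "\<psi> (B + C) = \<psi> B + \<psi> C"
      using B C \<tau>n by (intro eq_matI) (auto simp: \<psi>_def)
  next
    show "\<psi> (1\<^sub>m n) = 1\<^sub>m n" using \<tau>n \<tau>inj by (intro eq_matI) (auto simp: \<psi>_def)
  next
    fix c and B :: "complex mat" assume "B \<in> carrier_mat n n"
    then show "\<psi> (c \<cdot>\<^sub>m B) = c \<cdot>\<^sub>m \<psi> B" using \<tau>n by (intro eq_matI) (auto simp: \<psi>_def)
  qed
  moreover have "\<psi> ` snd (elementary_grading n \<Gamma> s) \<gamma> \<subseteq> snd (elementary_grading n \<Delta> t) (\<theta> \<gamma>)"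
    if "\<gamma> \<in> carrier \<Gamma>" for \<gamma>
  proof -
    have "t i \<otimes>\<^bsub>\<Delta>\<^esub> inv\<^bsub>\<Delta>\<^esub> (t j) = \<theta> (s (\<tau> i) \<otimes>\<^bsub>\<Gamma>\<^esub> inv\<^bsub>\<Gamma>\<^esub> (s (\<tau> j)))" if "i < n" "j < n" for i j
      using that \<tau>n sc \<theta>s by simp
    then show ?thesis using \<tau>n \<psi>c by (auto simp: elementary_grading_def \<psi>i)
  qed
  ultimately have "quotient_morphism (matrix_algebra n) (elementary_grading n \<Gamma> s)
      (matrix_algebra n) (elementary_grading n \<Delta> t) \<psi> \<theta>"
    using \<theta>hom \<theta>bij unfolding quotient_morphism_def
    by (simp add: elementary_grading_def bij_betw_def)
  then show ?thesis
    unfolding graded_equivalent_def using \<theta> by (auto simp: elementary_grading_def)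
qed

text \<open>Transport of structure along an injection into the natural numbers, since
  \<open>Grad\<close> admits only grading groups of that type.\<close>

lemma finite_group_iso_nat:
  assumes "group G" "finite (carrier G)"
  obtains \<Gamma> :: "nat monoid" and \<theta> where "group \<Gamma>" "\<theta> \<in> iso G \<Gamma>"
proof -
  interpret group G by fact
  obtain b :: "'a \<Rightarrow> nat" where b: "inj_on b (carrier G)"
    using finite_imp_inj_to_nat_seg[OF assms(2)] by blast
  define b' where "b' = inv_into (carrier G) b"
  have b'b: "b' (b x) = x" if "x \<in> carrier G" for x
    using b that by (simp add: b'_def)
  define \<Gamma> where "\<Gamma> = \<lparr>carrier = b ` carrier G, monoid.mult = (\<lambda>x y. b (b' x \<otimes>\<^bsub>G\<^esub> b' y)), one = b \<one>\<^bsub>G\<^esub>\<rparr>"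
  have "group \<Gamma>"
  proof (rule groupI)
    fix x assume "x \<in> carrier \<Gamma>"
    then obtain a where "a \<in> carrier G" "x = b a" by (auto simp: \<Gamma>_def)
    then show "\<exists>y\<in>carrier \<Gamma>. y \<otimes>\<^bsub>\<Gamma>\<^esub> x = \<one>\<^bsub>\<Gamma>\<^esub>"
      by (intro bexI[of _ "b (inv\<^bsub>G\<^esub> a)"]) (auto simp: \<Gamma>_def b'b)
  qed (auto simp: \<Gamma>_def b'b m_assoc)
  moreover have "b \<in> iso G \<Gamma>"
    using b by (auto simp: iso_def hom_def bij_betw_def \<Gamma>_def b'b)
  ultimately show ?thesis using that by blast
qed

section \<open>Non-degenerate twisted group algebras\<close>

locale nondegenerate_twist = comm_group A for A :: "'a monoid" (structure) +
  fixes \<alpha> :: "'a \<Rightarrow> 'a \<Rightarrow> complex" and n :: nat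
  assumes finite_A: "finite (carrier A)" and order_A: "Coset.order A = n\<^sup>2"
    and nondegenerate: "nondegenerate A \<alpha>"
begin

abbreviation "B \<equiv> twisted_group_algebra A \<alpha>"

lemma complex_algebra_B: "complex_algebra B"
  using nondegenerate by (simp add: nondegenerate_def simple_algebra_def)

lemma is_two_cocycle: "two_cocycle A \<alpha>"
  using nondegenerate by (simp add: nondegenerate_def)

lemma cocycle_nonzero: "\<lbrakk>g \<in> carrier A; h \<in> carrier A\<rbrakk> \<Longrightarrow> \<alpha> g h \<noteq> 0"
  using is_two_cocycle by (simp add: two_cocycle_def)

lemma cocycle: "\<lbrakk>g \<in> carrier A; h \<in> carrier A; k \<in> carrier A\<rbrakk> \<Longrightarrow>
    \<alpha> g h * \<alpha> (g \<otimes> h) k = \<alpha> h k * \<alpha> g (h \<otimes> k)"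
  using is_two_cocycle by (simp add: two_cocycle_def)

lemma B_carrier: "f \<in> carrier B \<longleftrightarrow> (\<forall>g. g \<notin> carrier A \<longrightarrow> f g = 0)"
  by (simp add: twisted_group_algebra_def)

lemma B_simps:
  "\<zero>\<^bsub>B\<^esub> = (\<lambda>k. 0)" "f \<oplus>\<^bsub>B\<^esub> f' = (\<lambda>k. f k + f' k)" "c \<odot>\<^bsub>B\<^esub> f = (\<lambda>k. c * f k)"
  "\<one>\<^bsub>B\<^esub> = (\<lambda>k. inverse (\<alpha> \<one> \<one>) * basis_elem \<one> k)"
  by (simp_all add: twisted_group_algebra_def)

lemma B_mult:
  assumes k: "k \<in> carrier A"
  shows "(f \<otimes>\<^bsub>B\<^esub> f') k = (\<Sum>g\<in>carrier A. \<alpha> g (inv g \<otimes> k) * (f g * f' (inv g \<otimes> k)))"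
proof -
  have "(f \<otimes>\<^bsub>B\<^esub> f') k =
      (\<Sum>(g, h) \<in> {(g, h) \<in> carrier A \<times> carrier A. g \<otimes> h = k}. \<alpha> g h * (f g * f' h))"
    by (simp add: twisted_group_algebra_def)
  also have "\<dots> = (\<Sum>g\<in>carrier A. \<alpha> g (inv g \<otimes> k) * (f g * f' (inv g \<otimes> k)))"
    by (rule sum.reindex_bij_witness[of _ "\<lambda>g. (g, inv g \<otimes> k)" fst])
      (use k in \<open>auto simp: m_assoc[symmetric]\<close>)
  finally show ?thesis .
qed

lemma B_mult_outside: "k \<notin> carrier A \<Longrightarrow> (f \<otimes>\<^bsub>B\<^esub> f') k = 0"
  by (auto simp: twisted_group_algebra_def intro!: sum.neutral)

lemma basis_elem_B: "g \<in> carrier A \<Longrightarrow> basis_elem g \<in> carrier B"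
  by (auto simp: B_carrier basis_elem_def)

lemma basis_mult_left:
  assumes "r \<in> carrier A" "k \<in> carrier A"
  shows "(basis_elem r \<otimes>\<^bsub>B\<^esub> f) k = \<alpha> r (inv r \<otimes> k) * f (inv r \<otimes> k)"
proof -
  have "(basis_elem r \<otimes>\<^bsub>B\<^esub> f) k =
      (\<Sum>g\<in>carrier A. if g = r then \<alpha> r (inv r \<otimes> k) * f (inv r \<otimes> k) else 0)"
    unfolding B_mult[OF assms(2)] by (intro sum.cong) (auto simp: basis_elem_def)
  then show ?thesis using assms finite_A by simp
qed

lemma basis_mult_right:
  assumes "r \<in> carrier A" "k \<in> carrier A"
  shows "(f \<otimes>\<^bsub>B\<^esub> basis_elem r) k = \<alpha> (inv r \<otimes> k) r * f (inv r \<otimes> k)"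
proof -
  have eq: "inv g \<otimes> k = r \<longleftrightarrow> g = inv r \<otimes> k" if g: "g \<in> carrier A" for g
    using assms g by (metis inv_closed inv_solve_left' m_comm m_closed)
  have eq2: "inv (inv r \<otimes> k) \<otimes> k = r" using iffD2[OF eq refl] assms by simp
  have "(f \<otimes>\<^bsub>B\<^esub> basis_elem r) k =
      (\<Sum>g\<in>carrier A. if g = inv r \<otimes> k then \<alpha> g r * f g else 0)"
    unfolding B_mult[OF assms(2)] using eq by (intro sum.cong) (auto simp: basis_elem_def eq2)
  then show ?thesis using assms finite_A by simp
qed

lemma twisted_is_grading: "is_grading B (twisted_grading A)"
  unfolding twisted_grading_def
proof (rule coordinate_grading[where I = "carrier A" and c = "\<lambda>g f. f g" and d = "\<lambda>g. g"])
  show "complex_algebra B" by (rule complex_algebra_B)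
  show "group A" by (rule is_group)
  show "finite (carrier A)" by (rule finite_A)
  fix v :: "'a \<Rightarrow> complex"
  show "\<exists>x\<in>carrier B. \<forall>i\<in>carrier A. x i = v i"
    by (rule bexI[of _ "\<lambda>g. if g \<in> carrier A then v g else 0"]) (auto simp: B_carrier)
next
  fix \<gamma> assume "\<gamma> \<in> carrier A"
  show "{\<lambda>k. c * basis_elem \<gamma> k |c. True} = {x \<in> carrier B. \<forall>i\<in>carrier A. x i \<noteq> 0 \<longrightarrow> i = \<gamma>}"
  proof (intro equalityI subsetI)
    fix x assume "x \<in> {\<lambda>k. c * basis_elem \<gamma> k |c. True}"
    then show "x \<in> {x \<in> carrier B. \<forall>i\<in>carrier A. x i \<noteq> 0 \<longrightarrow> i = \<gamma>}"
      using \<open>\<gamma> \<in> carrier A\<close> by (auto simp: B_carrier basis_elem_def split: if_splits)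
  next
    fix x assume x: "x \<in> {x \<in> carrier B. \<forall>i\<in>carrier A. x i \<noteq> 0 \<longrightarrow> i = \<gamma>}"
    then have x0: "x k = 0" if "k \<noteq> \<gamma>" for k using that unfolding mem_Collect_eq B_carrier by blast
    have "x = (\<lambda>k. x \<gamma> * basis_elem \<gamma> k)"
    proof
      fix k show "x k = x \<gamma> * basis_elem \<gamma> k"
        using x0[of k] by (simp add: basis_elem_def)
    qed
    then show "x \<in> {\<lambda>k. c * basis_elem \<gamma> k |c. True}" by blast
  qed
next
  fix \<gamma> \<delta> x y assume \<gamma>: "\<gamma> \<in> carrier A" and \<delta>: "\<delta> \<in> carrier A"
    and "x \<in> {\<lambda>k. c * basis_elem \<gamma> k |c. True}" "y \<in> {\<lambda>k. c * basis_elem \<delta> k |c. True}"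
  then obtain c d where xy: "x = (\<lambda>k. c * basis_elem \<gamma> k)" "y = (\<lambda>k. d * basis_elem \<delta> k)" by auto
  have "x \<otimes>\<^bsub>B\<^esub> y = (\<lambda>k. (c * d * \<alpha> \<gamma> \<delta>) * basis_elem (\<gamma> \<otimes> \<delta>) k)"
  proof
    fix k
    show "(x \<otimes>\<^bsub>B\<^esub> y) k = (c * d * \<alpha> \<gamma> \<delta>) * basis_elem (\<gamma> \<otimes> \<delta>) k"
    proof (cases "k \<in> carrier A")
      case True
      have eq: "inv \<gamma> \<otimes> k = \<delta> \<longleftrightarrow> k = \<gamma> \<otimes> \<delta>"
        using \<gamma> \<delta> True by (metis inv_solve_left')
      have "(x \<otimes>\<^bsub>B\<^esub> y) k = (\<Sum>g\<in>carrier A. if g = \<gamma> then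
          \<alpha> \<gamma> (inv \<gamma> \<otimes> k) * (c * (d * basis_elem \<delta> (inv \<gamma> \<otimes> k))) else 0)"
        unfolding B_mult[OF True] xy by (intro sum.cong) (auto simp: basis_elem_def)
      then show ?thesis using \<gamma> finite_A eq by (auto simp: basis_elem_def)
    next
      case False
      then have "k \<noteq> \<gamma> \<otimes> \<delta>" using \<gamma> \<delta> by auto
      then show ?thesis using B_mult_outside[OF False] by (simp add: basis_elem_def)
    qed
  qed
  then show "x \<otimes>\<^bsub>B\<^esub> y \<in> {\<lambda>k. c * basis_elem (\<gamma> \<otimes> \<delta>) k |c. True}" by blast
qed (auto simp: B_simps B_carrier fun_eq_iff, metis)

section \<open>The commutator form of a non-degenerate cocycle\<close>

definition \<omega> :: "'a \<Rightarrow> 'a \<Rightarrow> complex" where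
  "\<omega> g h = \<alpha> g h / \<alpha> h g"

text \<open>As A is abelian, u_g u_h = \<omega>(g,h) u_h u_g, and moving u_k past u_g u_h collects
  both factors. In terms of the cocycle this is the combination of its equations for (g,h,k),
  (k,g,h) and (g,k,h).\<close>

lemma commutator_mult_left:
  assumes "g \<in> carrier A" "h \<in> carrier A" "k \<in> carrier A"
  shows "\<omega> (g \<otimes> h) k = \<omega> g k * \<omega> h k"
proof -
  have "\<alpha> g h * \<alpha> (g \<otimes> h) k = \<alpha> h k * \<alpha> g (h \<otimes> k)"
    "\<alpha> k g * \<alpha> (g \<otimes> k) h = \<alpha> g h * \<alpha> k (g \<otimes> h)"
    "\<alpha> g k * \<alpha> (g \<otimes> k) h = \<alpha> k h * \<alpha> g (h \<otimes> k)"
    using cocycle[OF assms] cocycle[of k g h] cocycle[of g k h] assms by (simp_all add: m_comm)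
  moreover have "\<alpha> g h \<noteq> 0" "\<alpha> (g \<otimes> h) k \<noteq> 0" "\<alpha> h k \<noteq> 0" "\<alpha> g (h \<otimes> k) \<noteq> 0" "\<alpha> k g \<noteq> 0"
    "\<alpha> (g \<otimes> k) h \<noteq> 0" "\<alpha> k (g \<otimes> h) \<noteq> 0" "\<alpha> g k \<noteq> 0" "\<alpha> k h \<noteq> 0"
    using cocycle_nonzero assms by auto
  \<comment> \<open>The elimination of the auxiliary values e, y and z from the three equations,
    stated for arbitrary complex numbers.\<close>
  moreover have "x1 / x2 = (g1 / g2) * (h1 / h2)"
    if "e * x1 = h1 * y" "g2 * z = e * x2" "g1 * z = h2 * y" "e \<noteq> 0" "x2 \<noteq> 0" "g2 \<noteq> 0" "h2 \<noteq> 0" "z \<noteq> 0"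
    for e x1 x2 g1 g2 h1 h2 y z :: complex
  proof -
    have "x1 * (g2 * h2) * (e * z) = (e * x1) * (g2 * z) * h2" by (simp add: algebra_simps)
    also have "\<dots> = h1 * (h2 * y) * (g2 * z)" unfolding that(1) by (simp add: algebra_simps)
    also have "\<dots> = g1 * h1 * x2 * (e * z)" unfolding that(2) that(3)[symmetric] by (simp add: algebra_simps)
    finally have "x1 * (g2 * h2) = g1 * h1 * x2" using that by simp
    then show ?thesis using that by (simp add: field_simps)
  qed
  ultimately show ?thesis unfolding \<omega>_def by blast
qed

lemma commutator_swap: "\<omega> k g = inverse (\<omega> g k)"
  unfolding \<omega>_def by simp

text \<open>If the radical contains \<open>g \<noteq> \<one>\<close>, then \<open>u\<^sub>g\<close> is central but not scalar and its eigenspaces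
  (under multiplication) are ideals; a splitting of the cocycle on the radical yields an eigenvector.\<close>

lemma commutator_nondegenerate:
  assumes g: "g \<in> carrier A" and rad: "\<And>h. h \<in> carrier A \<Longrightarrow> \<omega> g h = 1"
  shows "g = \<one>"
proof (rule ccontr)
  assume g1: "g \<noteq> \<one>"
  interpret B: complex_algebra B by (rule complex_algebra_B)
  define R where "R = {r \<in> carrier A. \<forall>h\<in>carrier A. \<omega> r h = 1}"
  have one: "\<omega> \<one> h = 1" if "h \<in> carrier A" for h
  proof -
    have "\<omega> \<one> h = \<omega> \<one> h * \<omega> \<one> h" using commutator_mult_left[of \<one> \<one> h] that by simp
    moreover have "\<omega> \<one> h \<noteq> 0" unfolding \<omega>_def using cocycle_nonzero that by simp
    ultimately show ?thesis by simp
  qed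
  have R: "subgroup R A"
  proof (rule subgroupI)
    show "R \<subseteq> carrier A" "R \<noteq> {}" using one unfolding R_def by auto
    fix a assume a: "a \<in> R"
    have "\<omega> (inv a) h = 1" if "h \<in> carrier A" for h
      using commutator_mult_left[of "inv a" a h] a one[OF that] that unfolding R_def by simp
    then show "inv a \<in> R" using a unfolding R_def by simp
    fix b assume "b \<in> R"
    then show "a \<otimes> b \<in> R" using a commutator_mult_left unfolding R_def by simp
  qed
  have RA: "r \<in> carrier A" if "r \<in> R" for r using that unfolding R_def by simp
  have sym: "\<alpha> r h = \<alpha> h r" if "r \<in> R" "h \<in> carrier A" for r h
  proof -
    have "\<alpha> r h / \<alpha> h r = 1" using that unfolding R_def \<omega>_def by auto
    then show ?thesis by simp
  qed
  have gR: "g \<in> R" using g rad unfolding R_def by simp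
  have "comm_group (A\<lparr>carrier := R\<rparr>)" by (rule subgroup_is_comm_group[OF R])
  moreover have "finite (carrier (A\<lparr>carrier := R\<rparr>))" using finite_A RA by (auto intro: finite_subset)
  moreover have "two_cocycle (A\<lparr>carrier := R\<rparr>) \<alpha>" using is_two_cocycle RA unfolding two_cocycle_def by simp
  ultimately obtain \<mu> where \<mu>: "\<And>r. r \<in> R \<Longrightarrow> \<mu> r \<noteq> (0::complex)"
      "\<And>r s. r \<in> R \<Longrightarrow> s \<in> R \<Longrightarrow> \<mu> r * \<mu> s = \<alpha> r s * \<mu> (r \<otimes> s)"
    using symmetric_cocycle_splits[of "A\<lparr>carrier := R\<rparr>" \<alpha>] sym RA by auto
  \<comment> \<open>Evaluated at gk, the condition says u_g f = \<mu>(g) f: this is an eigenspace of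
    left multiplication by u_g.\<close>
  define I where "I = {f \<in> carrier B. \<forall>k\<in>carrier A. \<alpha> g k * f k = \<mu> g * f (g \<otimes> k)}"
  have I: "ideal I B"
  proof (rule idealI[OF B.ring_axioms])
    show "subgroup I (add_monoid B)"
    proof (rule B.add.subgroupI)
      have "(\<lambda>_. 0) \<in> I" unfolding I_def by (simp add: B_carrier)
      then show "I \<subseteq> carrier B" "I \<noteq> {}" unfolding I_def by auto
      fix a assume a: "a \<in> I"
      then have aB: "a \<in> carrier B" unfolding I_def by simp
      have "(\<lambda>k. - a k) \<oplus>\<^bsub>B\<^esub> a = \<zero>\<^bsub>B\<^esub>" by (simp add: B_simps)
      then have "\<ominus>\<^bsub>B\<^esub> a = (\<lambda>k. - a k)"
        using aB by (intro B.minus_equality) (auto simp: B_carrier)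
      then show "\<ominus>\<^bsub>B\<^esub> a \<in> I" using a unfolding I_def by (simp add: B_carrier)
      fix b assume b: "b \<in> I"
      show "a \<oplus>\<^bsub>B\<^esub> b \<in> I" using a b unfolding I_def by (simp add: B_carrier B_simps algebra_simps)
    qed
    fix f x assume f: "f \<in> I" and x: "x \<in> carrier B"
    have fB: "f \<in> carrier B" and fg: "\<And>k. k \<in> carrier A \<Longrightarrow> \<alpha> g k * f k = \<mu> g * f (g \<otimes> k)"
      using f unfolding I_def by auto
    show "x \<otimes>\<^bsub>B\<^esub> f \<in> I"
      unfolding I_def
    proof (intro CollectI conjI ballI)
      show "x \<otimes>\<^bsub>B\<^esub> f \<in> carrier B" using x fB by simp
      fix k assume k: "k \<in> carrier A"
      \<comment> \<open>Closure under left factors holds term by term, because u_g commutes with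
        each u_a; \<open>sym\<close> enters here.\<close>
      have "\<alpha> g k * (\<alpha> a (inv a \<otimes> k) * (x a * f (inv a \<otimes> k))) =
          \<mu> g * (\<alpha> a (inv a \<otimes> (g \<otimes> k)) * (x a * f (inv a \<otimes> (g \<otimes> k))))" if a: "a \<in> carrier A" for a
      proof -
        define m where "m = inv a \<otimes> k"
        have m: "m \<in> carrier A" "k = a \<otimes> m" using a k unfolding m_def by (simp_all add: m_assoc[symmetric])
        have gm: "inv a \<otimes> (g \<otimes> k) = g \<otimes> m" unfolding m_def using a g k by (simp add: m_lcomm)
        have "\<alpha> g k * \<alpha> a m = \<alpha> g a * \<alpha> (g \<otimes> a) m" using cocycle[OF g a m(1)] m(2) by (simp add: mult.commute)
        also have "\<dots> = \<alpha> a g * \<alpha> (a \<otimes> g) m" using sym[OF gR a] a g by (simp add: m_comm)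
        also have "\<dots> = \<alpha> g m * \<alpha> a (g \<otimes> m)" by (rule cocycle[OF a g m(1)])
        finally have "\<alpha> g k * \<alpha> a m * (x a * f m) = \<alpha> a (g \<otimes> m) * x a * (\<alpha> g m * f m)"
          by (simp add: algebra_simps)
        then show ?thesis unfolding gm m_def[symmetric] fg[OF m(1)] by (simp add: algebra_simps)
      qed
      note terms = this
      show "\<alpha> g k * (x \<otimes>\<^bsub>B\<^esub> f) k = \<mu> g * (x \<otimes>\<^bsub>B\<^esub> f) (g \<otimes> k)"
        unfolding B_mult[OF k] B_mult[OF m_closed[OF g k]] sum_distrib_left
        by (intro sum.cong refl terms)
    qed
    show "f \<otimes>\<^bsub>B\<^esub> x \<in> I"
      unfolding I_def
    proof (intro CollectI conjI ballI)
      show "f \<otimes>\<^bsub>B\<^esub> x \<in> carrier B" using x fB by simp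
      fix k assume k: "k \<in> carrier A"
      have "\<alpha> g k * (f \<otimes>\<^bsub>B\<^esub> x) k =
          (\<Sum>a\<in>carrier A. \<alpha> g k * (\<alpha> a (inv a \<otimes> k) * (f a * x (inv a \<otimes> k))))"
        using k by (simp add: B_mult sum_distrib_left)
      \<comment> \<open>For right factors associativity suffices: u_g acts on f itself, which shifts
        the summation index a by g.\<close>
      also have "\<dots> = (\<Sum>a\<in>carrier A. \<mu> g * (\<alpha> a (inv a \<otimes> (g \<otimes> k)) * (f a * x (inv a \<otimes> (g \<otimes> k)))))"
      proof (rule sum.reindex_bij_witness[of _ "\<lambda>a. inv g \<otimes> a" "\<lambda>a. g \<otimes> a"])
        fix a assume a: "a \<in> carrier A"
        show "inv g \<otimes> (g \<otimes> a) = a" "g \<otimes> (inv g \<otimes> a) = a" using a g by (simp_all add: m_assoc[symmetric])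
        show "inv g \<otimes> a \<in> carrier A" "g \<otimes> a \<in> carrier A" using a g by simp_all
        define m where "m = inv a \<otimes> k"
        have m: "m \<in> carrier A" "k = a \<otimes> m" using a k unfolding m_def by (simp_all add: m_assoc[symmetric])
        have gm: "inv (g \<otimes> a) \<otimes> (g \<otimes> k) = m"
        proof -
          have "inv (g \<otimes> a) \<otimes> (g \<otimes> k) = inv (g \<otimes> a) \<otimes> ((g \<otimes> a) \<otimes> m)" using m a g by (simp add: m_assoc)
          also have "\<dots> = m" using m a g by (intro mult_inv_cancel(1)) simp_all
          finally show ?thesis .
        qed
        have "\<alpha> g k * \<alpha> a m = \<alpha> g a * \<alpha> (g \<otimes> a) m" using cocycle[OF g a m(1)] m(2) by (simp add: mult.commute)
        then have "\<alpha> g k * \<alpha> a m * (f a * x m) = \<alpha> (g \<otimes> a) m * x m * (\<alpha> g a * f a)"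
          by (simp add: algebra_simps)
        then show "\<mu> g * (\<alpha> (g \<otimes> a) (inv (g \<otimes> a) \<otimes> (g \<otimes> k)) * (f (g \<otimes> a) * x (inv (g \<otimes> a) \<otimes> (g \<otimes> k)))) =
            \<alpha> g k * (\<alpha> a (inv a \<otimes> k) * (f a * x (inv a \<otimes> k)))"
          unfolding gm m_def[symmetric] fg[OF a] by (auto simp add: algebra_simps)
      qed
      also have "\<dots> = \<mu> g * (f \<otimes>\<^bsub>B\<^esub> x) (g \<otimes> k)" using k g by (simp add: B_mult sum_distrib_left)
      finally show "\<alpha> g k * (f \<otimes>\<^bsub>B\<^esub> x) k = \<mu> g * (f \<otimes>\<^bsub>B\<^esub> x) (g \<otimes> k)" .
    qed
  qed
  have "basis_elem \<one> \<notin> I"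
  proof
    assume "basis_elem \<one> \<in> I"
    then have "\<alpha> g \<one> * basis_elem \<one> \<one> = \<mu> g * basis_elem \<one> (g \<otimes> \<one>)" unfolding I_def by blast
    then show False using g g1 cocycle_nonzero[OF g one_closed] by (simp add: basis_elem_def)
  qed
  then have "I \<noteq> carrier B" using basis_elem_B by blast
  \<comment> \<open>The eigenvector is the sum of \<mu>(k)^-1 u_k over the radical; the splitting
    equation is exactly the eigenvalue equation.\<close>
  have e: "(\<lambda>k. if k \<in> R then inverse (\<mu> k) else 0) \<in> I"
    unfolding I_def
  proof (intro CollectI conjI ballI)
    show "(\<lambda>k. if k \<in> R then inverse (\<mu> k) else 0) \<in> carrier B" using RA by (auto simp: B_carrier)
    fix k assume k: "k \<in> carrier A"
    have "k = inv g \<otimes> (g \<otimes> k)" using g k by (simp add: m_assoc[symmetric])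
    then have "g \<otimes> k \<in> R \<Longrightarrow> k \<in> R" using R gR subgroup.m_closed subgroup.m_inv_closed by metis
    then have iff: "g \<otimes> k \<in> R \<longleftrightarrow> k \<in> R" using R gR subgroup.m_closed by metis
    show "\<alpha> g k * (if k \<in> R then inverse (\<mu> k) else 0) =
        \<mu> g * (if g \<otimes> k \<in> R then inverse (\<mu> (g \<otimes> k)) else 0)"
      using iff \<mu>(1)[of k] \<mu>(1)[of "g \<otimes> k"] \<mu>(2)[OF gR, of k] by (auto simp: field_simps)
  qed
  have "I \<noteq> {\<zero>\<^bsub>B\<^esub>}"
  proof
    assume "I = {\<zero>\<^bsub>B\<^esub>}"
    then have "(\<lambda>k. if k \<in> R then inverse (\<mu> k) else 0) = (\<lambda>k. 0)" using e by (simp add: B_simps)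
    then show False using \<mu>(1)[OF gR] gR by (metis inverse_nonzero_iff_nonzero)
  qed
  with \<open>I \<noteq> carrier B\<close> show False using I nondegenerate unfolding nondegenerate_def simple_algebra_def by blast
qed

sublocale alternating_form A \<omega>
proof
  show "finite (carrier A)" by (rule finite_A)
  fix g h k assume g: "g \<in> carrier A" and h: "h \<in> carrier A"
  show "\<omega> g h \<noteq> 0" unfolding \<omega>_def using cocycle_nonzero g h by simp
  assume k: "k \<in> carrier A"
  show "\<omega> (g \<otimes> h) k = \<omega> g k * \<omega> h k" using commutator_mult_left g h k .
  show "\<omega> k (g \<otimes> h) = \<omega> k g * \<omega> k h"
    using commutator_mult_left[OF g h k] by (simp add: commutator_swap[of k])
next
  fix g assume "g \<in> carrier A"
  then show "\<omega> g g = 1" unfolding \<omega>_def using cocycle_nonzero by simp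
next
  fix g assume "g \<in> carrier A" "\<And>h. h \<in> carrier A \<Longrightarrow> \<omega> g h = 1"
  then show "g = \<one>" by (rule commutator_nondegenerate)
qed

section \<open>The representation on the cosets of a Lagrangian\<close>

lemma card_lagrangian_eq: assumes "lagrangian L" shows "card L = n"
  using card_lagrangian[OF assms] order_A by (simp add: power2_eq_iff_nonneg)

lemma n_pos: "0 < n"
  using order_A finite_A order_gt_0_iff_finite by (metis gr0I power_zero_numeral less_irrefl zero_neq_numeral)

text \<open>With \<open>\<mu>\<close> splitting the cocycle on \<open>L\<close>, the left ideal generated by \<open>\<Sum>\<^sub>l \<mu>(l)\<^sup>-\<^sup>1 u\<^sub>l\<close> is
  an \<open>n\<close>-dimensional module with a basis indexed by the cosets of \<open>L\<close>; \<open>E a i j\<close> below are the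
  matrix coefficients of \<open>u\<^sub>a\<close> in that basis.\<close>

lemma lagrangian_quotient_elementary:
  fixes \<Gamma> :: "'g monoid"
  assumes L: "lagrangian L" and \<Gamma>: "group \<Gamma>" and \<phi>: "\<phi> \<in> hom A \<Gamma>" "\<phi> ` carrier A = carrier \<Gamma>"
    and ker: "\<And>a. a \<in> carrier A \<Longrightarrow> \<phi> a = \<one>\<^bsub>\<Gamma>\<^esub> \<longleftrightarrow> a \<in> L"
    and s: "bij_betw s {..<n} (carrier \<Gamma>)"
  shows "\<exists>\<psi>. quotient_morphism B (twisted_grading A) (matrix_algebra n) (elementary_grading n \<Gamma> s) \<psi> \<phi>"
proof -
  interpret \<Gamma>: group \<Gamma> by fact
  interpret \<phi>: group_hom A \<Gamma> \<phi>
    using \<phi>(1) is_group \<Gamma> by (simp add: group_hom_def group_hom_axioms_def)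
  interpret B: complex_algebra B by (rule complex_algebra_B)
  interpret M: complex_algebra "matrix_algebra n" by (rule complex_algebra_matrix)
  have Lsub: "subgroup L A" and perpL: "perp L = L" using L unfolding lagrangian_def by auto
  have LA: "l \<in> carrier A" if "l \<in> L" for l using subgroup.mem_carrier[OF Lsub that] .
  have symL: "\<alpha> l m = \<alpha> m l" if "l \<in> L" "m \<in> L" for l m
  proof -
    have "\<omega> l m = 1" using that perpL unfolding perp_def by blast
    then show ?thesis unfolding \<omega>_def by (simp add: cocycle_nonzero LA that)
  qed
  obtain \<mu> where \<mu>cocycle_nonzero: "\<And>l. l \<in> L \<Longrightarrow> \<mu> l \<noteq> (0::complex)"
      and \<mu>: "\<And>l m. l \<in> L \<Longrightarrow> m \<in> L \<Longrightarrow> \<mu> l * \<mu> m = \<alpha> l m * \<mu> (l \<otimes> m)"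
  proof (rule symmetric_cocycle_splits[of "A\<lparr>carrier := L\<rparr>" \<alpha>])
    show "comm_group (A\<lparr>carrier := L\<rparr>)" by (rule subgroup_is_comm_group[OF Lsub])
    show "finite (carrier (A\<lparr>carrier := L\<rparr>))" using finite_A LA by (auto intro: finite_subset)
    show "two_cocycle (A\<lparr>carrier := L\<rparr>) \<alpha>" using is_two_cocycle LA unfolding two_cocycle_def by simp
  qed (use symL in auto)
  have phi_eq: "\<phi> a = \<phi> b \<longleftrightarrow> inv a \<otimes> b \<in> L" if "a \<in> carrier A" "b \<in> carrier A" for a b
  proof -
    have "inv a \<otimes> b \<in> L \<longleftrightarrow> inv\<^bsub>\<Gamma>\<^esub> (\<phi> a) \<otimes>\<^bsub>\<Gamma>\<^esub> \<phi> b = \<one>\<^bsub>\<Gamma>\<^esub>"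
      using ker[of "inv a \<otimes> b"] that by simp
    also have "\<dots> \<longleftrightarrow> \<phi> a = \<phi> b"
      using that \<phi>.hom_closed by (metis \<Gamma>.inv_solve_left' \<Gamma>.r_one \<Gamma>.one_closed)
    finally show ?thesis by simp
  qed
  define rep where "rep = inv_into (carrier A) \<phi>"
  have rep: "rep \<gamma> \<in> carrier A" "\<phi> (rep \<gamma>) = \<gamma>" if "\<gamma> \<in> carrier \<Gamma>" for \<gamma>
    using that \<phi>(2) unfolding rep_def by (auto intro: inv_into_into f_inv_into_f)
  define t where "t j = rep (s j)" for j
  have sc: "s j \<in> carrier \<Gamma>" if "j < n" for j using bij_betwE[OF s] that by auto
  have s_inj: "s i = s j \<longleftrightarrow> i = j" if "i < n" "j < n" for i j
    using s that by (auto simp: bij_betw_def inj_on_def)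
  have s_surj: "\<exists>i<n. s i = \<gamma>" if "\<gamma> \<in> carrier \<Gamma>" for \<gamma>
    using s that unfolding bij_betw_def by (metis imageE lessThan_iff)
  have t: "t j \<in> carrier A" "\<phi> (t j) = s j" if "j < n" for j
    using rep[OF sc[OF that]] unfolding t_def by auto
  \<comment> \<open>Let v be the sum of \<mu>(l)^-1 u_l over L, so that u_l v = \<mu>(l) v. With r
    the representative of the coset of x, \<nu>(x) is the scalar in u_x v = \<nu>(x) u_r v.\<close>
  define \<nu> where "\<nu> x = \<mu> (inv (rep (\<phi> x)) \<otimes> x) / \<alpha> (rep (\<phi> x)) (inv (rep (\<phi> x)) \<otimes> x)" for x
  have repL: "inv (rep (\<phi> x)) \<otimes> x \<in> L" if "x \<in> carrier A" for x
    using phi_eq[of "rep (\<phi> x)" x] rep[of "\<phi> x"] that by simp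
  have \<nu>cocycle_nonzero: "\<nu> x \<noteq> 0" if "x \<in> carrier A" for x
    unfolding \<nu>_def using repL[OF that] \<mu>cocycle_nonzero cocycle_nonzero rep(1)[of "\<phi> x"] LA that by simp
  \<comment> \<open>Both sides are the coefficient of u_a u_x v at the representative of the coset
    of ax: on the left u_x v is reduced to its representative first, on the right u_a u_x is
    multiplied out first.\<close>
  have \<nu>: "\<nu> x * (\<alpha> a (rep (\<phi> x)) * \<nu> (a \<otimes> rep (\<phi> x))) = \<alpha> a x * \<nu> (a \<otimes> x)"
    if a: "a \<in> carrier A" and x: "x \<in> carrier A" for a x
  proof -
    define r where "r = rep (\<phi> x)"
    define l where "l = inv r \<otimes> x"
    define r' where "r' = rep (\<phi> (a \<otimes> x))"
    define l' where "l' = inv r' \<otimes> (a \<otimes> r)"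
    have r: "r \<in> carrier A" "\<phi> r = \<phi> x" unfolding r_def using rep x by auto
    have r': "r' \<in> carrier A" "\<phi> r' = \<phi> (a \<otimes> x)" unfolding r'_def using rep x a by auto
    have r'': "r' = rep (\<phi> (a \<otimes> r))" unfolding r'_def using a x r by simp
    have l: "l \<in> L" unfolding l_def r_def by (rule repL[OF x])
    have l': "l' \<in> L" unfolding l'_def r'' using a r by (intro repL) simp
    have xl: "r \<otimes> l = x" unfolding l_def using r x by (simp add: mult_inv_cancel)
    have al: "r' \<otimes> l' = a \<otimes> r" unfolding l'_def using r' r a by (simp add: mult_inv_cancel)
    have ll: "inv r' \<otimes> (a \<otimes> x) = l' \<otimes> l"
      unfolding l'_def xl[symmetric] using r r' a LA[OF l] by (simp add: m_assoc)
    have \<nu>1: "\<nu> x = \<mu> l / \<alpha> r l" unfolding \<nu>_def r_def[symmetric] l_def[symmetric] by simp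
    have \<nu>2: "\<nu> (a \<otimes> r) = \<mu> l' / \<alpha> r' l'" unfolding \<nu>_def r''[symmetric] l'_def[symmetric] by simp
    have \<nu>3: "\<nu> (a \<otimes> x) = \<mu> (l' \<otimes> l) / \<alpha> r' (l' \<otimes> l)"
      unfolding \<nu>_def r'_def[symmetric] ll by simp
    have c1: "\<alpha> r' l' * \<alpha> (a \<otimes> r) l = \<alpha> l' l * \<alpha> r' (l' \<otimes> l)"
      using cocycle[of r' l' l] r' LA l l' al by simp
    have c2: "\<alpha> a r * \<alpha> (a \<otimes> r) l = \<alpha> r l * \<alpha> a x"
      using cocycle[of a r l] a r LA l xl by simp
    have c3: "\<mu> l' * \<mu> l = \<alpha> l' l * \<mu> (l' \<otimes> l)" using \<mu>[OF l' l] .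
    have nzs: "\<alpha> r l \<noteq> 0" "\<alpha> r' l' \<noteq> 0" "\<alpha> r' (l' \<otimes> l) \<noteq> 0" "\<alpha> (a \<otimes> r) l \<noteq> 0"
      using cocycle_nonzero r r' a LA l l' by auto
    have "(\<mu> l * \<alpha> a r * \<mu> l' * \<alpha> r' (l' \<otimes> l)) * \<alpha> (a \<otimes> r) l =
        (\<mu> l' * \<mu> l) * (\<alpha> a r * \<alpha> (a \<otimes> r) l) * \<alpha> r' (l' \<otimes> l)" by (simp add: algebra_simps)
    also have "\<dots> = (\<alpha> l' l * \<alpha> r' (l' \<otimes> l)) * \<mu> (l' \<otimes> l) * \<alpha> r l * \<alpha> a x"
      unfolding c2 c3 by (simp add: algebra_simps)
    also have "\<dots> = (\<alpha> a x * \<mu> (l' \<otimes> l) * \<alpha> r l * \<alpha> r' l') * \<alpha> (a \<otimes> r) l"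
      unfolding c1[symmetric] by (simp add: algebra_simps)
    finally have "\<mu> l * \<alpha> a r * \<mu> l' * \<alpha> r' (l' \<otimes> l) = \<alpha> a x * \<mu> (l' \<otimes> l) * \<alpha> r l * \<alpha> r' l'"
      using nzs(4) by simp
    then have "(\<mu> l / \<alpha> r l) * (\<alpha> a r * (\<mu> l' / \<alpha> r' l')) = \<alpha> a x * (\<mu> (l' \<otimes> l) / \<alpha> r' (l' \<otimes> l))"
      using nzs by (simp add: field_simps)
    then show ?thesis unfolding \<nu>1 r_def[symmetric] \<nu>2 \<nu>3 .
  qed
  \<comment> \<open>Read off from u_a applied to the basis vector u_(t j) v: the result is a
    multiple of the single basis vector whose coset is \<phi>(a) s j. So every u_a acts by a
    monomial matrix.\<close>
  define E where "E a i j = (if \<phi> a \<otimes>\<^bsub>\<Gamma>\<^esub> s j = s i then \<alpha> a (t j) * \<nu> (a \<otimes> t j) else 0)" for a i j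
  have Enz: "E a i j \<noteq> 0 \<longleftrightarrow> \<phi> a \<otimes>\<^bsub>\<Gamma>\<^esub> s j = s i" if "a \<in> carrier A" "j < n" for a i j
    unfolding E_def using cocycle_nonzero t(1) \<nu>cocycle_nonzero that by simp
  have Emul: "E a i k * E b k j = \<alpha> a b * E (a \<otimes> b) i j"
    if a: "a \<in> carrier A" and b: "b \<in> carrier A" and j: "j < n" and k: "k < n" "\<phi> b \<otimes>\<^bsub>\<Gamma>\<^esub> s j = s k" for a b i j k
  proof -
    have x: "b \<otimes> t j \<in> carrier A" using b t(1)[OF j] by simp
    have px: "\<phi> (b \<otimes> t j) = s k" using b t[OF j] k by simp
    then have tk: "t k = rep (\<phi> (b \<otimes> t j))" unfolding t_def by simp
    have iff: "\<phi> a \<otimes>\<^bsub>\<Gamma>\<^esub> s k = s i \<longleftrightarrow> \<phi> (a \<otimes> b) \<otimes>\<^bsub>\<Gamma>\<^esub> s j = s i"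
      unfolding k(2)[symmetric] using a b sc[OF j] by (simp add: \<Gamma>.m_assoc)
    have "\<alpha> a (t k) * \<nu> (a \<otimes> t k) * (\<alpha> b (t j) * \<nu> (b \<otimes> t j)) =
        \<alpha> b (t j) * (\<nu> (b \<otimes> t j) * (\<alpha> a (rep (\<phi> (b \<otimes> t j))) * \<nu> (a \<otimes> rep (\<phi> (b \<otimes> t j)))))"
      unfolding tk by (simp add: algebra_simps)
    also have "\<dots> = (\<alpha> b (t j) * \<alpha> a (b \<otimes> t j)) * \<nu> (a \<otimes> (b \<otimes> t j))"
      unfolding \<nu>[OF a x] by (simp add: algebra_simps)
    also have "\<dots> = \<alpha> a b * (\<alpha> (a \<otimes> b) (t j) * \<nu> (a \<otimes> b \<otimes> t j))"
      using cocycle[OF a b t(1)[OF j]] a b t(1)[OF j] by (simp add: m_assoc mult.assoc[symmetric])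
    finally show ?thesis unfolding E_def using iff k by simp
  qed
  \<comment> \<open>Only one intermediate index contributes, as column j of the matrix of u_b has a
    single non-zero entry.\<close>
  have Esum: "(\<Sum>k<n. E a i k * E b k j) = \<alpha> a b * E (a \<otimes> b) i j"
    if a: "a \<in> carrier A" and b: "b \<in> carrier A" and j: "j < n" for a b i j
  proof -
    obtain k where k: "k < n" "s k = \<phi> b \<otimes>\<^bsub>\<Gamma>\<^esub> s j" using s_surj[of "\<phi> b \<otimes>\<^bsub>\<Gamma>\<^esub> s j"] b sc[OF j] by auto
    have "(\<Sum>k<n. E a i k * E b k j) = (\<Sum>k'<n. if k' = k then E a i k * E b k j else 0)"
    proof (intro sum.cong refl)
      fix k' assume "k' \<in> {..<n}"
      then show "E a i k' * E b k' j = (if k' = k then E a i k * E b k j else 0)"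
        using Enz[OF b j, of k'] k s_inj[of k' k] by auto
    qed
    then show ?thesis using Emul[OF a b j k(1) k(2)[symmetric]] k(1) by simp
  qed
  define \<psi> where "\<psi> f = mat n n (\<lambda>(i, j). \<Sum>a\<in>carrier A. f a * E a i j)" for f :: "'a \<Rightarrow> complex"
  have \<psi>i: "\<psi> f $$ (i, j) = (\<Sum>a\<in>carrier A. f a * E a i j)" if "i < n" "j < n" for f i j
    using that by (simp add: \<psi>_def)
  have \<psi>c: "\<psi> f \<in> carrier_mat n n" for f by (simp add: \<psi>_def)
  have \<psi>mult: "\<psi> (f \<otimes>\<^bsub>B\<^esub> f') = \<psi> f * \<psi> f'" for f f'
  proof (rule eq_matI)
    fix i j assume "i < dim_row (\<psi> f * \<psi> f')" "j < dim_col (\<psi> f * \<psi> f')"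
    then have ij: "i < n" "j < n" by (auto simp: \<psi>_def)
    have "(\<psi> f * \<psi> f') $$ (i, j) =
        (\<Sum>k<n. (\<Sum>a\<in>carrier A. f a * E a i k) * (\<Sum>b\<in>carrier A. f' b * E b k j))"
      using ij by (simp add: index_mult_square_mat[OF \<psi>c \<psi>c] \<psi>i)
    also have "\<dots> = (\<Sum>k<n. \<Sum>a\<in>carrier A. \<Sum>b\<in>carrier A. f a * f' b * (E a i k * E b k j))"
      unfolding sum_product by (intro sum.cong refl) (simp add: mult_ac)
    also have "\<dots> = (\<Sum>a\<in>carrier A. \<Sum>k<n. \<Sum>b\<in>carrier A. f a * f' b * (E a i k * E b k j))"
      by (rule sum.swap)
    also have "\<dots> = (\<Sum>a\<in>carrier A. \<Sum>b\<in>carrier A. \<Sum>k<n. f a * f' b * (E a i k * E b k j))"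
      by (intro sum.cong refl sum.swap)
    also have "\<dots> = (\<Sum>a\<in>carrier A. \<Sum>b\<in>carrier A. f a * f' b * (\<alpha> a b * E (a \<otimes> b) i j))"
      by (intro sum.cong refl) (simp add: sum_distrib_left[symmetric] Esum ij)
    also have "\<dots> = (\<Sum>a\<in>carrier A. \<Sum>k\<in>carrier A. \<alpha> a (inv a \<otimes> k) * (f a * f' (inv a \<otimes> k)) * E k i j)"
    proof (rule sum.cong[OF refl])
      fix a assume a: "a \<in> carrier A"
      show "(\<Sum>b\<in>carrier A. f a * f' b * (\<alpha> a b * E (a \<otimes> b) i j)) =
          (\<Sum>k\<in>carrier A. \<alpha> a (inv a \<otimes> k) * (f a * f' (inv a \<otimes> k)) * E k i j)"
        by (rule sum.reindex_bij_witness[of _ "\<lambda>k. inv a \<otimes> k" "\<lambda>b. a \<otimes> b"])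
          (use a in \<open>auto simp: mult_inv_cancel algebra_simps\<close>)
    qed
    also have "\<dots> = (\<Sum>k\<in>carrier A. \<Sum>a\<in>carrier A. \<alpha> a (inv a \<otimes> k) * (f a * f' (inv a \<otimes> k)) * E k i j)"
      by (rule sum.swap)
    also have "\<dots> = (\<Sum>k\<in>carrier A. (f \<otimes>\<^bsub>B\<^esub> f') k * E k i j)"
      by (intro sum.cong refl) (simp only: B_mult sum_distrib_right)
    finally show "\<psi> (f \<otimes>\<^bsub>B\<^esub> f') $$ (i, j) = (\<psi> f * \<psi> f') $$ (i, j)" using ij by (simp add: \<psi>i)
  qed (auto simp: \<psi>_def)
  have \<psi>add: "\<psi> (f \<oplus>\<^bsub>B\<^esub> f') = \<psi> f + \<psi> f'" for f f'
    by (rule eq_matI) (auto simp: \<psi>_def B_simps algebra_simps sum.distrib)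
  have \<psi>smult: "\<psi> (c \<odot>\<^bsub>B\<^esub> f) = c \<cdot>\<^sub>m \<psi> f" for c f
    by (rule eq_matI) (auto simp: \<psi>_def B_simps algebra_simps sum_distrib_left)
  have \<psi>basis: "\<psi> (\<lambda>k. c * basis_elem g k) $$ (i, j) = c * E g i j" if "g \<in> carrier A" "i < n" "j < n" for c g i j
  proof -
    have "\<psi> (\<lambda>k. c * basis_elem g k) $$ (i, j) = (\<Sum>a\<in>carrier A. if a = g then c * E g i j else 0)"
      unfolding \<psi>i[OF that(2,3)] by (intro sum.cong) (auto simp: basis_elem_def)
    then show ?thesis using that finite_A by simp
  qed
  have \<mu>1: "\<mu> \<one> = \<alpha> \<one> \<one>"
    using \<mu>[of \<one> \<one>] \<mu>cocycle_nonzero[of \<one>] subgroup.one_closed[OF Lsub] by simp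
  have \<psi>one: "\<psi> \<one>\<^bsub>B\<^esub> = 1\<^sub>m n"
  proof (rule eq_matI)
    fix i j assume "i < dim_row (1\<^sub>m n)" "j < dim_col (1\<^sub>m n :: complex mat)"
    then have ij: "i < n" "j < n" by auto
    have "E \<one> i j = (if i = j then \<alpha> \<one> \<one> else 0)"
    proof -
      have "rep (\<phi> (t j)) = t j" using t(2)[OF ij(2)] unfolding t_def by simp
      then have "\<nu> (t j) = \<mu> \<one> / \<alpha> (t j) \<one>" unfolding \<nu>_def using t(1)[OF ij(2)] by simp
      also have "\<dots> = 1"
        unfolding \<mu>1 two_cocycle_one(2)[OF is_group is_two_cocycle t(1)[OF ij(2)]] using cocycle_nonzero[of \<one> \<one>] by simp
      finally have "\<nu> (\<one> \<otimes> t j) = 1" using t(1)[OF ij(2)] by simp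
      moreover have "\<phi> \<one> \<otimes>\<^bsub>\<Gamma>\<^esub> s j = s i \<longleftrightarrow> i = j" using sc[OF ij(2)] s_inj[OF ij] by auto
      ultimately show ?thesis
        unfolding E_def two_cocycle_one(1)[OF is_group is_two_cocycle t(1)[OF ij(2)]] by simp
    qed
    then show "\<psi> \<one>\<^bsub>B\<^esub> $$ (i, j) = 1\<^sub>m n $$ (i, j)"
      using ij cocycle_nonzero[of \<one> \<one>] by (simp add: B_simps \<psi>basis)
  qed (auto simp: \<psi>_def)
  have \<psi>hom: "\<psi> \<in> Ring.ring_hom B (matrix_algebra n)"
    unfolding Ring.ring_hom_def using \<psi>c \<psi>mult \<psi>add \<psi>one by (simp add: module_mat_simps)
  interpret \<psi>: ring_hom_ring B "matrix_algebra n" \<psi>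
    using B.ring_axioms M.ring_axioms \<psi>hom by (rule ring_hom_ringI2)
  have "1\<^sub>m n $$ (0, 0) \<noteq> (0\<^sub>m n n :: complex mat) $$ (0, 0)" using n_pos by simp
  then have "\<psi> \<one>\<^bsub>B\<^esub> \<noteq> \<zero>\<^bsub>matrix_algebra n\<^esub>" unfolding \<psi>one module_mat_simps by metis
  then have "\<one>\<^bsub>B\<^esub> \<notin> a_kernel B (matrix_algebra n) \<psi>" using \<psi>.kernel_zero by blast
  then have "a_kernel B (matrix_algebra n) \<psi> \<noteq> carrier B" using B.one_closed by blast
  then have "a_kernel B (matrix_algebra n) \<psi> = {\<zero>\<^bsub>B\<^esub>}"
    using \<psi>.kernel_is_ideal nondegenerate unfolding nondegenerate_def simple_algebra_def by blast
  then have inj: "inj_on \<psi> (carrier B)" by (rule \<psi>.trivial_ker_imp_inj)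
  \<comment> \<open>Schur orthogonality for the matrix coefficients. The elements g with a non-zero
    entry at (i,j) form a coset of L, with n elements; entries at (k,l) are summed against the
    inverses of those at (i,j) over it. It provides the inverse of \<psi>.\<close>
  have orth: "(\<Sum>g\<in>carrier A. if \<phi> g \<otimes>\<^bsub>\<Gamma>\<^esub> s j = s i then inverse (E g i j) * E g k l else 0) =
      (if k = i \<and> l = j then of_nat n else 0)"
    if ij: "i < n" "j < n" and kl: "k < n" "l < n" for i j k l
  proof -
    define S where "S = {g \<in> carrier A. \<phi> g \<otimes>\<^bsub>\<Gamma>\<^esub> s j = s i}"
    define g0 where "g0 = t i \<otimes> inv (t j)"
    have g0: "g0 \<in> carrier A" "\<phi> g0 \<otimes>\<^bsub>\<Gamma>\<^esub> s j = s i"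
      unfolding g0_def using t ij sc by (simp_all add: \<Gamma>.m_assoc)
    have S_phi: "\<phi> g = \<phi> g0" if "g \<in> S" for g
      using that g0 sc[OF ij(2)] \<Gamma>.right_cancel[of "s j" "\<phi> g" "\<phi> g0"] unfolding S_def by simp
    have Simg: "S = (\<lambda>x. g0 \<otimes> x) ` L"
    proof (intro equalityI subsetI)
      fix g assume g: "g \<in> S"
      then have "\<phi> g = \<phi> g0" by (rule S_phi)
      then have "inv g0 \<otimes> g \<in> L" using phi_eq[OF g0(1), of g] g unfolding S_def by simp
      moreover have "g = g0 \<otimes> (inv g0 \<otimes> g)" using g g0 unfolding S_def by (simp add: mult_inv_cancel)
      ultimately show "g \<in> (\<lambda>x. g0 \<otimes> x) ` L" by blast
    next
      fix g assume "g \<in> (\<lambda>x. g0 \<otimes> x) ` L"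
      then obtain x where x: "x \<in> L" "g = g0 \<otimes> x" by blast
      then have "\<phi> g = \<phi> g0" using ker[OF LA[OF x(1)]] g0(1) LA[OF x(1)] by simp
      then show "g \<in> S" unfolding S_def using g0 x LA by simp
    qed
    have inj0: "inj_on (\<lambda>x. g0 \<otimes> x) L" using g0(1) LA by (auto intro!: inj_onI)
    have "(\<Sum>g\<in>carrier A. if \<phi> g \<otimes>\<^bsub>\<Gamma>\<^esub> s j = s i then inverse (E g i j) * E g k l else 0) =
        (\<Sum>g\<in>S. inverse (E g i j) * E g k l)"
      unfolding S_def using finite_A by (intro sum.mono_neutral_cong_right) auto
    also have "\<dots> = (if k = i \<and> l = j then of_nat n else 0)"
    proof (cases "k = i \<and> l = j")
      case True
      have "inverse (E g i j) * E g k l = 1" if "g \<in> S" for g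
        using that True Enz[of g j i] ij unfolding S_def by simp
      then have "(\<Sum>g\<in>S. inverse (E g i j) * E g k l) = of_nat (card S)" by simp
      moreover have "card S = n" unfolding Simg using card_image[OF inj0] card_lagrangian_eq[OF L] by simp
      ultimately show ?thesis using True by simp
    next
      case False
      show ?thesis
      \<comment> \<open>Two positions have either disjoint or equal supports, both being cosets of
        L. Only equal supports require cancellation in the sum.\<close>
      proof (cases "\<phi> g0 \<otimes>\<^bsub>\<Gamma>\<^esub> s l = s k")
        case no: False
        have "E g k l = 0" if "g \<in> S" for g
          using S_phi[OF that] no unfolding E_def by simp
        then show ?thesis unfolding if_not_P[OF False] by simp
      next
        case yes: True
        have lj: "l \<noteq> j"
        proof
          assume "l = j"
          then have "s k = s i" using yes g0(2) by simp
          then show False using s_inj[OF kl(1) ij(1)] False \<open>l = j\<close> by simp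
        qed
        define h where "h = t l \<otimes> inv (t j)"
        have h: "h \<in> carrier A" "\<phi> h \<otimes>\<^bsub>\<Gamma>\<^esub> s j = s l"
          unfolding h_def using t ij kl sc by (simp_all add: \<Gamma>.m_assoc)
        have hL: "inv h \<notin> L"
        proof
          assume "inv h \<in> L"
          then have "h \<in> L" using subgroup.m_inv_closed[OF Lsub, of "inv h"] h(1) by simp
          then have "s l = s j" using h ker[OF h(1)] sc[OF ij(2)] by simp
          then show False using s_inj[OF kl(2) ij(2)] lj by simp
        qed
        \<comment> \<open>Here h carries coset j to coset l, and hence coset i to coset k. Comparing
          u_g u_h with u_h u_g at position (k,j) shows that the ratio of the entries of u_g is a
          constant times \<omega>(g,h). As h is not in L = perp L, this character is non-trivial on
          L and its sum vanishes.\<close>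
        have ratio: "inverse (E g i j) * E g k l = \<omega> g h * (E h k i / E h l j)" if g: "g \<in> S" for g
        proof -
          have gA: "g \<in> carrier A" and gij: "\<phi> g \<otimes>\<^bsub>\<Gamma>\<^esub> s j = s i" using g unfolding S_def by auto
          have "E g k l * E h l j = \<alpha> g h * E (g \<otimes> h) k j"
            by (rule Emul[OF gA h(1) ij(2) kl(2) h(2)])
          moreover have "E h k i * E g i j = \<alpha> h g * E (h \<otimes> g) k j"
            by (rule Emul[OF h(1) gA ij(2) ij(1) gij])
          moreover have "h \<otimes> g = g \<otimes> h" using h(1) gA by (rule m_comm)
          ultimately have "\<alpha> h g * (E g k l * E h l j) = \<alpha> g h * (E h k i * E g i j)"
            by (simp add: algebra_simps)
          moreover have "E g i j \<noteq> 0" "E h l j \<noteq> 0" "\<alpha> h g \<noteq> 0"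
            using Enz[OF gA ij(2)] Enz[OF h(1) ij(2)] gij h(2) cocycle_nonzero[OF h(1) gA] by auto
          ultimately show ?thesis unfolding \<omega>_def by (simp add: field_simps)
        qed
        have "(\<Sum>g\<in>S. inverse (E g i j) * E g k l) = (\<Sum>g\<in>S. \<omega> g h) * (E h k i / E h l j)"
          unfolding sum_distrib_right by (intro sum.cong refl ratio)
        also have "(\<Sum>g\<in>S. \<omega> g h) = (\<Sum>x\<in>L. \<omega> (g0 \<otimes> x) h)"
          unfolding Simg by (rule sum.reindex[OF inj0, unfolded comp_def])
        also have "\<dots> = \<omega> g0 h * (\<Sum>x\<in>L. \<omega> (inv h) x)"
        proof -
          have "\<omega> (g0 \<otimes> x) h = \<omega> g0 h * \<omega> (inv h) x" if "x \<in> L" for x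
            using mult_left[OF g0(1) LA[OF that] h(1)] form_inv[OF h(1) LA[OF that]]
              commutator_swap[of x h] by simp
          then show ?thesis by (simp add: sum_distrib_left)
        qed
        also have "(\<Sum>x\<in>L. \<omega> (inv h) x) = 0"
          using character_sum[OF Lsub, of "inv h"] h(1) hL perpL by simp
        finally show ?thesis unfolding if_not_P[OF False] by simp
      qed
    qed
    finally show ?thesis .
  qed
  have surj: "\<psi> ` carrier B = carrier_mat n n"
  proof (intro equalityI subsetI)
    fix X :: "complex mat" assume X: "X \<in> carrier_mat n n"
    \<comment> \<open>Fourier inversion: by \<open>orth\<close>, the matrix unit at (i,j) is the
      image of the sum of u_g / (n E g i j) over all g with a non-zero entry at (i,j).\<close>
    define F where "F g = (if g \<in> carrier A then
        \<Sum>i<n. \<Sum>j<n. if \<phi> g \<otimes>\<^bsub>\<Gamma>\<^esub> s j = s i then X $$ (i, j) * inverse (E g i j) / of_nat n else 0 else 0)" for g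
    have FB: "F \<in> carrier B" by (simp add: B_carrier F_def)
    have "\<psi> F = X"
    proof (rule eq_matI)
      fix k l assume "k < dim_row X" "l < dim_col X"
      then have kl: "k < n" "l < n" using X by auto
      have "\<psi> F $$ (k, l) = (\<Sum>g\<in>carrier A. \<Sum>i<n. \<Sum>j<n. X $$ (i, j) / of_nat n *
          (if \<phi> g \<otimes>\<^bsub>\<Gamma>\<^esub> s j = s i then inverse (E g i j) * E g k l else 0))"
        unfolding \<psi>i[OF kl] F_def by (intro sum.cong refl) (auto simp: sum_distrib_right intro!: sum.cong)
      also have "\<dots> = (\<Sum>i<n. \<Sum>g\<in>carrier A. \<Sum>j<n. X $$ (i, j) / of_nat n *
          (if \<phi> g \<otimes>\<^bsub>\<Gamma>\<^esub> s j = s i then inverse (E g i j) * E g k l else 0))" by (rule sum.swap)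
      also have "\<dots> = (\<Sum>i<n. \<Sum>j<n. \<Sum>g\<in>carrier A. X $$ (i, j) / of_nat n *
          (if \<phi> g \<otimes>\<^bsub>\<Gamma>\<^esub> s j = s i then inverse (E g i j) * E g k l else 0))"
        by (intro sum.cong refl sum.swap)
      also have "\<dots> = (\<Sum>i<n. \<Sum>j<n. X $$ (i, j) / of_nat n * (if k = i \<and> l = j then of_nat n else 0))"
        by (intro sum.cong refl) (simp only: sum_distrib_left[symmetric] orth kl lessThan_iff)
      also have "\<dots> = (\<Sum>i<n. \<Sum>j<n. if l = j then (if k = i then X $$ (i, j) else 0) else 0)"
        using n_pos by (intro sum.cong refl) auto
      also have "\<dots> = X $$ (k, l)" using kl by simp
      finally show "\<psi> F $$ (k, l) = X $$ (k, l)" .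
    qed (use X in \<open>auto simp: \<psi>_def\<close>)
    then show "X \<in> \<psi> ` carrier B" using FB by blast
  qed (use \<psi>c in auto)
  have "\<psi> \<in> algebra_iso B (matrix_algebra n)"
    unfolding algebra_iso_def ring_iso_def bij_betw_def
    using \<psi>hom inj surj \<psi>smult by (simp add: module_mat_simps)
  moreover have "\<psi> ` {\<lambda>k. c * basis_elem g k | c. True} \<subseteq> snd (elementary_grading n \<Gamma> s) (\<phi> g)"
    if g: "g \<in> carrier A" for g
  proof
    fix X assume "X \<in> \<psi> ` {\<lambda>k. c * basis_elem g k | c. True}"
    then obtain c where X: "X = \<psi> (\<lambda>k. c * basis_elem g k)" by auto
    have "s i \<otimes>\<^bsub>\<Gamma>\<^esub> inv\<^bsub>\<Gamma>\<^esub> (s j) = \<phi> g" if "i < n" "j < n" "X $$ (i, j) \<noteq> 0" for i j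
    proof -
      have "E g i j \<noteq> 0" using that \<psi>basis[OF g] unfolding X by auto
      then have "\<phi> g \<otimes>\<^bsub>\<Gamma>\<^esub> s j = s i" using Enz[OF g that(2)] by simp
      then show ?thesis using g sc[OF that(2)] sc[OF that(1)] by (metis \<Gamma>.inv_solve_right \<phi>.hom_closed)
    qed
    then show "X \<in> snd (elementary_grading n \<Gamma> s) (\<phi> g)"
      using \<psi>c unfolding elementary_grading_def X by simp
  qed
  ultimately show ?thesis
    unfolding quotient_morphism_def using \<phi>
    by (intro exI[of _ \<psi>]) (simp add: twisted_grading_def elementary_grading_def)
qed

text \<open>For \<open>r\<close> orthogonal to the kernel, \<open>u\<^sub>r\<close> commutes with the preimage of the identity component,
  which contains all diagonal matrices; so its image is diagonal and has degree \<open>\<one>\<close>.\<close>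

lemma elementary_quotient_kernel_coisotropic:
  fixes \<Gamma> :: "'g monoid"
  assumes \<Gamma>: "group \<Gamma>" and s: "s \<in> {..<n} \<rightarrow> carrier \<Gamma>"
    and q: "quotient_morphism B (twisted_grading A) (matrix_algebra n) (elementary_grading n \<Gamma> s) \<psi> \<phi>"
  shows "perp (kernel A \<Gamma> \<phi>) \<subseteq> kernel A \<Gamma> \<phi>"
proof
  interpret \<Gamma>: group \<Gamma> by fact
  interpret B: complex_algebra B by (rule complex_algebra_B)
  fix r assume r: "r \<in> perp (kernel A \<Gamma> \<phi>)"
  then have rA: "r \<in> carrier A" using perp_subset by blast
  have \<psi>: "\<psi> \<in> algebra_iso B (matrix_algebra n)" and \<phi>: "\<phi> \<in> hom A \<Gamma>"
    and V: "\<And>g x. g \<in> carrier A \<Longrightarrow> x \<in> snd (twisted_grading A) g \<Longrightarrow>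
      \<psi> x \<in> snd (elementary_grading n \<Gamma> s) (\<phi> g)"
    using q unfolding quotient_morphism_def fst_gradings by (blast, blast, blast)
  note \<psi>' = algebra_isoD[OF \<psi>, unfolded module_mat_simps]
  have sc: "s i \<in> carrier \<Gamma>" if "i < n" for i using s that by auto
  define U where "U = \<psi> (basis_elem r)"
  have U: "U \<in> carrier_mat n n" unfolding U_def using \<psi>'(1) basis_elem_B[OF rA] by simp
  have offdiag: "U $$ (i, p) = 0" if ip: "i < n" "p < n" "i \<noteq> p" for i p
  proof -
    \<comment> \<open>The diagonal matrix unit at p has degree s p (s p)^-1 = 1, whatever s
      is.\<close>
    define D :: "complex mat" where "D = mat n n (\<lambda>(i, j). if i = p \<and> j = p then 1 else 0)"
    have D: "D \<in> carrier_mat n n" by (simp add: D_def)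
    have D1: "D \<in> snd (elementary_grading n \<Gamma> s) \<one>\<^bsub>\<Gamma>\<^esub>"
      unfolding elementary_grading_def using sc ip by (auto simp: D_def)
    have "D \<in> \<psi> ` carrier B" using D \<psi>'(6) by (simp add: bij_betw_def)
    then obtain x where x: "x \<in> carrier B" "\<psi> x = D" by blast
    have xsum: "x = finsum B (\<lambda>a k. x a * basis_elem a k) (carrier A)"
    proof
      fix k
      have "finsum B (\<lambda>a k. x a * basis_elem a k) (carrier A) k = (\<Sum>a\<in>carrier A. x a * basis_elem a k)"
        by (rule B.additive_finsum[of "\<lambda>f. f k"]) (auto simp: B_simps finite_A B_carrier basis_elem_def)
      also have "\<dots> = (\<Sum>a\<in>carrier A. if a = k then x k else 0)"
        by (intro sum.cong) (auto simp: basis_elem_def)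
      also have "\<dots> = x k" using finite_A x(1) by (simp add: B_carrier)
      finally show "x k = finsum B (\<lambda>a k. x a * basis_elem a k) (carrier A) k" by simp
    qed
    \<comment> \<open>The preimage of D is supported on the kernel of \<phi>, so u_r, with r
      orthogonal to the kernel, commutes with it.\<close>
    have x0: "x a = 0" if a: "a \<in> carrier A" "\<phi> a \<noteq> \<one>\<^bsub>\<Gamma>\<^esub>" for a
    proof -
      have "(\<lambda>k. x a * basis_elem a k) = \<zero>\<^bsub>B\<^esub>"
      proof (rule quotient_morphism_components[where ?f = "\<lambda>a k. x a * basis_elem a k"])
        show "is_grading B (A, snd (twisted_grading A))"
          using twisted_is_grading by (simp add: twisted_grading_def)
        show "is_grading (matrix_algebra n) (\<Gamma>, snd (elementary_grading n \<Gamma> s))"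
          using elementary_is_grading[OF \<Gamma> s] by (simp add: elementary_grading_def)
        show "quotient_morphism B (A, snd (twisted_grading A)) (matrix_algebra n)
            (\<Gamma>, snd (elementary_grading n \<Gamma> s)) \<psi> \<phi>"
          using q by (simp add: twisted_grading_def elementary_grading_def)
        show "\<psi> (finsum B (\<lambda>a k. x a * basis_elem a k) (carrier A)) \<in> snd (elementary_grading n \<Gamma> s) \<one>\<^bsub>\<Gamma>\<^esub>"
          using D1 x(2) xsum by simp
      qed (use finite_A a in \<open>auto simp: twisted_grading_def\<close>)
      then have "x a * basis_elem a a = \<zero>\<^bsub>B\<^esub> a" by (rule fun_cong)
      then show ?thesis by (simp add: basis_elem_def B_simps)
    qed
    have comm: "basis_elem r \<otimes>\<^bsub>B\<^esub> x = x \<otimes>\<^bsub>B\<^esub> basis_elem r"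
    proof
      fix k
      show "(basis_elem r \<otimes>\<^bsub>B\<^esub> x) k = (x \<otimes>\<^bsub>B\<^esub> basis_elem r) k"
      proof (cases "k \<in> carrier A")
        case True
        have m: "inv r \<otimes> k \<in> carrier A" using rA True by simp
        have "\<alpha> r (inv r \<otimes> k) * x (inv r \<otimes> k) = \<alpha> (inv r \<otimes> k) r * x (inv r \<otimes> k)"
        proof (cases "\<phi> (inv r \<otimes> k) = \<one>\<^bsub>\<Gamma>\<^esub>")
          case True
          then have "\<omega> r (inv r \<otimes> k) = 1" using r m unfolding perp_def kernel_def by blast
          then show ?thesis unfolding \<omega>_def using cocycle_nonzero[OF m rA] by simp
        next
          case False
          then show ?thesis using x0[OF m] by simp
        qed
        then show ?thesis unfolding basis_mult_left[OF rA True] basis_mult_right[OF rA True] .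
      qed (simp add: B_mult_outside)
    qed
    have "U * D = D * U"
      using \<psi>'(2)[OF basis_elem_B[OF rA] x(1)] \<psi>'(2)[OF x(1) basis_elem_B[OF rA]] comm x(2)
      unfolding U_def by simp
    \<comment> \<open>Right multiplication by D keeps column p and left multiplication keeps row p.
      At (i,p) with i different from p, the first leaves the entry of U and the second leaves
      0.\<close>
    then have "(U * D) $$ (i, p) = (D * U) $$ (i, p)" by simp
    moreover have "(U * D) $$ (i, p) = (\<Sum>k<n. if k = p then U $$ (i, p) else 0)"
      unfolding index_mult_square_mat[OF U D ip(1,2)] using ip by (intro sum.cong) (auto simp: D_def)
    moreover have "(D * U) $$ (i, p) = 0"
      unfolding index_mult_square_mat[OF D U ip(1,2)] using ip by (intro sum.neutral) (auto simp: D_def)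
    ultimately show ?thesis using ip by simp
  qed
  have "U \<noteq> 0\<^sub>m n n"
  proof
    assume "U = 0\<^sub>m n n"
    moreover have "\<psi> \<zero>\<^bsub>B\<^esub> = 0\<^sub>m n n"
      using algebra_iso_zero[OF complex_algebra_B complex_algebra_matrix \<psi>] by (simp add: module_mat_simps)
    ultimately have "\<psi> (basis_elem r) = \<psi> \<zero>\<^bsub>B\<^esub>" unfolding U_def by simp
    then have "basis_elem r = \<zero>\<^bsub>B\<^esub>"
      using inj_onD[OF bij_betw_imp_inj_on[OF \<psi>'(6)]] basis_elem_B[OF rA] B.zero_closed by blast
    then have "basis_elem r r = \<zero>\<^bsub>B\<^esub> r" by (rule fun_cong)
    then show False by (simp add: basis_elem_def B_simps)
  qed
  then obtain i j where ij: "i < n" "j < n" "U $$ (i, j) \<noteq> 0"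
    using U eq_matI[of U "0\<^sub>m n n"] by auto
  then have "i = j" using offdiag by blast
  have "basis_elem r \<in> snd (twisted_grading A) r"
    unfolding twisted_grading_def by (auto intro!: exI[of _ 1])
  then have "U \<in> snd (elementary_grading n \<Gamma> s) (\<phi> r)" using V[OF rA] unfolding U_def by blast
  then have "s i \<otimes>\<^bsub>\<Gamma>\<^esub> inv\<^bsub>\<Gamma>\<^esub> (s j) = \<phi> r" using ij unfolding elementary_grading_def by simp
  then have "\<phi> r = \<one>\<^bsub>\<Gamma>\<^esub>" using \<open>i = j\<close> sc[OF ij(1)] by simp
  then show "r \<in> kernel A \<Gamma> \<phi>" unfolding kernel_def using rA by simp
qed

section \<open>Classes of elementary quotients\<close>

abbreviation "M \<equiv> matrix_algebra n"
abbreviation "T \<equiv> twisted_grading A"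
abbreviation "EQ \<equiv> elementary_quotient_classes n A \<alpha>"

lemma lagrangian_quotient_group:
  assumes L: "lagrangian L"
  obtains \<Gamma> :: "nat monoid" and \<phi> where "group \<Gamma>" "\<phi> \<in> hom A \<Gamma>" "\<phi> ` carrier A = carrier \<Gamma>"
    "\<And>a. a \<in> carrier A \<Longrightarrow> \<phi> a = \<one>\<^bsub>\<Gamma>\<^esub> \<longleftrightarrow> a \<in> L" "card (carrier \<Gamma>) = n"
proof -
  have Lsub: "subgroup L A" using L unfolding lagrangian_def by simp
  have nL: "L \<lhd> A" using Lsub by (rule subgroup_imp_normal)
  interpret Q: group "A Mod L" using nL by (rule normal.factorgroup_is_group)
  have "finite (carrier (A Mod L))" using finite_A by (simp add: FactGroup_def RCOSETS_def)
  then obtain \<Gamma> :: "nat monoid" and \<theta> where \<Gamma>: "group \<Gamma>" and \<theta>: "\<theta> \<in> iso (A Mod L) \<Gamma>"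
    using finite_group_iso_nat[OF Q.is_group] by blast
  interpret \<Gamma>: group \<Gamma> by fact
  have bij: "bij_betw \<theta> (carrier (A Mod L)) (carrier \<Gamma>)" and hom: "\<theta> \<in> hom (A Mod L) \<Gamma>"
    using \<theta> by (auto simp: iso_def)
  have \<theta>1: "\<theta> \<one>\<^bsub>A Mod L\<^esub> = \<one>\<^bsub>\<Gamma>\<^esub>" using hom Q.is_group \<Gamma> by (rule hom_one)
  have carQ: "carrier (A Mod L) = (\<lambda>a. L #> a) ` carrier A"
    by (auto simp: FactGroup_def RCOSETS_def)
  define \<phi> where "\<phi> = \<theta> \<circ> (\<lambda>a. L #> a)"
  have "\<phi> \<in> hom A \<Gamma>"
    unfolding \<phi>_def using normal.r_coset_hom_Mod[OF nL] hom by (rule Group.hom_compose)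
  moreover have "\<phi> ` carrier A = carrier \<Gamma>"
    using bij unfolding \<phi>_def bij_betw_def carQ by (simp add: image_image)
  moreover have "\<phi> a = \<one>\<^bsub>\<Gamma>\<^esub> \<longleftrightarrow> a \<in> L" if a: "a \<in> carrier A" for a
  proof -
    have "\<phi> a = \<one>\<^bsub>\<Gamma>\<^esub> \<longleftrightarrow> \<theta> (L #> a) = \<theta> \<one>\<^bsub>A Mod L\<^esub>" unfolding \<phi>_def \<theta>1 by simp
    also have "\<dots> \<longleftrightarrow> L #> a = \<one>\<^bsub>A Mod L\<^esub>"
      using bij_betw_imp_inj_on[OF bij] a Q.one_closed by (intro inj_on_eq_iff) (auto simp: carQ)
    also have "\<dots> \<longleftrightarrow> L #> a = L" by (simp add: FactGroup_def)
    also have "\<dots> \<longleftrightarrow> a \<in> L"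
      using coset_join1[OF _ a Lsub] coset_join2[OF a Lsub] by blast
    finally show ?thesis .
  qed
  moreover have "card (carrier \<Gamma>) = n"
  proof -
    have "card (rcosets L) * card L = n\<^sup>2" using lagrange[OF Lsub] order_A by simp
    then have "card (rcosets L) = n"
      using card_lagrangian_eq[OF L] n_pos by (simp add: power2_eq_square)
    then show ?thesis using bij_betw_same_card[OF bij] by (simp add: FactGroup_def)
  qed
  ultimately show ?thesis using that \<Gamma> by blast
qed

lemma lagrangian_crossed_product:
  assumes L: "lagrangian L"
  obtains \<Gamma> :: "nat monoid" and s \<psi> \<phi> where "group \<Gamma>" "bij_betw s {..<n} (carrier \<Gamma>)"
    "quotient_morphism B T M (elementary_grading n \<Gamma> s) \<psi> \<phi>"
    "\<And>a. a \<in> carrier A \<Longrightarrow> \<phi> a = \<one>\<^bsub>\<Gamma>\<^esub> \<longleftrightarrow> a \<in> L"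
proof -
  obtain \<Gamma> :: "nat monoid" and \<phi> where \<Gamma>: "group \<Gamma>" "\<phi> \<in> hom A \<Gamma>" "\<phi> ` carrier A = carrier \<Gamma>"
    and ker: "\<And>a. a \<in> carrier A \<Longrightarrow> \<phi> a = \<one>\<^bsub>\<Gamma>\<^esub> \<longleftrightarrow> a \<in> L" and card: "card (carrier \<Gamma>) = n"
    using lagrangian_quotient_group[OF L] by blast
  have "finite (carrier \<Gamma>)" using \<Gamma>(3) finite_A finite_imageI by metis
  then obtain s where s: "bij_betw s {..<n} (carrier \<Gamma>)"
    using ex_bij_betw_nat_finite[of "carrier \<Gamma>"] card by (auto simp: atLeast0LessThan)
  obtain \<psi> where "quotient_morphism B T M (elementary_grading n \<Gamma> s) \<psi> \<phi>"
    using lagrangian_quotient_elementary[OF L \<Gamma> ker s] by blast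
  then show ?thesis using that \<Gamma>(1) s ker by blast
qed

text \<open>Each degree is \<phi>(a) for some a, and its component contains the non-zero image of
  u_a; so the support is the whole group.\<close>

lemma quotient_connected:
  assumes G: "is_grading M (\<Gamma>, V)" and q: "quotient_morphism B T M (\<Gamma>, V) \<psi> \<phi>"
  shows "connected_grading M (\<Gamma>, V)"
proof -
  interpret \<Gamma>: group \<Gamma> using is_gradingD(2)[OF G] .
  interpret B: complex_algebra B by (rule complex_algebra_B)
  have \<psi>: "\<psi> \<in> algebra_iso B M" and surj: "\<phi> ` carrier A = carrier \<Gamma>"
    and V: "\<And>g. g \<in> carrier A \<Longrightarrow> \<psi> ` snd T g \<subseteq> V (\<phi> g)"
    using q unfolding quotient_morphism_def fst_gradings fst_conv snd_conv by blast+
  have \<psi>0: "\<psi> \<zero>\<^bsub>B\<^esub> = \<zero>\<^bsub>M\<^esub>"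
    by (rule algebra_iso_zero[OF complex_algebra_B complex_algebra_matrix \<psi>])
  have "V \<gamma> \<noteq> {\<zero>\<^bsub>M\<^esub>}" if \<gamma>: "\<gamma> \<in> carrier \<Gamma>" for \<gamma>
  proof -
    obtain a where a: "a \<in> carrier A" "\<gamma> = \<phi> a" using surj \<gamma> by blast
    have "basis_elem a \<in> snd T a" unfolding twisted_grading_def by (auto intro!: exI[of _ 1])
    then have mem: "\<psi> (basis_elem a) \<in> V \<gamma>" using V[OF a(1)] a(2) by blast
    have "basis_elem a a \<noteq> \<zero>\<^bsub>B\<^esub> a" by (simp add: basis_elem_def B_simps)
    then have "basis_elem a \<noteq> \<zero>\<^bsub>B\<^esub>" by metis
    then have "\<psi> (basis_elem a) \<noteq> \<psi> \<zero>\<^bsub>B\<^esub>"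
      using inj_onD[OF bij_betw_imp_inj_on[OF algebra_isoD(6)[OF \<psi>]]] basis_elem_B[OF a(1)] B.zero_closed
      by blast
    then show ?thesis using mem \<psi>0 by auto
  qed
  then have "{\<gamma> \<in> carrier \<Gamma>. V \<gamma> \<noteq> {\<zero>\<^bsub>M\<^esub>}} = carrier \<Gamma>" by blast
  moreover have "generate \<Gamma> (carrier \<Gamma>) = carrier \<Gamma>"
    using \<Gamma>.generate_incl[of "carrier \<Gamma>"] generate.incl[of _ "carrier \<Gamma>" \<Gamma>] by blast
  ultimately show ?thesis unfolding connected_grading_def using G by simp
qed

text \<open>\<open>class_le\<close> speaks of members of classes, so the class of \<open>T\<close>
  among gradings of the matrix algebra must be seen to be non-empty. The grading is carried over by
  \<psi> and its group renamed by natural numbers.\<close>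

lemma twisted_class_representative:
  assumes \<psi>: "\<psi> \<in> algebra_iso B M"
  obtains \<Gamma> :: "nat monoid" and V where "(\<Gamma>, V) \<in> grading_class M B T"
proof -
  interpret B: complex_algebra B by (rule complex_algebra_B)
  note \<psi>' = algebra_isoD[OF \<psi>]
  obtain \<Gamma> :: "nat monoid" and \<theta> where \<Gamma>: "group \<Gamma>" and \<theta>: "\<theta> \<in> iso A \<Gamma>"
    using finite_group_iso_nat[OF is_group finite_A] by blast
  have \<theta>bij: "bij_betw \<theta> (carrier A) (carrier \<Gamma>)" and \<theta>hom: "\<theta> \<in> hom A \<Gamma>"
    using \<theta> by (auto simp: iso_def)
  define \<chi> where "\<chi> = inv_into (carrier B) \<psi>"
  have \<chi>: "\<chi> \<in> algebra_iso M B" unfolding \<chi>_def by (rule algebra_iso_inv[OF complex_algebra_B \<psi>])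
  note \<chi>' = algebra_isoD[OF \<chi>]
  have \<chi>\<psi>: "\<chi> (\<psi> x) = x" if "x \<in> carrier B" for x
    unfolding \<chi>_def using bij_betw_inv_into_left[OF \<psi>'(6) that] .
  have \<psi>\<chi>: "\<psi> (\<chi> X) = X" if "X \<in> carrier M" for X
    unfolding \<chi>_def using bij_betw_inv_into_right[OF \<psi>'(6) that] .
  \<comment> \<open>The coordinates of X are those with respect to the basis of the images
    \<psi>(u_a).\<close>
  define V where "V \<gamma> = {X \<in> carrier M. \<forall>a\<in>carrier A. \<chi> X a \<noteq> 0 \<longrightarrow> \<theta> a = \<gamma>}" for \<gamma>
  have G: "is_grading M (\<Gamma>, V)"
  proof (rule coordinate_grading[where I = "carrier A" and c = "\<lambda>a X. \<chi> X a" and d = \<theta>])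
    show "complex_algebra M" by (rule complex_algebra_matrix)
    show "group \<Gamma>" "finite (carrier A)" by (rule \<Gamma>, rule finite_A)
    show "\<theta> \<in> carrier A \<rightarrow> carrier \<Gamma>" using \<theta>bij by (auto dest: bij_betwE)
    fix X Y assume X: "X \<in> carrier M" and Y: "Y \<in> carrier M"
    show "\<chi> (X \<oplus>\<^bsub>M\<^esub> Y) i = \<chi> X i + \<chi> Y i" for i
      using \<chi>'(3)[OF X Y] by (simp add: B_simps)
    assume eq: "\<And>i. i \<in> carrier A \<Longrightarrow> \<chi> X i = \<chi> Y i"
    have "\<chi> X = \<chi> Y"
    proof
      fix i show "\<chi> X i = \<chi> Y i"
        using eq \<chi>'(1)[OF X] \<chi>'(1)[OF Y] unfolding B_carrier by (cases "i \<in> carrier A") auto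
    qed
    then show "X = Y" using \<psi>\<chi>[OF X] \<psi>\<chi>[OF Y] by metis
  next
    fix X i k assume "X \<in> carrier M"
    then show "\<chi> (k \<odot>\<^bsub>M\<^esub> X) i = k * \<chi> X i" using \<chi>'(5)[of X k] by (simp add: B_simps)
  next
    fix v :: "'a \<Rightarrow> complex"
    define x where "x = (\<lambda>g. if g \<in> carrier A then v g else 0)"
    have x: "x \<in> carrier B" by (simp add: B_carrier x_def)
    show "\<exists>X\<in>carrier M. \<forall>i\<in>carrier A. \<chi> X i = v i"
      by (rule bexI[of _ "\<psi> x"]) (use \<psi>'(1)[OF x] \<chi>\<psi>[OF x] in \<open>auto simp: x_def\<close>)
  next
    fix \<gamma> show "V \<gamma> = {X \<in> carrier M. \<forall>a\<in>carrier A. \<chi> X a \<noteq> 0 \<longrightarrow> \<theta> a = \<gamma>}" by (rule V_def)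
  next
    fix \<gamma> \<delta> X Y assume X: "X \<in> V \<gamma>" and Y: "Y \<in> V \<delta>"
    have XM: "X \<in> carrier M" "Y \<in> carrier M" using X Y unfolding V_def by auto
    have "\<theta> k = \<gamma> \<otimes>\<^bsub>\<Gamma>\<^esub> \<delta>" if k: "k \<in> carrier A" and nonz: "\<chi> (X \<otimes>\<^bsub>M\<^esub> Y) k \<noteq> 0" for k
    proof -
      have "(\<Sum>g\<in>carrier A. \<alpha> g (inv g \<otimes> k) * (\<chi> X g * \<chi> Y (inv g \<otimes> k))) \<noteq> 0"
        using nonz unfolding \<chi>'(2)[OF XM] B_mult[OF k] .
      then obtain g where g: "g \<in> carrier A" and "\<alpha> g (inv g \<otimes> k) * (\<chi> X g * \<chi> Y (inv g \<otimes> k)) \<noteq> 0"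
        by (rule sum.not_neutral_contains_not_neutral)
      then have "\<chi> X g \<noteq> 0" "\<chi> Y (inv g \<otimes> k) \<noteq> 0" by auto
      then have "\<theta> g = \<gamma>" "\<theta> (inv g \<otimes> k) = \<delta>" using X Y g k unfolding V_def by auto
      moreover have "\<theta> k = \<theta> g \<otimes>\<^bsub>\<Gamma>\<^esub> \<theta> (inv g \<otimes> k)"
        using hom_mult[OF \<theta>hom, of g "inv g \<otimes> k"] g k by (simp add: mult_inv_cancel)
      ultimately show ?thesis by simp
    qed
    moreover have "X \<otimes>\<^bsub>M\<^esub> Y \<in> carrier M" using XM by (simp add: module_mat_simps)
    ultimately show "X \<otimes>\<^bsub>M\<^esub> Y \<in> V (\<gamma> \<otimes>\<^bsub>\<Gamma>\<^esub> \<delta>)" unfolding V_def by blast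
  qed
  have q: "quotient_morphism B T M (\<Gamma>, V) \<psi> \<theta>"
    unfolding quotient_morphism_def fst_gradings fst_conv snd_conv
  proof (intro conjI ballI subsetI)
    show "\<psi> \<in> algebra_iso B M" "\<theta> \<in> hom A \<Gamma>" by (rule \<psi>, rule \<theta>hom)
    show "\<theta> ` carrier A = carrier \<Gamma>" using \<theta>bij by (simp add: bij_betw_def)
    fix g X assume g: "g \<in> carrier A" and "X \<in> \<psi> ` snd T g"
    then obtain c where X: "X = \<psi> (\<lambda>k. c * basis_elem g k)" by (auto simp: twisted_grading_def)
    have mem: "(\<lambda>k. c * basis_elem g k) \<in> carrier B" using g by (auto simp: B_carrier basis_elem_def)
    then show "X \<in> V (\<theta> g)" unfolding V_def X
      using \<psi>'(1)[OF mem] \<chi>\<psi>[OF mem] by (auto simp: basis_elem_def split: if_splits)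
  qed
  have "graded_equivalent B T M (\<Gamma>, V)"
    unfolding graded_equivalent_def fst_gradings fst_conv using q \<theta> by blast
  then show ?thesis
    using that[of \<Gamma> V] quotient_connected[OF G q] unfolding grading_class_def connected_gradings_def by simp
qed

section \<open>Membership in \<open>EQ\<close> in terms of quotient morphisms out of
  \<open>T\<close>\<close>

lemma twisted_equivalent_sym:
  assumes "is_grading M (\<Gamma>, V)" "graded_equivalent B T M (\<Gamma>, V)"
  shows "graded_equivalent M (\<Gamma>, V) B T"
  using graded_equivalent_sym[of B A "snd T" M \<Gamma> V] twisted_is_grading finite_A assms
  by (simp add: grading_pair(2)[symmetric])

lemma elementary_connected:
  assumes "group \<Gamma>" "s \<in> {..<n} \<rightarrow> carrier \<Gamma>"
    and "quotient_morphism B T M (elementary_grading n \<Gamma> s) \<psi> \<phi>"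
  shows "elementary_grading n \<Gamma> s \<in> connected_gradings M"
  using quotient_connected[of \<Gamma> "snd (elementary_grading n \<Gamma> s)"] elementary_is_grading[OF assms(1,2)] assms(3)
  by (simp add: grading_pair(1)[symmetric] connected_gradings_def)

text \<open>With its converse below, this trades an order relation between classes for a quotient
  morphism that starts at \<open>T\<close>, where kernels are subgroups of A and can be
  compared.\<close>

lemma quotient_classI:
  fixes \<Gamma> :: "nat monoid"
  assumes \<Gamma>: "group \<Gamma>" and s: "s \<in> {..<n} \<rightarrow> carrier \<Gamma>"
    and q: "quotient_morphism B T M (elementary_grading n \<Gamma> s) \<psi> \<phi>"
  shows "grading_class M M (elementary_grading n \<Gamma> s) \<in> EQ"
proof -
  let ?e = "elementary_grading n \<Gamma> s"
  have con: "?e \<in> connected_gradings M" by (rule elementary_connected[OF assms])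
  have "\<psi> \<in> algebra_iso B M" using q unfolding quotient_morphism_def by blast
  then obtain \<Delta> :: "nat monoid" and V where rep: "(\<Delta>, V) \<in> grading_class M B T"
    using twisted_class_representative by blast
  then have "is_grading M (\<Delta>, V)" "graded_equivalent B T M (\<Delta>, V)"
    unfolding grading_class_def connected_gradings_def connected_grading_def by auto
  then obtain \<psi>' \<phi>' where "quotient_morphism M (\<Delta>, V) B T \<psi>' \<phi>'"
    using twisted_equivalent_sym unfolding graded_equivalent_def by blast
  then have "quotient_morphism M (\<Delta>, V) M ?e (\<psi> \<circ> \<psi>') (\<phi> \<circ> \<phi>')" using q by (rule quotient_morphism_comp)
  then have "class_le M (grading_class M M ?e) (grading_class M B T)"
    unfolding class_le_def using rep grading_class_self[OF con] by blast
  then show ?thesis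
    unfolding elementary_quotient_classes_def elementary_class_def
    using grading_class_in_Grad[OF con] \<Gamma> s by blast
qed

lemma quotient_classD:
  fixes \<Gamma> :: "nat monoid"
  assumes X: "grading_class M M (elementary_grading n \<Gamma> s) \<in> EQ"
    and \<Gamma>: "group \<Gamma>" and s: "s \<in> {..<n} \<rightarrow> carrier \<Gamma>"
  obtains \<psi> \<phi> where "quotient_morphism B T M (elementary_grading n \<Gamma> s) \<psi> \<phi>"
proof -
  let ?e = "elementary_grading n \<Gamma> s"
  obtain \<G>\<^sub>1 \<G>\<^sub>2 \<psi> \<phi> where G1: "\<G>\<^sub>1 \<in> grading_class M B T" and G2: "\<G>\<^sub>2 \<in> grading_class M M ?e"
    and q: "quotient_morphism M \<G>\<^sub>1 M \<G>\<^sub>2 \<psi> \<phi>"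
    using X unfolding elementary_quotient_classes_def class_le_def by blast
  obtain \<psi>1 \<phi>1 where "quotient_morphism B T M \<G>\<^sub>1 \<psi>1 \<phi>1"
    using G1 unfolding grading_class_def graded_equivalent_def by blast
  then have q2: "quotient_morphism B T M \<G>\<^sub>2 (\<psi> \<circ> \<psi>1) (\<phi> \<circ> \<phi>1)" using q by (rule quotient_morphism_comp)
  obtain \<psi>2 \<phi>2 where e2: "quotient_morphism M ?e M \<G>\<^sub>2 \<psi>2 \<phi>2" "\<phi>2 \<in> iso \<Gamma> (fst \<G>\<^sub>2)"
    using G2 unfolding grading_class_def graded_equivalent_def fst_gradings by blast
  \<comment> \<open>Inverting an equivalence requires a finite grading group; finiteness of \<Gamma>
    is inherited from A through the surjection onto the group of the intermediate grading.\<close>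
  have "(\<phi> \<circ> \<phi>1) ` carrier A = carrier (fst \<G>\<^sub>2)"
    using q2 unfolding quotient_morphism_def fst_gradings by blast
  then have "finite (carrier (fst \<G>\<^sub>2))" using finite_A finite_imageI by metis
  then have fin: "finite (carrier \<Gamma>)" using e2(2) by (auto simp: iso_def dest: bij_betw_finite)
  have "graded_equivalent M \<G>\<^sub>2 M ?e"
    using graded_equivalent_sym[of M \<Gamma> "snd ?e" M "fst \<G>\<^sub>2" "snd \<G>\<^sub>2"] elementary_is_grading[OF \<Gamma> s] fin G2
    unfolding grading_class_def connected_gradings_def connected_grading_def
    by (auto simp: grading_pair(1)[symmetric])
  then obtain \<psi>3 \<phi>3 where "quotient_morphism M \<G>\<^sub>2 M ?e \<psi>3 \<phi>3" unfolding graded_equivalent_def by blast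
  then show ?thesis using that quotient_morphism_comp[OF q2] by blast
qed

section \<open>Comparison of elementary quotients and maximal classes\<close>

lemma quotient_finite:
  assumes "quotient_morphism B T N \<H> \<psi> \<phi>" shows "finite (carrier (fst \<H>))"
  using assms finite_A unfolding quotient_morphism_def fst_gradings by (metis finite_imageI)

text \<open>Inclusion of kernels reverses the order: the quotient with the smaller kernel maps onto
  the other one.\<close>

lemma elementary_quotient_factor:
  assumes \<Gamma>: "group \<Gamma>" "s \<in> {..<n} \<rightarrow> carrier \<Gamma>" and \<Delta>: "group \<Delta>" "t \<in> {..<n} \<rightarrow> carrier \<Delta>"
    and q: "quotient_morphism B T M (elementary_grading n \<Gamma> s) \<psi> \<phi>"
    and q': "quotient_morphism B T M (elementary_grading n \<Delta> t) \<psi>' \<phi>'"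
    and ker: "\<And>a. a \<in> carrier A \<Longrightarrow> \<phi> a = \<one>\<^bsub>\<Gamma>\<^esub> \<Longrightarrow> \<phi>' a = \<one>\<^bsub>\<Delta>\<^esub>"
  obtains \<chi> \<theta> where "quotient_morphism M (elementary_grading n \<Gamma> s) M (elementary_grading n \<Delta> t) \<chi> \<theta>"
proof -
  interpret \<phi>: group_hom A \<Gamma> \<phi>
    using q is_group \<Gamma>(1) unfolding quotient_morphism_def fst_gradings
    by (simp add: group_hom_def group_hom_axioms_def)
  interpret \<phi>': group_hom A \<Delta> \<phi>'
    using q' is_group \<Delta>(1) unfolding quotient_morphism_def fst_gradings
    by (simp add: group_hom_def group_hom_axioms_def)
  have ker': "\<phi>' a = \<phi>' b" if ab: "a \<in> carrier A" "b \<in> carrier A" "\<phi> a = \<phi> b" for a b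
  proof -
    have "\<phi> (a \<otimes> inv b) = \<one>\<^bsub>\<Gamma>\<^esub>" using ab by simp
    then have "\<phi>' (a \<otimes> inv b) = \<one>\<^bsub>\<Delta>\<^esub>" using ker ab by simp
    then show ?thesis using ab \<phi>'.H.inv_solve_right'[of "\<one>\<^bsub>\<Delta>\<^esub>" "\<phi>' a" "\<phi>' b"] by simp
  qed
  obtain \<chi> \<theta> where "quotient_morphism M (\<Gamma>, snd (elementary_grading n \<Gamma> s)) M
      (\<Delta>, snd (elementary_grading n \<Delta> t)) \<chi> \<theta>"
  proof (rule quotient_morphism_factor[of B A "snd T"])
    show "is_grading B (A, snd T)" by (simp add: grading_pair(2)[symmetric] twisted_is_grading)
    show "is_grading M (\<Gamma>, snd (elementary_grading n \<Gamma> s))"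
      "is_grading M (\<Delta>, snd (elementary_grading n \<Delta> t))"
      using elementary_is_grading[OF \<Gamma>] elementary_is_grading[OF \<Delta>]
      by (simp_all add: grading_pair(1)[symmetric])
    show "quotient_morphism B (A, snd T) M (\<Gamma>, snd (elementary_grading n \<Gamma> s)) \<psi> \<phi>"
      "quotient_morphism B (A, snd T) M (\<Delta>, snd (elementary_grading n \<Delta> t)) \<psi>' \<phi>'"
      using q q' by (simp_all add: grading_pair[symmetric])
    show "finite (carrier A)" by (rule finite_A)
  qed (use ker' in blast)+
  then show ?thesis using that by (simp add: grading_pair(1)[symmetric])
qed

text \<open>Shrinking the kernel to a Lagrangian. It serves twice: it bounds the order of every
  elementary quotient group by n, and it puts a crossed product class above every class of
  \<open>EQ\<close>.\<close>

lemma elementary_quotient_below_crossed_product: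
  assumes \<Gamma>: "group \<Gamma>" "s \<in> {..<n} \<rightarrow> carrier \<Gamma>"
    and q: "quotient_morphism B T M (elementary_grading n \<Gamma> s) \<psi> \<phi>"
  obtains \<Delta> :: "nat monoid" and t \<psi>' \<phi>' \<chi> \<theta> where "group \<Delta>" "bij_betw t {..<n} (carrier \<Delta>)"
    "quotient_morphism B T M (elementary_grading n \<Delta> t) \<psi>' \<phi>'"
    "quotient_morphism M (elementary_grading n \<Delta> t) M (elementary_grading n \<Gamma> s) \<chi> \<theta>"
proof -
  interpret \<phi>: group_hom A \<Gamma> \<phi>
    using q is_group \<Gamma>(1) unfolding quotient_morphism_def fst_gradings
    by (simp add: group_hom_def group_hom_axioms_def)
  obtain L where L: "lagrangian L" "L \<subseteq> kernel A \<Gamma> \<phi>"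
    using lagrangian_below[OF \<phi>.subgroup_kernel elementary_quotient_kernel_coisotropic[OF \<Gamma> q]] by blast
  obtain \<Delta> :: "nat monoid" and t \<psi>' \<phi>' where \<Delta>: "group \<Delta>" "bij_betw t {..<n} (carrier \<Delta>)"
    and q': "quotient_morphism B T M (elementary_grading n \<Delta> t) \<psi>' \<phi>'"
    and ker: "\<And>a. a \<in> carrier A \<Longrightarrow> \<phi>' a = \<one>\<^bsub>\<Delta>\<^esub> \<longleftrightarrow> a \<in> L"
    using lagrangian_crossed_product[OF L(1)] by blast
  have t: "t \<in> {..<n} \<rightarrow> carrier \<Delta>" using bij_betwE[OF \<Delta>(2)] by blast
  have "\<phi> a = \<one>\<^bsub>\<Gamma>\<^esub>" if "a \<in> carrier A" "\<phi>' a = \<one>\<^bsub>\<Delta>\<^esub>" for a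
    using L(2) ker that unfolding kernel_def by blast
  then obtain \<chi> \<theta> where "quotient_morphism M (elementary_grading n \<Delta> t) M (elementary_grading n \<Gamma> s) \<chi> \<theta>"
    using elementary_quotient_factor[OF \<Delta>(1) t \<Gamma> q' q] by blast
  then show ?thesis using that \<Delta> q' by blast
qed

text \<open>A class Y above X has a group of order at most n, being the image of a crossed product
  group, and this group maps onto that of X, of order n. So the map is bijective and Y = X.\<close>

lemma crossed_product_class_maximal:
  assumes X: "X \<in> EQ" and c: "elementary_crossed_product_class n X"
  shows "maximal_class M EQ X"
  unfolding maximal_class_def
proof (intro conjI ballI impI)
  show "X \<in> EQ" by (rule X)
  obtain \<Gamma> :: "nat monoid" and s where \<Gamma>: "group \<Gamma>" and sb: "bij_betw s {..<n} (carrier \<Gamma>)"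
    and Xe: "X = grading_class M M (elementary_grading n \<Gamma> s)"
    using c unfolding elementary_crossed_product_class_def by blast
  have s: "s \<in> {..<n} \<rightarrow> carrier \<Gamma>" using bij_betwE[OF sb] by blast
  let ?e = "elementary_grading n \<Gamma> s"
  have card\<Gamma>: "card (carrier \<Gamma>) = n" "finite (carrier \<Gamma>)"
    using bij_betw_same_card[OF sb] bij_betw_finite[OF sb] by auto
  fix Y assume Y: "Y \<in> EQ" and le: "class_le M X Y"
  obtain \<Gamma>' :: "nat monoid" and s' where \<Gamma>': "group \<Gamma>'" and s': "s' \<in> {..<n} \<rightarrow> carrier \<Gamma>'"
    and Ye: "Y = grading_class M M (elementary_grading n \<Gamma>' s')"
    using Y unfolding elementary_quotient_classes_def elementary_class_def by blast
  let ?e' = "elementary_grading n \<Gamma>' s'"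
  obtain \<psi>' \<phi>' where q': "quotient_morphism B T M ?e' \<psi>' \<phi>'"
    using quotient_classD[of \<Gamma>' s'] Y \<Gamma>' s' unfolding Ye by blast
  have fin': "finite (carrier \<Gamma>')" using quotient_finite[OF q'] by (simp add: fst_gradings)
  obtain \<Delta> :: "nat monoid" and t \<psi>'' \<phi>'' \<chi> \<theta> where "group \<Delta>"
    and \<Delta>: "bij_betw t {..<n} (carrier \<Delta>)"
    and "quotient_morphism B T M (elementary_grading n \<Delta> t) \<psi>'' \<phi>''"
    and "quotient_morphism M (elementary_grading n \<Delta> t) M ?e' \<chi> \<theta>"
    by (rule elementary_quotient_below_crossed_product[OF \<Gamma>' s' q'])
  then have "\<theta> ` carrier \<Delta> = carrier \<Gamma>'" unfolding quotient_morphism_def fst_gradings by blast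
  then have card\<Gamma>': "card (carrier \<Gamma>') \<le> n"
    using card_image_le[of "carrier \<Delta>" \<theta>] bij_betw_finite[OF \<Delta>] bij_betw_same_card[OF \<Delta>] by simp
  obtain \<G>\<^sub>1 \<G>\<^sub>2 \<psi> \<phi> where G1: "\<G>\<^sub>1 \<in> Y" and G2: "\<G>\<^sub>2 \<in> X" and q: "quotient_morphism M \<G>\<^sub>1 M \<G>\<^sub>2 \<psi> \<phi>"
    using le unfolding class_le_def by blast
  obtain \<psi>1 \<phi>1 where q1: "quotient_morphism M ?e' M \<G>\<^sub>1 \<psi>1 \<phi>1"
    using G1 unfolding Ye grading_class_def graded_equivalent_def by blast
  have "graded_equivalent M \<G>\<^sub>2 M ?e"
    using graded_equivalent_sym[of M \<Gamma> "snd ?e" M "fst \<G>\<^sub>2" "snd \<G>\<^sub>2"] elementary_is_grading[OF \<Gamma> s] card\<Gamma>(2) G2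
    unfolding Xe grading_class_def connected_gradings_def connected_grading_def
    by (auto simp: grading_pair(1)[symmetric])
  then obtain \<psi>2 \<phi>2 where q2: "quotient_morphism M \<G>\<^sub>2 M ?e \<psi>2 \<phi>2" unfolding graded_equivalent_def by blast
  \<comment> \<open>The relation \<open>class_le\<close> holds between some representatives;
    composing with equivalences on both sides yields a morphism between the two elementary gradings
    themselves.\<close>
  define \<eta> where "\<eta> = \<phi>2 \<circ> (\<phi> \<circ> \<phi>1)"
  have qe: "quotient_morphism M ?e' M ?e (\<psi>2 \<circ> (\<psi> \<circ> \<psi>1)) \<eta>"
    unfolding \<eta>_def by (rule quotient_morphism_comp[OF quotient_morphism_comp[OF q1 q] q2])
  then have \<eta>: "\<eta> ` carrier \<Gamma>' = carrier \<Gamma>" "\<eta> \<in> hom \<Gamma>' \<Gamma>"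
    unfolding quotient_morphism_def fst_gradings by blast+
  then have "card (\<eta> ` carrier \<Gamma>') = card (carrier \<Gamma>')"
    using card_image_le[OF fin', of \<eta>] card\<Gamma>' card\<Gamma>(1) by simp
  then have "inj_on \<eta> (carrier \<Gamma>')" by (rule eq_card_imp_inj_on[OF fin'])
  then have "\<eta> \<in> iso \<Gamma>' \<Gamma>" using \<eta> by (simp add: iso_def bij_betw_def)
  then have "graded_equivalent M ?e' M ?e" unfolding graded_equivalent_def fst_gradings using qe by blast
  then show "Y = X"
    using grading_class_eq[of M \<Gamma>' "snd ?e'" M \<Gamma> "snd ?e" M] fin' elementary_is_grading[OF \<Gamma> s]
      elementary_is_grading[OF \<Gamma>' s'] unfolding grading_pair(1)[symmetric] Xe Ye by blast
qed

lemma crossed_product_quotient_class: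
  fixes \<Gamma> :: "nat monoid"
  assumes \<Gamma>: "group \<Gamma>" "bij_betw s {..<n} (carrier \<Gamma>)"
    and q: "quotient_morphism B T M (elementary_grading n \<Gamma> s) \<psi> \<phi>"
  shows "grading_class M M (elementary_grading n \<Gamma> s) \<in> EQ"
    "elementary_crossed_product_class n (grading_class M M (elementary_grading n \<Gamma> s))"
    "maximal_class M EQ (grading_class M M (elementary_grading n \<Gamma> s))"
proof -
  have s: "s \<in> {..<n} \<rightarrow> carrier \<Gamma>" using bij_betwE[OF \<Gamma>(2)] by blast
  show 1: "grading_class M M (elementary_grading n \<Gamma> s) \<in> EQ" by (rule quotient_classI[OF \<Gamma>(1) s q])
  show 2: "elementary_crossed_product_class n (grading_class M M (elementary_grading n \<Gamma> s))"
    unfolding elementary_crossed_product_class_def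
    using grading_class_in_Grad[OF elementary_connected[OF \<Gamma>(1) s q]] \<Gamma> by blast
  show "maximal_class M EQ (grading_class M M (elementary_grading n \<Gamma> s))"
    by (rule crossed_product_class_maximal[OF 1 2])
qed

lemma maximal_class_crossed_product:
  assumes max: "maximal_class M EQ X"
  shows "elementary_crossed_product_class n X"
proof -
  have X: "X \<in> EQ" using max unfolding maximal_class_def by blast
  obtain \<Gamma> :: "nat monoid" and s where \<Gamma>: "group \<Gamma>" and s: "s \<in> {..<n} \<rightarrow> carrier \<Gamma>"
    and Xe: "X = grading_class M M (elementary_grading n \<Gamma> s)"
    using X unfolding elementary_quotient_classes_def elementary_class_def by blast
  obtain \<psi> \<phi> where q: "quotient_morphism B T M (elementary_grading n \<Gamma> s) \<psi> \<phi>"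
    using quotient_classD[of \<Gamma> s] X \<Gamma> s unfolding Xe by blast
  obtain \<Delta> :: "nat monoid" and t \<psi>' \<phi>' \<chi> \<theta> where \<Delta>: "group \<Delta>" "bij_betw t {..<n} (carrier \<Delta>)"
    and q': "quotient_morphism B T M (elementary_grading n \<Delta> t) \<psi>' \<phi>'"
    and qe: "quotient_morphism M (elementary_grading n \<Delta> t) M (elementary_grading n \<Gamma> s) \<chi> \<theta>"
    using elementary_quotient_below_crossed_product[OF \<Gamma> s q] by blast
  let ?Y = "grading_class M M (elementary_grading n \<Delta> t)"
  have t: "t \<in> {..<n} \<rightarrow> carrier \<Delta>" using bij_betwE[OF \<Delta>(2)] by blast
  have "class_le M X ?Y"
    unfolding class_le_def Xe
    using grading_class_self[OF elementary_connected[OF \<Gamma> s q]]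
      grading_class_self[OF elementary_connected[OF \<Delta>(1) t q']] qe by blast
  then have "?Y = X"
    using max crossed_product_quotient_class(1)[OF \<Delta> q'] unfolding maximal_class_def by blast
  then show ?thesis using crossed_product_quotient_class(2)[OF \<Delta> q'] by simp
qed

section \<open>Existence and uniqueness of the maximal class\<close>

lemma crossed_product_classE:
  assumes "maximal_class M EQ X"
  obtains \<Gamma> :: "nat monoid" and s \<psi> \<phi> where "group \<Gamma>" "bij_betw s {..<n} (carrier \<Gamma>)"
    "X = grading_class M M (elementary_grading n \<Gamma> s)"
    "quotient_morphism B T M (elementary_grading n \<Gamma> s) \<psi> \<phi>"
proof -
  obtain \<Gamma> :: "nat monoid" and s where \<Gamma>: "group \<Gamma>" "bij_betw s {..<n} (carrier \<Gamma>)"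
    and X: "X = grading_class M M (elementary_grading n \<Gamma> s)"
    using maximal_class_crossed_product[OF assms] unfolding elementary_crossed_product_class_def by blast
  have s: "s \<in> {..<n} \<rightarrow> carrier \<Gamma>" using bij_betwE[OF \<Gamma>(2)] by blast
  have "X \<in> EQ" using assms unfolding maximal_class_def by blast
  then obtain \<psi> \<phi> where "quotient_morphism B T M (elementary_grading n \<Gamma> s) \<psi> \<phi>"
    using quotient_classD[of \<Gamma> s] \<Gamma>(1) s unfolding X by blast
  then show ?thesis using that \<Gamma> X by blast
qed

lemma squarefree_quotient_group:
  assumes \<Gamma>: "group \<Gamma>" and \<phi>: "\<phi> \<in> hom A \<Gamma>" "\<phi> ` carrier A = carrier \<Gamma>"
    and sf: "\<forall>a\<in>carrier A. squarefree (ord a)"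
  shows "comm_group \<Gamma>" "\<forall>\<gamma>\<in>carrier \<Gamma>. squarefree (group.ord \<Gamma> \<gamma>)"
proof -
  interpret \<phi>: group_hom A \<Gamma> \<phi>
    using \<phi>(1) is_group \<Gamma> by (simp add: group_hom_def group_hom_axioms_def)
  show "comm_group \<Gamma>"
  proof (rule \<phi>.H.group_comm_groupI)
    fix x y assume "x \<in> carrier \<Gamma>" "y \<in> carrier \<Gamma>"
    then obtain a b where "a \<in> carrier A" "b \<in> carrier A" "x = \<phi> a" "y = \<phi> b" using \<phi>(2) by blast
    then show "x \<otimes>\<^bsub>\<Gamma>\<^esub> y = y \<otimes>\<^bsub>\<Gamma>\<^esub> x" by (metis \<phi>.hom_mult m_comm)
  qed
  show "\<forall>\<gamma>\<in>carrier \<Gamma>. squarefree (\<phi>.H.ord \<gamma>)"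
  proof
    fix \<gamma> assume "\<gamma> \<in> carrier \<Gamma>"
    then obtain a where a: "a \<in> carrier A" "\<gamma> = \<phi> a" using \<phi>(2) by blast
    have "\<gamma> [^]\<^bsub>\<Gamma>\<^esub> ord a = \<phi> (a [^] ord a)" unfolding a(2) using a(1) by (simp only: \<phi>.hom_nat_pow)
    then have "\<phi>.H.ord \<gamma> dvd ord a" using a by (simp add: \<phi>.H.pow_eq_id[symmetric])
    then show "squarefree (\<phi>.H.ord \<gamma>)" using sf a(1) squarefree_mono by blast
  qed
qed

lemma maximal_class_unique_if_squarefree:
  assumes sf: "\<forall>a\<in>carrier A. squarefree (ord a)"
    and X: "maximal_class M EQ X" and Y: "maximal_class M EQ Y"
  shows "X = Y"
proof -
  obtain \<Gamma> :: "nat monoid" and s \<psi> \<phi> where \<Gamma>: "group \<Gamma>" "bij_betw s {..<n} (carrier \<Gamma>)"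
    and Xe: "X = grading_class M M (elementary_grading n \<Gamma> s)"
    and q: "quotient_morphism B T M (elementary_grading n \<Gamma> s) \<psi> \<phi>"
    using crossed_product_classE[OF X] by blast
  obtain \<Delta> :: "nat monoid" and t \<psi>' \<phi>' where \<Delta>: "group \<Delta>" "bij_betw t {..<n} (carrier \<Delta>)"
    and Ye: "Y = grading_class M M (elementary_grading n \<Delta> t)"
    and q': "quotient_morphism B T M (elementary_grading n \<Delta> t) \<psi>' \<phi>'"
    using crossed_product_classE[OF Y] by blast
  have hom: "\<phi> \<in> hom A \<Gamma>" "\<phi> ` carrier A = carrier \<Gamma>" "\<phi>' \<in> hom A \<Delta>" "\<phi>' ` carrier A = carrier \<Delta>"
    using q q' unfolding quotient_morphism_def fst_gradings by blast+
  have fin: "finite (carrier \<Gamma>)" "finite (carrier \<Delta>)"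
    using bij_betw_finite[OF \<Gamma>(2)] bij_betw_finite[OF \<Delta>(2)] by auto
  have "Coset.order \<Gamma> = Coset.order \<Delta>"
    using bij_betw_same_card[OF \<Gamma>(2)] bij_betw_same_card[OF \<Delta>(2)] by (simp add: Coset.order_def)
  then obtain \<theta> where "\<theta> \<in> iso \<Gamma> \<Delta>"
    using squarefree_abelian_groups_iso squarefree_quotient_group[OF \<Gamma>(1) hom(1,2) sf]
      squarefree_quotient_group[OF \<Delta>(1) hom(3,4) sf] fin by blast
  then have "graded_equivalent M (elementary_grading n \<Gamma> s) M (elementary_grading n \<Delta> t)"
    using elementary_equivalent[OF \<Gamma>(1) \<Delta>(1) _ \<Gamma>(2) \<Delta>(2)] by blast
  moreover have "s \<in> {..<n} \<rightarrow> carrier \<Gamma>" "t \<in> {..<n} \<rightarrow> carrier \<Delta>"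
    using bij_betwE[OF \<Gamma>(2)] bij_betwE[OF \<Delta>(2)] by blast+
  ultimately show ?thesis
    using grading_class_eq[of M \<Gamma> "snd (elementary_grading n \<Gamma> s)" M \<Delta> "snd (elementary_grading n \<Delta> t)" M]
      fin elementary_is_grading \<Gamma>(1) \<Delta>(1) unfolding grading_pair(1)[symmetric] Xe Ye by blast
qed

text \<open>Let \<open>e\<close> be the exponent of \<open>A\<close>, \<open>q\<^sup>2\<close> a divisor of \<open>e\<close> and \<open>f = e / q\<close>. The \<open>f\<close>-th powers
  form an isotropic subgroup, so some Lagrangian quotient has exponent dividing \<open>f\<close>; the quotient
  by a Lagrangian containing an element \<open>a\<close> with \<open>a\<^sup>f \<noteq> \<one>\<close> does not.\<close>

lemma squarefree_if_maximal_class_unique: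
  assumes uniq: "\<And>X Y. maximal_class M EQ X \<Longrightarrow> maximal_class M EQ Y \<Longrightarrow> X = Y"
    and c: "c \<in> carrier A"
  shows "squarefree (ord c)"
proof (rule ccontr)
  assume "\<not> squarefree (ord c)"
  then obtain q where q: "q ^ 2 dvd ord c" "\<not> q dvd 1" unfolding squarefree_def by blast
  \<comment> \<open>The exponent is used rather than the order of c: it bounds all values of
    \<omega> to e-th roots of unity, and its minimality produces elements not killed by f.\<close>
  define e where "e = (LEAST e::nat. 0 < e \<and> (\<forall>x\<in>carrier A. x [^] e = \<one>))"
  have "0 < Coset.order A \<and> (\<forall>x\<in>carrier A. x [^] Coset.order A = \<one>)"
    using finite_A order_gt_0_iff_finite pow_order_eq_1 by blast
  then have e: "0 < e \<and> (\<forall>x\<in>carrier A. x [^] e = \<one>)" unfolding e_def by (rule LeastI)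
  have least: "\<not> (0 < f \<and> (\<forall>x\<in>carrier A. x [^] f = \<one>))" if "f < e" for f
    using not_less_Least that unfolding e_def by blast
  have "ord c dvd e" using e c pow_eq_id by blast
  then have "q ^ 2 dvd e" using q(1) dvd_trans by blast
  then obtain m where m: "e = q ^ 2 * m" by (rule dvdE)
  define f where "f = q * m"
  have eq: "e = q * f" unfolding m f_def power2_eq_square by simp
  have "1 < q" using q(2) e eq by (cases q) auto
  then have f: "0 < f" "f < e" using e eq by auto
  \<comment> \<open>Here the square divisor matters: e divides f^2, hence \<omega>(x^f, y^f) =
    \<omega>(x,y)^(f^2) = 1.\<close>
  have ff: "f * f = e * m" unfolding m f_def power2_eq_square by simp
  obtain a where a: "a \<in> carrier A" "a [^] f \<noteq> \<one>" using least[OF f(2)] f(1) by blast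
  \<comment> \<open>Non-degeneracy moves the exponent over: \<omega>(a,h^f) = \<omega>(a^f,h) is not
    1. So h^f is not orthogonal to a and cannot lie in \<open>L1\<close>.\<close>
  then obtain h where h: "h \<in> carrier A" "\<omega> (a [^] f) h \<noteq> 1" using nondegen[of "a [^] f"] by auto
  obtain L1 where L1: "lagrangian L1" "{a} \<subseteq> L1"
    by (rule lagrangian_above[of "{a}"]) (use a alternating in auto)
  have e1: "\<omega> x y ^ e = 1" if "x \<in> carrier A" "y \<in> carrier A" for x y
    using form_pow(1)[OF that, of e] e that by simp
  obtain L2 where L2: "lagrangian L2" "(\<lambda>x. x [^] f) ` carrier A \<subseteq> L2"
  proof (rule lagrangian_above[of "(\<lambda>x. x [^] f) ` carrier A"])
    show "(\<lambda>x. x [^] f) ` carrier A \<subseteq> carrier A" by auto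
    fix r s assume "r \<in> (\<lambda>x. x [^] f) ` carrier A" "s \<in> (\<lambda>x. x [^] f) ` carrier A"
    then obtain x y where xy: "x \<in> carrier A" "y \<in> carrier A" "r = x [^] f" "s = y [^] f" by blast
    have "\<omega> r s = \<omega> x y ^ (f * f)" using xy by (simp add: form_pow power_mult)
    then show "\<omega> r s = 1" unfolding ff power_mult using e1[OF xy(1,2)] by simp
  qed
  have hL1: "h [^] f \<notin> L1"
  proof
    assume "h [^] f \<in> L1"
    moreover have "a \<in> perp L1" using L1 unfolding lagrangian_def by auto
    ultimately have "\<omega> a (h [^] f) = 1" unfolding perp_def by blast
    then show False using h form_pow[OF a(1) h(1), of f] form_pow[OF h(1) a(1), of f] by simp
  qed
  obtain \<Gamma> :: "nat monoid" and s \<psi> \<phi> where \<Gamma>: "group \<Gamma>" "bij_betw s {..<n} (carrier \<Gamma>)"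
    and q1: "quotient_morphism B T M (elementary_grading n \<Gamma> s) \<psi> \<phi>"
    and ker1: "\<And>a. a \<in> carrier A \<Longrightarrow> \<phi> a = \<one>\<^bsub>\<Gamma>\<^esub> \<longleftrightarrow> a \<in> L1"
    using lagrangian_crossed_product[OF L1(1)] by blast
  obtain \<Delta> :: "nat monoid" and t \<psi>' \<phi>' where \<Delta>: "group \<Delta>" "bij_betw t {..<n} (carrier \<Delta>)"
    and q2: "quotient_morphism B T M (elementary_grading n \<Delta> t) \<psi>' \<phi>'"
    and ker2: "\<And>a. a \<in> carrier A \<Longrightarrow> \<phi>' a = \<one>\<^bsub>\<Delta>\<^esub> \<longleftrightarrow> a \<in> L2"
    using lagrangian_crossed_product[OF L2(1)] by blast
  have t: "t \<in> {..<n} \<rightarrow> carrier \<Delta>" using bij_betwE[OF \<Delta>(2)] by blast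
  have "grading_class M M (elementary_grading n \<Gamma> s) = grading_class M M (elementary_grading n \<Delta> t)"
    by (rule uniq[OF crossed_product_quotient_class(3)[OF \<Gamma> q1] crossed_product_quotient_class(3)[OF \<Delta> q2]])
  then have "elementary_grading n \<Delta> t \<in> grading_class M M (elementary_grading n \<Gamma> s)"
    using grading_class_self[OF elementary_connected[OF \<Delta>(1) t q2]] by simp
  then obtain \<theta> where \<theta>: "\<theta> \<in> iso \<Gamma> \<Delta>"
    unfolding grading_class_def graded_equivalent_def mem_Collect_eq fst_gradings by blast
  interpret \<phi>: group_hom A \<Gamma> \<phi>
    using q1 is_group \<Gamma>(1) unfolding quotient_morphism_def fst_gradings
    by (simp add: group_hom_def group_hom_axioms_def)
  interpret \<phi>': group_hom A \<Delta> \<phi>'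
    using q2 is_group \<Delta>(1) unfolding quotient_morphism_def fst_gradings
    by (simp add: group_hom_def group_hom_axioms_def)
  interpret \<theta>: group_hom \<Gamma> \<Delta> \<theta>
    using \<theta> \<Gamma>(1) \<Delta>(1) by (simp add: group_hom_def group_hom_axioms_def iso_def)
  have "\<theta> (\<phi> h) \<in> \<phi>' ` carrier A"
    using q2 h(1) \<phi>.hom_closed \<theta>.hom_closed unfolding quotient_morphism_def fst_gradings by simp
  \<comment> \<open>Under an isomorphism of the two quotient groups the class of h corresponds to
    that of some x. Since x^f lies in \<open>L2\<close>, the f-th power of the class of h would be
    trivial as well.\<close>
  then obtain x where x: "x \<in> carrier A" "\<theta> (\<phi> h) = \<phi>' x" by blast
  have "\<theta> (\<phi> (h [^] f)) = \<phi>' (x [^] f)"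
    using h(1) x by (simp add: \<phi>.hom_nat_pow \<phi>'.hom_nat_pow \<theta>.hom_nat_pow)
  also have "\<dots> = \<one>\<^bsub>\<Delta>\<^esub>" using ker2[of "x [^] f"] x(1) L2(2) by auto
  finally have eq1: "\<theta> (\<phi> (h [^] f)) = \<theta> \<one>\<^bsub>\<Gamma>\<^esub>" by simp
  have inj: "inj_on \<theta> (carrier \<Gamma>)" using \<theta> by (simp add: iso_def bij_betw_def)
  have "\<phi> (h [^] f) = \<one>\<^bsub>\<Gamma>\<^esub>"
    by (rule inj_onD[OF inj eq1]) (use h(1) in simp_all)
  then show False using ker1[of "h [^] f"] h(1) hL1 by simp
qed

lemma maximal_class_exists: "\<exists>X. maximal_class M EQ X"
proof -
  \<comment> \<open>The empty set is isotropic, so a Lagrangian exists.\<close>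
  obtain L where L: "lagrangian L" using lagrangian_above[of "{}"] by blast
  obtain \<Gamma> :: "nat monoid" and s \<psi> \<phi> where \<Gamma>: "group \<Gamma>" "bij_betw s {..<n} (carrier \<Gamma>)"
    and q: "quotient_morphism B T M (elementary_grading n \<Gamma> s) \<psi> \<phi>"
    by (rule lagrangian_crossed_product[OF L])
  show ?thesis using crossed_product_quotient_class(3)[OF \<Gamma> q] by blast
qed

end

theorem theoremD:
  fixes A :: "'a monoid" and \<alpha> :: "'a \<Rightarrow> 'a \<Rightarrow> complex" and n :: nat
  assumes "comm_group A" and "central_type A" and "Coset.order A = n\<^sup>2"
    and "nondegenerate A \<alpha>"
  shows "(\<forall>X \<in> elementary_quotient_classes n A \<alpha>.
      maximal_class (matrix_algebra n) (elementary_quotient_classes n A \<alpha>) X \<longleftrightarrow>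
      elementary_crossed_product_class n X) \<and>
    ((\<exists>!X. maximal_class (matrix_algebra n) (elementary_quotient_classes n A \<alpha>) X) \<longleftrightarrow>
      (\<forall>a\<in>carrier A. squarefree (group.ord A a)))"
proof -
  interpret comm_group A by fact
  interpret nondegenerate_twist A \<alpha> n
    using assms by unfold_locales (auto simp: central_type_def)
  have "maximal_class M EQ X \<longleftrightarrow> elementary_crossed_product_class n X" if "X \<in> EQ" for X
    using crossed_product_class_maximal[OF that] maximal_class_crossed_product by blast
  moreover have "(\<exists>!X. maximal_class M EQ X) \<longleftrightarrow> (\<forall>a\<in>carrier A. squarefree (ord a))"
  proof
    assume "\<exists>!X. maximal_class M EQ X"
    then show "\<forall>a\<in>carrier A. squarefree (ord a)"
      by (intro ballI squarefree_if_maximal_class_unique) blast+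
  next
    assume "\<forall>a\<in>carrier A. squarefree (ord a)"
    then show "\<exists>!X. maximal_class M EQ X"
      using maximal_class_exists maximal_class_unique_if_squarefree by (intro ex_ex1I)
  qed
  ultimately show ?thesis by blast
qed

end
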